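(* Let $N\ge1$ be an integer, $\lambda>0$ a real number and $\mathbf n\in\mathbb Z^N$. Define $$P_{\mathbf n}=\sum_{\mathbf m\in\mathbb Z^N}\beta_{\mathbf n}(\mathbf m)\,f^{(H)}_{\mathbf m},$$ where the functions $f^{(H)}_{\mathbf m}$ are as in the context and $$\beta_{\mathbf n}(\mathbf m)=\delta_{\mathbf n}(\mathbf m)+\sum_{s=1}^\infty\ \sum_{j_1<k_1}\sum_{t_1,u_1,\nu_1=0}^\infty\cdots\sum_{j_s<k_s}\sum_{t_s,u_s,\nu_s=0}^\infty\delta_{\mathbf n}\Bigl(\mathbf m+\sum_{r=1}^s\mathbf E_{j_rk_r}^{t_ru_r,\nu_r}\Bigr)\prod_{r=1}^s\frac{g_{j_rk_r}^{t_ru_r}\bigl(\nu_r;\ \mathbf n-\sum_{\ell=1}^r\mathbf E_{j_\ell k_\ell}^{t_\ell u_\ell,\nu_\ell}\bigr)}{4\sum_{\ell=1}^r(1+t_\ell+u_\ell)},$$ each sum $\sum_{j_r<k_r}$ being over $1\le j_r<k_r\le N$, with $$g_{jk}^{tu}(\nu;\mathbf m)=2\lambda(\lambda-1)\,\nu\; b_t(\nu-1,\ \tilde m_j+1+2t-\nu)\; b_u(-1-\nu,\ \tilde m_k+1+2u+\nu),$$ $$\mathbf E_{jk}^{tu,\nu}=(1+2t-\nu)\mathbf e_j+(1+2u+\nu)\mathbf e_k,\qquad \tilde m_j=m_j+\lambda(N+1-j),$$ and the coefficients $b_s(n,a)$ given in the context. Then $P_{\mathbf n}$ is a reduced polynomial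 eigenfunction of the Calogero model corresponding to the eigenvalue $E_{\mathbf n}=2(n_1+\cdots+n_N)+N(1+\lambda(N-1))$; that is, $P_{\mathbf n}$ is a symmetric polynomial in $x_1,\dots,x_N$ and $$H(\psi_0P_{\mathbf n})=E_{\mathbf n}\,\psi_0P_{\mathbf n}.$$
   Context: The Calogero Hamiltonian is the differential operator $$H=\sum_{j=1}^N\left(-\partial_{x_j}^2+x_j^2\right)+2\lambda(\lambda-1)\sum_{1\le j<k\le N}\frac{1}{(x_j-x_k)^2},$$ and $$\psi_0(\mathbf x)=\prod_{j=1}^N e^{-\frac12x_j^2}\prod_{1\le j<k\le N}(x_k-x_j)^\lambda .$$ The eigenvalue equation is a differential identity at points $\mathbf x\in\mathbb R^N$ with pairwise distinct coordinates; one may take the region $x_1<x_2<\cdots<x_N$, where $\psi_0>0$. $\mathbf e_j$ is the $j$-th standard basis vector, and $\delta_{\mathbf n}(\mathbf m)=\delta_{\mathbf n,\mathbf m}$ is the Kronecker delta. $(z)_0=1$, $(z)_n=z(z+1)\cdots(z+n-1)$ is the Pochhammer symbol. For $a\in\mathbb C$ let $p_a$ be the formal series $$p_a(x)=\sum_{s=0}^\infty c_s(a)\,x^{a-2s},\qquad c_s(a)=(-1)^s\frac{(a-2s+1)_{2s}}{4^s s!}.$$ For $s\in\mathbb N_0$, $n\in\mathbb Z$, $a\in\mathbb C$ put $$b_s(n,a)=(-1)^s\frac{(a-2s+1)_{2s}}{4^s s!}+\sum_{j=1}^s(-1)^{j+s}\sum_{0\le s_j<s_{j-1}<\cdots<s_1<s}\frac{(a-2s_j+1)_{2s_j}\,(a+n-2s+1)_{2(s-s_j)}}{4^s\,s_j!\,(s_{j-1}-s_j)!\cdots(s_1-s_2)!\,(s-s_1)!}$$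 (for $j=1$ the denominator is $4^s s_1!(s-s_1)!$). These are the coefficients in the formal expansion $x^np_a(x)=\sum_{s\ge0}b_s(n,a)\,p_{a+n-2s}(x)$. For $\mathbf n\in\mathbb Z^N$, $\mathbf x\in\mathbb R^N$, $\epsilon>0$ let $\mathcal C_j$ be the positively oriented circle in $\mathbb C$ centred at $0$ of radius $\max_{1\le k\le N}|x_k|+\epsilon j$, and, with $\tilde n_j=n_j+\lambda(N+1-j)$, let $$f^{(H)}_{\mathbf n}(\mathbf x)=\prod_{j=1}^N\left(\oint_{\mathcal C_j}\frac{dy_j}{2\pi i\,y_j}\,y_j\,p_{\tilde n_j-1}(y_j)\,y_j^{\lambda(j-N-1)}\right)\frac{\prod_{1\le j<k\le N}(1-y_j/y_k)^\lambda}{\prod_{j,k=1}^N(1-x_j/y_k)^\lambda},$$ where the integral is understood termwise: the series $p_{\tilde n_j-1}(y_j)$ are inserted formally (so that $y_jp_{\tilde n_j-1}(y_j)y_j^{\lambda(j-N-1)}=\sum_{s\ge0}c_s(\tilde n_j-1)y_j^{n_j-2s}$), integrations and summations over $s$ are interchanged, and only finitely many of the resulting terms are non-zero. Powers with exponent $\pm\lambda$ in the fraction are given by binomial series in $y_j/y_k$, $j<k$, and $x_j/y_k$. Equivalently, $f^{(H)}_{\mathbf n}(\mathbf x)$ is the coefficient of $(y_1\cdots y_N)^{-1}$ in the formal Laurent series $\prod_jp_{\tilde n_j-1}(y_j)y_j^{\lambda(j-N-1)}$ times the fraction. "Reduced polynomial eigenfunction with eigenvalue $E$" means a symmetric polynomial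 $P$ with $H(\psi_0P)=E\psi_0P$; non-vanishing of $P$ is not part of the assertion. The sums defining $\beta_{\mathbf n}(\mathbf m)$ and $P_{\mathbf n}$ contain only finitely many non-zero terms.
   Formalization: In g_jk^{tu}(ν;m) the second arguments of b_t and b_u are taken as m̃_j+2t−ν and m̃_k+2u+ν (one less than printed); with the printed +1 the eigenvalue equation fails, e.g. for N=2, λ=2, n=(1,3), where P is off by the constant 1/2. *)

theory Defs
  imports "HOL-Analysis.Analysis"
begin

text \<open>
  A vector of length \<open>N\<close> (a point of real \<open>N\<close>-space or an integer vector) is a function on \<open>nat\<close>
  of which only the values at the indices \<open>1..N\<close> are used.  All sums written with \<open>\<Sum>\<^sub>\<infinity>\<close> below have
  only finitely many non-zero terms.
\<close>

definition index_pairs :: "nat \<Rightarrow> (nat \<times> nat) set" where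
  "index_pairs N = {(j, k). 1 \<le> j \<and> j < k \<and> k \<le> N}"


subsection \<open>The Calogero Hamiltonian\<close>

definition partial2 :: "nat \<Rightarrow> ((nat \<Rightarrow> real) \<Rightarrow> real) \<Rightarrow> (nat \<Rightarrow> real) \<Rightarrow> real" where
  "partial2 j F x = deriv (deriv (\<lambda>z. F (x(j := z)))) (x j)"

definition calogero_H ::
  "nat \<Rightarrow> real \<Rightarrow> ((nat \<Rightarrow> real) \<Rightarrow> real) \<Rightarrow> (nat \<Rightarrow> real) \<Rightarrow> real" where
  "calogero_H N lam F x =
     (\<Sum>j=1..N. - partial2 j F x + (x j)^2 * F x)
     + 2 * lam * (lam - 1) * (\<Sum>(j, k)\<in>index_pairs N. 1 / (x j - x k)^2) * F x"

definition psi0 :: "nat \<Rightarrow> real \<Rightarrow> (nat \<Rightarrow> real) \<Rightarrow> real" where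
  "psi0 N lam x =
     (\<Prod>j=1..N. exp (- ((x j)^2) / 2)) * (\<Prod>(j, k)\<in>index_pairs N. (x k - x j) powr lam)"

text \<open>Polynomials in \<open>x\<^sub>1, \<dots>, x\<^sub>N\<close> are identified with polynomial functions;
  \<open>A\<close> is a finite set of exponent vectors.\<close>

definition polynomial_in :: "nat \<Rightarrow> ((nat \<Rightarrow> real) \<Rightarrow> real) \<Rightarrow> bool" where
  "polynomial_in N P \<longleftrightarrow>
     (\<exists>(A :: (nat \<Rightarrow> nat) set) (c :: (nat \<Rightarrow> nat) \<Rightarrow> real).
        finite A \<and> (\<forall>x. P x = (\<Sum>\<alpha>\<in>A. c \<alpha> * (\<Prod>j=1..N. x j ^ \<alpha> j))))"

definition symmetric_in :: "nat \<Rightarrow> ((nat \<Rightarrow> real) \<Rightarrow> real) \<Rightarrow> bool" where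
  "symmetric_in N P \<longleftrightarrow> (\<forall>\<pi>. \<pi> permutes {1..N} \<longrightarrow> (\<forall>x. P (\<lambda>j. x (\<pi> j)) = P x))"

text \<open>The differential identity is required on the open region \<open>x\<^sub>1 < \<dots> < x\<^sub>N\<close>, where \<open>\<psi>\<^sub>0 > 0\<close>.\<close>

definition reduced_polynomial_eigenfunction ::
  "nat \<Rightarrow> real \<Rightarrow> ((nat \<Rightarrow> real) \<Rightarrow> real) \<Rightarrow> real \<Rightarrow> bool" where
  "reduced_polynomial_eigenfunction N lam P E \<longleftrightarrow>
     polynomial_in N P \<and> symmetric_in N P \<and>
     (\<forall>x. strict_mono_on {1..N} x \<longrightarrow>
        calogero_H N lam (\<lambda>y. psi0 N lam y * P y) x = E * (psi0 N lam x * P x))"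


subsection \<open>The series \<open>p\<^sub>a\<close> and the coefficients of \<open>x\<^sup>n p\<^sub>a\<close>\<close>

definition p_coeff :: "nat \<Rightarrow> 'a::field_char_0 \<Rightarrow> 'a" where
  "p_coeff s a = (-1) ^ s * pochhammer (a - 2 * of_nat s + 1) (2 * s) / (4 ^ s * fact s)"

text \<open>A chain \<open>s > s\<^sub>1 > \<dots> > s\<^sub>j \<ge> 0\<close> is the list \<open>[s\<^sub>1, \<dots>, s\<^sub>j]\<close>.\<close>

definition chains :: "nat \<Rightarrow> nat \<Rightarrow> nat list set" where
  "chains s j = {\<sigma>. length \<sigma> = j \<and> set \<sigma> \<subseteq> {..<s} \<and> sorted_wrt (>) \<sigma>}"

definition b_coeff :: "nat \<Rightarrow> int \<Rightarrow> 'a::field_char_0 \<Rightarrow> 'a" where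
  "b_coeff s n a =
     (-1) ^ s * pochhammer (a - 2 * of_nat s + 1) (2 * s) / (4 ^ s * fact s)
     + (\<Sum>j=1..s. (-1) ^ (j + s) *
         (\<Sum>\<sigma>\<in>chains s j.
            pochhammer (a - 2 * of_nat (last \<sigma>) + 1) (2 * last \<sigma>)
            * pochhammer (a + of_int n - 2 * of_nat s + 1) (2 * (s - last \<sigma>))
            / (4 ^ s * fact (last \<sigma>) * (\<Prod>i<j. fact ((s # \<sigma>) ! i - (s # \<sigma>) ! Suc i)))))"


subsection \<open>The functions \<open>f\<^sub>n\<close>\<close>

definition shifted :: "nat \<Rightarrow> real \<Rightarrow> (nat \<Rightarrow> int) \<Rightarrow> nat \<Rightarrow> real" where
  "shifted N lam n j = of_int (n j) + lam * (real N + 1 - real j)"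

text \<open>
  \<open>f\<^sub>n(x)\<close> is the coefficient of \<open>(y\<^sub>1 \<cdots> y\<^sub>N)\<^sup>-\<^sup>1\<close> in the product of the formal series
  \<^item> \<open>p\<^sub>a(y\<^sub>j) y\<^sub>j\<^sup>b = \<Sum>s. c\<^sub>s(a) y\<^sub>j\<^bsup>a - 2 s + b\<^esup>\<close> with \<open>a = shifted N lam n j - 1\<close> and
    \<open>b = lam (j - N - 1)\<close>, for each \<open>j\<close> (summation index \<open>s j\<close>);
  \<^item> \<open>(1 - y\<^sub>j / y\<^sub>k)\<^bsup>lam\<^esup> = \<Sum>r. (lam choose r) (-1)\<^sup>r y\<^sub>j\<^sup>r y\<^sub>k\<^bsup>-r\<^esup>\<close>, for each \<open>j < k\<close>
    (summation index \<open>p (j, k)\<close>);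
  \<^item> \<open>(1 - x\<^sub>j / y\<^sub>k)\<^bsup>-lam\<^esup> = \<Sum>r. (-lam choose r) (-x\<^sub>j)\<^sup>r y\<^sub>k\<^bsup>-r\<^esup>\<close>, for all \<open>j, k\<close>
    (summation index \<open>q (j, k)\<close>).

  The coefficient is the sum over all choices of one term from each factor for which every \<open>y\<^sub>j\<close>
  has total exponent \<open>-1\<close>.
\<close>

definition y_exponent ::
  "nat \<Rightarrow> real \<Rightarrow> (nat \<Rightarrow> int) \<Rightarrow> (nat \<Rightarrow> nat) \<Rightarrow> (nat \<times> nat \<Rightarrow> nat) \<Rightarrow> (nat \<times> nat \<Rightarrow> nat)
   \<Rightarrow> nat \<Rightarrow> real" where
  "y_exponent N lam n s p q j =
     (shifted N lam n j - 1) - 2 * real (s j) + lam * (real j - real N - 1)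
     + (\<Sum>k\<in>{j<..N}. real (p (j, k))) - (\<Sum>i\<in>{1..<j}. real (p (i, j)))
     - (\<Sum>i\<in>{1..N}. real (q (i, j)))"

definition f_H :: "nat \<Rightarrow> real \<Rightarrow> (nat \<Rightarrow> int) \<Rightarrow> (nat \<Rightarrow> real) \<Rightarrow> real" where
  "f_H N lam n x =
     (\<Sum>\<^sub>\<infinity>(s, p, q)\<in>{(s, p, q).
          s \<in> {1..N} \<rightarrow>\<^sub>E UNIV \<and> p \<in> index_pairs N \<rightarrow>\<^sub>E UNIV \<and> q \<in> {1..N} \<times> {1..N} \<rightarrow>\<^sub>E UNIV \<and>
          (\<forall>j\<in>{1..N}. y_exponent N lam n s p q j = -1)}.
        (\<Prod>j=1..N. p_coeff (s j) (shifted N lam n j - 1))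
        * (\<Prod>jk\<in>index_pairs N. (lam gchoose p jk) * (-1) ^ p jk)
        * (\<Prod>(j, k)\<in>{1..N} \<times> {1..N}. ((- lam) gchoose q (j, k)) * (- x j) ^ q (j, k)))"


subsection \<open>The coefficients \<open>\<beta>\<close> and the functions \<open>P\<close>\<close>

text \<open>A step \<open>(j, k, t, u, v)\<close> collects the summation indices \<open>j < k\<close> and \<open>t, u, \<nu>\<close>.\<close>

type_synonym step = "nat \<times> nat \<times> nat \<times> nat \<times> nat"

definition steps :: "nat \<Rightarrow> step set" where
  "steps N = {(j, k, t, u, v). (j, k) \<in> index_pairs N}"

definition E_vec :: "step \<Rightarrow> nat \<Rightarrow> int" where
  "E_vec = (\<lambda>(j, k, t, u, v) i.
     (1 + 2 * int t - int v) * of_bool (i = j) + (1 + 2 * int u + int v) * of_bool (i = k))"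

text \<open>
  The last arguments of \<open>b_coeff\<close> are the exponents \<open>a\<close> of the series \<open>p\<^sub>a\<close> in \<open>f_H N lam (m + E)\<close>,
  where \<open>E\<close> is the vector of the step: \<open>shifted N lam (m + E) j - 1 = shifted N lam m j + 2 t - v\<close>,
  and likewise \<open>shifted N lam m k + 2 u + v\<close> at \<open>k\<close>.  The formula in the source has these arguments
  larger by one (it omits the \<open>-1\<close>); with it the eigenvalue equation fails, for example
  for \<open>N = 2\<close>, \<open>lam = 2\<close>, \<open>n = (1, 3)\<close>.
\<close>

definition g_coeff :: "nat \<Rightarrow> real \<Rightarrow> step \<Rightarrow> (nat \<Rightarrow> int) \<Rightarrow> real" where
  "g_coeff N lam = (\<lambda>(j, k, t, u, v) m.
     2 * lam * (lam - 1) * real v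
     * b_coeff t (int v - 1) (shifted N lam m j + 2 * real t - real v)
     * b_coeff u (- 1 - int v) (shifted N lam m k + 2 * real u + real v))"

definition step_weight :: "step \<Rightarrow> nat" where
  "step_weight = (\<lambda>(j, k, t, u, v). 1 + t + u)"

definition kronecker :: "nat \<Rightarrow> (nat \<Rightarrow> int) \<Rightarrow> (nat \<Rightarrow> int) \<Rightarrow> real" where
  "kronecker N n m = (if \<forall>i\<in>{1..N}. n i = m i then 1 else 0)"

text \<open>The lists \<open>w\<close> of length \<open>s\<close> are the choices of \<open>s\<close> successive steps; they are indexed from \<open>0\<close>.\<close>

definition beta :: "nat \<Rightarrow> real \<Rightarrow> (nat \<Rightarrow> int) \<Rightarrow> (nat \<Rightarrow> int) \<Rightarrow> real" where
  "beta N lam n m =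
     kronecker N n m
     + (\<Sum>\<^sub>\<infinity>s\<in>{1..}. \<Sum>\<^sub>\<infinity>w\<in>{w. length w = s \<and> set w \<subseteq> steps N}.
          kronecker N n (\<lambda>i. m i + (\<Sum>r<s. E_vec (w ! r) i))
          * (\<Prod>r<s. g_coeff N lam (w ! r) (\<lambda>i. n i - (\<Sum>l\<le>r. E_vec (w ! l) i))
                    / (4 * (\<Sum>l\<le>r. real (step_weight (w ! l))))))"

definition calogero_P :: "nat \<Rightarrow> real \<Rightarrow> (nat \<Rightarrow> int) \<Rightarrow> (nat \<Rightarrow> real) \<Rightarrow> real" where
  "calogero_P N lam n x = (\<Sum>\<^sub>\<infinity>m\<in>{1..N} \<rightarrow>\<^sub>E (UNIV :: int set). beta N lam n m * f_H N lam m x)"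

definition calogero_E :: "nat \<Rightarrow> real \<Rightarrow> (nat \<Rightarrow> int) \<Rightarrow> real" where
  "calogero_E N lam n = 2 * (\<Sum>j=1..N. of_int (n j)) + real N * (1 + lam * (real N - 1))"

end

theory Submission
  imports Defs
begin

text \<open>
  The functions \<open>f\<close> are obtained from the kernel
  \<open>\<Phi>(x, y) = \<Prod>\<^sub>j\<^sub><\<^sub>k (1 - y\<^sub>j/y\<^sub>k)\<^bsup>lam\<^esup> / \<Prod>\<^sub>j\<^sub>,\<^sub>k (1 - x\<^sub>j/y\<^sub>k)\<^bsup>lam\<^esup>\<close>, whose logarithmic derivatives are sums of
  simple poles.  Partial fractions show that on \<open>\<Phi>\<close>, multiplied by \<open>\<Prod>\<^sub>j y\<^sub>j\<^bsup>lam (j - N - 1)\<^esup>\<close>, the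
  operator conjugated by \<open>\<psi>\<^sub>0\<close>, without its Euler term \<open>2 \<Sum>\<^sub>j x\<^sub>j \<partial>/\<partial>x\<^sub>j\<close>, acts as
  \<open>-\<Delta>\<^sub>y + 2 lam (lam - 1) \<Sum>\<^sub>j\<^sub><\<^sub>k (y\<^sub>j - y\<^sub>k)\<^sup>-\<^sup>2\<close>.  Comparing coefficients gives a recurrence
  for the coefficients of \<open>\<Phi>\<close>.  Summed against the coefficients of the series \<open>p\<^sub>a\<close>, which solve
  \<open>-p'' + 2 y p' = 2 a p\<close>, it shows that the conjugated operator is triangular on the functions \<open>f\<close>: the diagonal
  entry at \<open>n\<close> is \<open>2 (n\<^sub>1 + \<dots> + n\<^sub>N)\<close>, and the interaction lowers \<open>n\<close> by the vectors \<open>E\<close> with weights \<open>g\<close>.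
  The coefficients \<open>\<beta>\<close> solve the resulting triangular system.

  To have all expansions as formal power series in a single variable \<open>T\<close>, we put \<open>1/y\<^sub>k = z\<^sub>k T\<^sup>k\<close> with real
  \<open>z\<^sub>k > 0\<close>.  Every coefficient of a power of \<open>T\<close> is then a Laurent polynomial in \<open>z\<close>, so derivatives in \<open>x\<close> and
  \<open>z\<close> are taken coefficientwise and the coefficients in \<open>z\<close> can be compared at the end.
\<close>

text \<open>The substitution encodes the nesting of the circles: y_j/y_k becomes (z_k/z_j) T^(k-j)
  and x_i/y_k becomes x_i z_k T^k, so for j < k every factor of the kernel is a power series in T
  with constant term 1. Real power series form an integral domain, hence partial fractions may be
  verified by clearing denominators. The obstacle is that f, beta and P are given as infinite sums.
  All exponents of the kernel lie in the cone of vectors whose tails m_k + ... + m_N are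
  non-negative. Subtracting 2 s or a vector E from n never raises a tail, so one bound M on the
  tails of n truncates every sum at once; terms beyond it leave the cone and vanish. A step lowers
  n_1 + ... + n_N by 2 (1+t+u), hence the diagonal entry by 4 (1+t+u). The denominators of beta are
  these positive energy differences, accumulated along the path, so no resonance can occur.\<close>

unbundle no vec_syntax
unbundle fps_syntax

subsection \<open>Binomial series and coefficientwise derivatives\<close>

text \<open>The series of (1 - a T^m)^c for real c. With c = -1 it is a geometric series, from which
  all poles below are built.\<close>

definition binom_fps :: "real \<Rightarrow> real \<Rightarrow> nat \<Rightarrow> real fps" where
  "binom_fps c a m = fps_compose (fps_binomial c) (fps_const (- a) * fps_X ^ m)"

lemma binom_fps_nth:
  assumes "m > 0"
  shows "binom_fps c a m $ n =
    (if m dvd n then (c gchoose (n div m)) * (- a) ^ (n div m) else 0)"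
proof -
  have "binom_fps c a m $ n = (\<Sum>i=0..n. (c gchoose i) * ((- a) ^ i * (if n = m * i then 1 else 0)))"
    unfolding binom_fps_def fps_compose_nth
    by (intro sum.cong refl)
       (simp add: power_mult_distrib fps_const_power power_mult [symmetric] fps_X_power_nth
             del: fps_const_neg)
  also have "\<dots> = (\<Sum>i\<in>(if m dvd n then {n div m} else {}).
      (c gchoose i) * ((- a) ^ i * (if n = m * i then 1 else 0)))"
    using assms by (intro sum.mono_neutral_right) (auto simp: div_le_dividend)
  also have "\<dots> = (if m dvd n then (c gchoose (n div m)) * (- a) ^ (n div m) else 0)"
    by auto
  finally show ?thesis .
qed

lemma binom_fps_add:
  assumes "m > 0"
  shows "binom_fps (c + d) a m = binom_fps c a m * binom_fps d a m"
  using assms by (simp add: binom_fps_def fps_binomial_add_mult fps_compose_mult_distrib)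

lemma binom_fps_one:
  assumes "m > 0"
  shows "binom_fps 1 a m = 1 - fps_const a * fps_X ^ m"
  using assms by (simp add: binom_fps_def fps_binomial_1 fps_compose_add_distrib flip: fps_const_neg)

lemma binom_fps_zero: "binom_fps 0 a m = 1"
  by (simp add: binom_fps_def)

lemma binom_fps_minus_one:
  assumes "m > 0"
  shows "binom_fps (-1) a m * (1 - fps_const a * fps_X ^ m) = 1"
proof -
  have "binom_fps (-1) a m * binom_fps 1 a m = 1"
    using binom_fps_add[OF assms, of "-1" 1 a] by (simp add: binom_fps_zero)
  then show ?thesis by (simp add: binom_fps_one[OF assms])
qed

section \<open>Derivatives of power series with respect to a real parameter\<close>

definition has_fps_derivative_at :: "(real \<Rightarrow> real fps) \<Rightarrow> real fps \<Rightarrow> real \<Rightarrow> bool" where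
  "has_fps_derivative_at F F' t \<longleftrightarrow> (\<forall>n. ((\<lambda>s. F s $ n) has_real_derivative F' $ n) (at t))"

lemma has_fps_derivative_at_const: "has_fps_derivative_at (\<lambda>_. F) 0 t"
  by (simp add: has_fps_derivative_at_def)

lemma has_fps_derivative_at_fps_const:
  assumes "(f has_real_derivative f') (at t)"
  shows "has_fps_derivative_at (\<lambda>s. fps_const (f s)) (fps_const f') t"
  unfolding has_fps_derivative_at_def
proof
  fix n show "((\<lambda>s. fps_const (f s) $ n) has_real_derivative fps_const f' $ n) (at t)"
    using assms by (cases n) auto
qed

lemma has_fps_derivative_at_add:
  "has_fps_derivative_at F F' t \<Longrightarrow> has_fps_derivative_at G G' t
    \<Longrightarrow> has_fps_derivative_at (\<lambda>s. F s + G s) (F' + G') t"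
  by (auto simp: has_fps_derivative_at_def intro!: derivative_intros)

lemma has_fps_derivative_at_minus:
  "has_fps_derivative_at F F' t \<Longrightarrow> has_fps_derivative_at (\<lambda>s. - F s) (- F') t"
  by (auto simp: has_fps_derivative_at_def intro!: derivative_intros)

lemma has_fps_derivative_at_diff:
  "has_fps_derivative_at F F' t \<Longrightarrow> has_fps_derivative_at G G' t
    \<Longrightarrow> has_fps_derivative_at (\<lambda>s. F s - G s) (F' - G') t"
  by (auto simp: has_fps_derivative_at_def intro!: derivative_intros)

lemma has_fps_derivative_at_mult:
  assumes "has_fps_derivative_at F F' t" "has_fps_derivative_at G G' t"
  shows "has_fps_derivative_at (\<lambda>s. F s * G s) (F' * G t + F t * G') t"
  unfolding has_fps_derivative_at_def
proof
  fix n
  have "((\<lambda>s. \<Sum>i=0..n. F s $ i * G s $ (n - i)) has_real_derivative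
      (\<Sum>i=0..n. F' $ i * G t $ (n - i) + G' $ (n - i) * F t $ i)) (at t)"
    using assms unfolding has_fps_derivative_at_def by (auto intro!: derivative_eq_intros)
  then show "((\<lambda>s. (F s * G s) $ n) has_real_derivative (F' * G t + F t * G') $ n) (at t)"
    by (simp add: fps_mult_nth sum.distrib mult.commute[of "F t $ _"])
qed

lemma has_fps_derivative_at_cmult:
  assumes "has_fps_derivative_at F F' t"
  shows "has_fps_derivative_at (\<lambda>s. C * F s) (C * F') t"
  using has_fps_derivative_at_mult[OF has_fps_derivative_at_const[of C t] assms] by simp

lemma has_fps_derivative_at_sum:
  assumes "\<And>i. i \<in> I \<Longrightarrow> has_fps_derivative_at (F i) (F' i) t"
  shows "has_fps_derivative_at (\<lambda>s. \<Sum>i\<in>I. F i s) (\<Sum>i\<in>I. F' i) t"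
  using assms by (induction I rule: infinite_finite_induct)
    (auto intro!: has_fps_derivative_at_const has_fps_derivative_at_add)

text \<open>Each factor's derivative is supplied as a multiple L i of the factor itself, so the
  product rule collapses to the sum of the L i times the unchanged product, and nothing has to be
  inverted.\<close>

lemma has_fps_derivative_at_prod:
  assumes "finite I" "\<And>i. i \<in> I \<Longrightarrow> has_fps_derivative_at (F i) (L i * F i t) t"
  shows "has_fps_derivative_at (\<lambda>s. \<Prod>i\<in>I. F i s) ((\<Sum>i\<in>I. L i) * (\<Prod>i\<in>I. F i t)) t"
  using assms
proof (induction I rule: finite_induct)
  case empty
  show ?case by (simp add: has_fps_derivative_at_const)
next
  case (insert i I)
  have "has_fps_derivative_at (\<lambda>s. F i s * (\<Prod>i\<in>I. F i s))
      (L i * F i t * (\<Prod>i\<in>I. F i t) + F i t * ((\<Sum>i\<in>I. L i) * (\<Prod>i\<in>I. F i t))) t"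
    by (intro has_fps_derivative_at_mult insert) (use insert in auto)
  then show ?case using insert(1,2) by (simp add: algebra_simps)
qed

lemma has_fps_derivative_at_unique:
  assumes "has_fps_derivative_at F F' t" "has_fps_derivative_at F F'' t"
  shows "F' = F''"
  using assms unfolding has_fps_derivative_at_def fps_eq_iff by (blast intro: DERIV_unique)

lemma gbinomial_Suc_times:
  fixes c :: real
  shows "real (Suc r) * (c gchoose Suc r) = c * ((c - 1) gchoose r)"
  using gbinomial_absorption[of r c] by simp

text \<open>The derivative - c a' T^m (1 - a T^m)^(c-1) is written with (1 - a T^m)^(-1) split off,
  which is the form that the product rule above expects. On coefficients it is r (c choose r) = c
  (c-1 choose r-1).\<close>

lemma has_fps_derivative_at_binom_fps:
  assumes m: "m > 0" and a: "(a has_real_derivative a') (at t)"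
  shows "has_fps_derivative_at (\<lambda>s. binom_fps c (a s) m)
    (fps_const (- c * a') * fps_X ^ m * binom_fps (-1) (a t) m * binom_fps c (a t) m) t"
proof -
  have eq: "fps_const (- c * a') * fps_X ^ m * binom_fps (-1) (a t) m * binom_fps c (a t) m
    = fps_const (- c * a') * (fps_X ^ m * binom_fps (c - 1) (a t) m)"
    using binom_fps_add[OF m, of "-1" c] by (simp add: mult.assoc)
  show ?thesis
    unfolding eq has_fps_derivative_at_def
  proof
    fix n
    show "((\<lambda>s. binom_fps c (a s) m $ n) has_real_derivative
      (fps_const (- c * a') * (fps_X ^ m * binom_fps (c - 1) (a t) m)) $ n) (at t)"
    proof (cases "m dvd n")
      case False
      then have "\<not> m dvd n - m" if "m \<le> n"
        using that by (auto dest: dvd_diffD)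
      with False show ?thesis
        by (auto simp add: binom_fps_nth m fps_X_power_mult_nth)
    next
      case True
      then obtain r where n: "n = m * r" ..
      show ?thesis
      proof (cases r)
        case 0
        with n m show ?thesis
          by (auto simp add: binom_fps_nth fps_X_power_mult_nth)
      next
        case (Suc r')
        have "((\<lambda>s. (c gchoose r) * (- a s) ^ r) has_real_derivative
            (c gchoose r) * (real r * (- a t) ^ (r - 1) * (- a'))) (at t)"
          using a by (auto intro!: derivative_eq_intros)
        also have "(c gchoose r) * (real r * (- a t) ^ (r - 1) * (- a'))
          = - c * a' * (((c - 1) gchoose r') * (- a t) ^ r')"
        proof -
          have e: "real r * (c gchoose r) = c * ((c - 1) gchoose r')"
            using gbinomial_Suc_times[of r' c] Suc by simp
          have "(c gchoose r) * (real r * (- a t) ^ (r - 1) * (- a'))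
            = (real r * (c gchoose r)) * ((- a t) ^ (r - 1) * (- a'))"
            by (simp only: mult_ac)
          then show ?thesis unfolding e using Suc by simp
        qed
        finally show ?thesis
          using n m Suc by (simp add: binom_fps_nth m fps_X_power_mult_nth)
      qed
    qed
  qed
qed

lemma finite_weighted_exponents:
  fixes m :: "'i \<Rightarrow> nat"
  assumes "finite I" "\<And>i. i \<in> I \<Longrightarrow> m i > 0"
  shows "finite {p \<in> I \<rightarrow>\<^sub>E (UNIV :: nat set). (\<Sum>i\<in>I. m i * p i) \<le> d}"
proof (rule finite_subset)
  show "{p \<in> I \<rightarrow>\<^sub>E (UNIV :: nat set). (\<Sum>i\<in>I. m i * p i) \<le> d} \<subseteq> I \<rightarrow>\<^sub>E {..d}"
  proof (intro subsetI)
    fix p assume "p \<in> {p \<in> I \<rightarrow>\<^sub>E (UNIV :: nat set). (\<Sum>i\<in>I. m i * p i) \<le> d}"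
    then have p: "p \<in> I \<rightarrow>\<^sub>E (UNIV :: nat set)" "(\<Sum>i\<in>I. m i * p i) \<le> d"
      by auto
    show "p \<in> I \<rightarrow>\<^sub>E {..d}"
    proof (rule PiE_I)
      fix i assume i: "i \<in> I"
      have "p i \<le> m i * p i" using assms(2)[OF i] by simp
      also have "\<dots> \<le> (\<Sum>i\<in>I. m i * p i)"
        using assms(1) i by (intro member_le_sum) auto
      finally show "p i \<in> {..d}" using p(2) by simp
    qed (use p in auto)
  qed
  show "finite (I \<rightarrow>\<^sub>E {..d})" using assms(1) by (intro finite_PiE) auto
qed

lemma prod_binom_fps_nth:
  assumes "finite I" "\<And>i. i \<in> I \<Longrightarrow> m i > 0"
  shows "(\<Prod>i\<in>I. binom_fps (c i) (a i) (m i)) $ d =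
    (\<Sum>p\<in>{p \<in> I \<rightarrow>\<^sub>E UNIV. (\<Sum>i\<in>I. m i * p i) = d}. \<Prod>i\<in>I. (c i gchoose p i) * (- a i) ^ p i)"
  using assms
proof (induction I arbitrary: d rule: finite_induct)
  case empty
  show ?case by (cases "d = 0") auto
next
  case (insert j I)
  define h where "h = (\<lambda>i r. (c i gchoose r) * (- a i) ^ r)"
  define Q where "Q = (\<lambda>d. {p \<in> I \<rightarrow>\<^sub>E (UNIV :: nat set). (\<Sum>i\<in>I. m i * p i) = d})"
  have mj: "m j > 0" using insert by auto
  have finQ: "finite (Q e)" for e
    by (rule finite_subset[OF _ finite_weighted_exponents[of I m e]])
       (use insert in \<open>auto simp: Q_def\<close>)
  have "(\<Prod>i\<in>insert j I. binom_fps (c i) (a i) (m i)) $ d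
      = (\<Sum>k=0..d. binom_fps (c j) (a j) (m j) $ k * (\<Prod>i\<in>I. binom_fps (c i) (a i) (m i)) $ (d - k))"
    using insert(1,2) by (simp add: fps_mult_nth)
  also have "\<dots> = (\<Sum>k=0..d. if m j dvd k then h j (k div m j) * (\<Sum>p\<in>Q (d - k). \<Prod>i\<in>I. h i (p i)) else 0)"
    using insert by (intro sum.cong) (auto simp: binom_fps_nth h_def Q_def)
  also have "\<dots> = (\<Sum>k\<in>{k \<in> {0..d}. m j dvd k}. h j (k div m j) * (\<Sum>p\<in>Q (d - k). \<Prod>i\<in>I. h i (p i)))"
    by (subst sum.inter_filter) auto
  also have "\<dots> = (\<Sum>r\<in>{r. m j * r \<le> d}. h j r * (\<Sum>p\<in>Q (d - m j * r). \<Prod>i\<in>I. h i (p i)))"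
    using mj by (intro sum.reindex_bij_witness[of _ "\<lambda>r. m j * r" "\<lambda>k. k div m j"]) auto
  also have "\<dots> = (\<Sum>(r, p)\<in>(SIGMA r:{r. m j * r \<le> d}. Q (d - m j * r)). h j r * (\<Prod>i\<in>I. h i (p i)))"
  proof -
    have "{r. m j * r \<le> d} \<subseteq> {..d}" using mj
      by (auto intro: order_trans[rotated])
    then have "finite {r. m j * r \<le> d}" by (rule finite_subset) auto
    then show ?thesis using finQ by (simp add: sum_distrib_left sum.Sigma)
  qed
  also have "\<dots> = (\<Sum>p\<in>{p \<in> insert j I \<rightarrow>\<^sub>E UNIV. (\<Sum>i\<in>insert j I. m i * p i) = d}.
      \<Prod>i\<in>insert j I. h i (p i))"
  \<comment> \<open>An exponent function on \<open>insert j I\<close> corresponds to its value at j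
    and its restriction to I; the restriction must take the value \<open>undefined\<close> at j to
    lie in the extensional function space.\<close>
  proof (rule sum.reindex_bij_witness[of _ "\<lambda>p. (p j, p(j := undefined))" "\<lambda>(r, p). p(j := r)"])
    fix x assume x: "x \<in> (SIGMA r:{r. m j * r \<le> d}. Q (d - m j * r))"
    obtain r p where xrp: "x = (r, p)" by force
    have rp: "m j * r \<le> d" "p \<in> I \<rightarrow>\<^sub>E UNIV" "(\<Sum>i\<in>I. m i * p i) = d - m j * r"
      using x unfolding xrp Q_def by auto
    have pj: "p j = undefined" using rp(2) insert(2) by (auto simp: PiE_def extensional_def)
    have s: "(\<Sum>i\<in>I. m i * (p(j := r)) i) = (\<Sum>i\<in>I. m i * p i)"
      using insert(2) by (intro sum.cong) auto
    have pr: "(\<Prod>i\<in>I. h i ((p(j := r)) i)) = (\<Prod>i\<in>I. h i (p i))"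
      using insert(2) by (intro prod.cong) auto
    show "(\<lambda>p. (p j, p(j := undefined))) ((\<lambda>(r, p). p(j := r)) x) = x"
      unfolding xrp by (simp add: fun_upd_idem pj)
    show "(\<lambda>(r, p). p(j := r)) x \<in> {p \<in> insert j I \<rightarrow>\<^sub>E UNIV. (\<Sum>i\<in>insert j I. m i * p i) = d}"
      unfolding xrp using rp insert(1,2) s by (auto simp: PiE_def extensional_def)
    show "(\<Prod>i\<in>insert j I. h i ((case x of (r, p) \<Rightarrow> p(j := r)) i)) =
         (case x of (r, p) \<Rightarrow> h j r * (\<Prod>i\<in>I. h i (p i)))"
      unfolding xrp using pr insert(1,2) by simp
  next
    fix p assume p: "p \<in> {p \<in> insert j I \<rightarrow>\<^sub>E UNIV. (\<Sum>i\<in>insert j I. m i * p i) = d}"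
    have s: "(\<Sum>i\<in>I. m i * (p(j := undefined)) i) = (\<Sum>i\<in>I. m i * p i)"
      using insert(2) by (intro sum.cong) auto
    show "(\<lambda>(r, p). p(j := r)) ((\<lambda>p. (p j, p(j := undefined))) p) = p" by simp
    show "(p j, p(j := undefined)) \<in> (SIGMA r:{r. m j * r \<le> d}. Q (d - m j * r))"
      using p s insert(1,2) unfolding Q_def by (auto simp: PiE_def extensional_def)
  qed
  finally show ?case unfolding h_def .
qed


subsection \<open>Partial fractions\<close>

lemma sum_index_pairs:
  "(\<Sum>(j, k)\<in>index_pairs N. h j k) = (\<Sum>j=1..N. \<Sum>k=1..N. if j < k then h j k else (0::'a::comm_monoid_add))"
proof -
  have "index_pairs N = {p \<in> {1..N} \<times> {1..N}. fst p < snd p}"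
    by (auto simp: index_pairs_def)
  then have "(\<Sum>(j, k)\<in>index_pairs N. h j k)
      = (\<Sum>p\<in>{1..N} \<times> {1..N}. if fst p < snd p then (case p of (j, k) \<Rightarrow> h j k) else 0)"
    by (simp add: sum.inter_filter)
  also have "\<dots> = (\<Sum>(j, k)\<in>{1..N} \<times> {1..N}. if j < k then h j k else 0)"
    by (intro sum.cong) auto
  finally show ?thesis by (simp add: sum.cartesian_product)
qed

lemma finite_index_pairs: "finite (index_pairs N)"
  by (rule finite_subset[of _ "{1..N} \<times> {1..N}"]) (auto simp: index_pairs_def)

lemma sum_square_index_pairs:
  fixes h :: "nat \<Rightarrow> nat \<Rightarrow> 'a::comm_monoid_add"
  shows "(\<Sum>j=1..N. \<Sum>k=1..N. h j k) = (\<Sum>(j, k)\<in>index_pairs N. h j k + h k j) + (\<Sum>j=1..N. h j j)"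
proof -
  have "(\<Sum>j=1..N. \<Sum>k=1..N. h j k) = (\<Sum>j=1..N. \<Sum>k=1..N. (if j < k then h j k else 0)
      + (if k < j then h j k else 0) + (if j = k then h j k else 0))"
    by (intro sum.cong) auto
  also have "\<dots> = (\<Sum>(j, k)\<in>index_pairs N. h j k)
      + (\<Sum>j=1..N. \<Sum>k=1..N. if k < j then h j k else 0) + (\<Sum>j=1..N. h j j)"
    by (simp add: sum.distrib sum_index_pairs)
  also have "(\<Sum>j=1..N. \<Sum>k=1..N. if k < j then h j k else 0) = (\<Sum>(j, k)\<in>index_pairs N. h k j)"
    by (subst sum.swap) (simp add: sum_index_pairs)
  finally show ?thesis by (simp add: sum.distrib case_prod_beta)
qed

lemma sum_index_pairs_symmetric:
  fixes h :: "nat \<Rightarrow> nat \<Rightarrow> 'a::comm_ring_1"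
  assumes "\<And>j k. h j k = h k j"
  shows "(\<Sum>j=1..N. \<Sum>k=1..N. h j k) = 2 * (\<Sum>(j, k)\<in>index_pairs N. h j k) + (\<Sum>j=1..N. h j j)"
proof -
  have "h j k + h k j = 2 * h j k" for j k using assms[of k j] by simp
  then show ?thesis unfolding sum_square_index_pairs by (simp add: sum_distrib_left case_prod_beta)
qed

text \<open>Differentiating a product over pairs in the single variable j touches only the pairs
  containing j, as smaller or as larger member. The same bookkeeping serves the kernel in z and the
  ground state in x.\<close>

lemma sum_index_pairs_incident:
  fixes f g :: "nat \<Rightarrow> 'a::comm_monoid_add"
  assumes "j \<in> {1..N}"
  shows "(\<Sum>(a, b)\<in>index_pairs N. if a = j then f b else if b = j then g a else 0)
    = (\<Sum>k=1..N. if j < k then f k else if k < j then g k else 0)"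
proof -
  have "(\<Sum>(a, b)\<in>index_pairs N. if a = j then f b else if b = j then g a else 0)
    = (\<Sum>a=1..N. \<Sum>b=1..N. (if a = j then if j < b then f b else 0 else 0)
        + (if b = j then if a < j then g a else 0 else 0))"
    unfolding sum_index_pairs by (intro sum.cong refl) auto
  also have "\<dots> = (\<Sum>b=1..N. if j < b then f b else 0) + (\<Sum>a=1..N. if a < j then g a else 0)"
  proof -
    have "(\<Sum>a=1..N. \<Sum>b=1..N. (if a = j then if j < b then f b else 0 else 0))
        = (\<Sum>b=1..N. if j < b then f b else 0)"
      using assms by (subst sum.swap) simp
    moreover have "(\<Sum>a=1..N. \<Sum>b=1..N. (if b = j then if a < j then g a else 0 else 0))
        = (\<Sum>a=1..N. if a < j then g a else 0)"
      using assms by simp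
    ultimately show ?thesis by (simp only: sum.distrib)
  qed
  also have "\<dots> = (\<Sum>k=1..N. if j < k then f k else if k < j then g k else 0)"
    by (subst sum.distrib [symmetric], intro sum.cong) auto
  finally show ?thesis .
qed

text \<open>The mixed products S j k * S j l cancel in cyclic triples. Their total X is invariant
  under relabelling, so 3 X is a sum of vanishing triples; this is why 3 has to be non-zero. It is
  applied to the poles 1/(y_j - y_k) as power series and to 1/(x_j - x_k) as real numbers.\<close>

lemma sum_square_triple:
  fixes S :: "'i \<Rightarrow> 'i \<Rightarrow> 'a::idom"
  assumes char: "(3::'a) \<noteq> 0" and anti: "\<And>j k. j \<in> I \<Longrightarrow> k \<in> I \<Longrightarrow> S k j = - S j k" and diag: "\<And>j. S j j = 0"
    and triple: "\<And>j k l. j \<in> I \<Longrightarrow> k \<in> I \<Longrightarrow> l \<in> I \<Longrightarrow> j \<noteq> k \<Longrightarrow> j \<noteq> l \<Longrightarrow> k \<noteq> l \<Longrightarrow>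
      S j k * S j l + S k j * S k l + S l j * S l k = 0"
    and "finite I"
  shows "(\<Sum>j\<in>I. (\<Sum>k\<in>I. S j k)\<^sup>2) = (\<Sum>j\<in>I. \<Sum>k\<in>I. (S j k)\<^sup>2)"
proof -
  \<comment> \<open>With the diagonal k = l removed and S j j = 0, all products with coinciding
    indices are zero, so the cyclic relation holds for every triple and the sums need no
    distinctness conditions.\<close>
  define T where "T = (\<lambda>j k l. if k = l then 0 else S j k * S j l)"
  define X where "X = (\<Sum>j\<in>I. \<Sum>k\<in>I. \<Sum>l\<in>I. T j k l)"
  have T0: "T j k l + T k j l + T l j k = 0" if "j \<in> I" "k \<in> I" "l \<in> I" for j k l
    using triple[OF that] by (auto simp: T_def diag)
  have "X = (\<Sum>j\<in>I. \<Sum>k\<in>I. \<Sum>l\<in>I. T k j l)"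
    unfolding X_def by (rule sum.swap)
  moreover have "X = (\<Sum>j\<in>I. \<Sum>k\<in>I. \<Sum>l\<in>I. T l j k)"
  proof -
    have "(\<Sum>j\<in>I. \<Sum>k\<in>I. \<Sum>l\<in>I. T l j k) = (\<Sum>j\<in>I. \<Sum>l\<in>I. \<Sum>k\<in>I. T l j k)"
      by (intro sum.cong refl sum.swap)
    also have "\<dots> = X" unfolding X_def by (rule sum.swap)
    finally show ?thesis by simp
  qed
  ultimately have "X + X + X = (\<Sum>j\<in>I. \<Sum>k\<in>I. \<Sum>l\<in>I. T j k l + T k j l + T l j k)"
    unfolding X_def by (simp add: sum.distrib)
  also have "\<dots> = 0" by (intro sum.neutral ballI T0)
  finally have "3 * X = 0" by (simp add: algebra_simps)
  with char have X: "X = 0" by simp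
  have "(\<Sum>k\<in>I. S j k)\<^sup>2 = (\<Sum>k\<in>I. (S j k)\<^sup>2) + (\<Sum>k\<in>I. \<Sum>l\<in>I. T j k l)" for j
  proof -
    have "(\<Sum>k\<in>I. S j k)\<^sup>2 = (\<Sum>k\<in>I. \<Sum>l\<in>I. S j k * S j l)"
      by (simp add: power2_eq_square sum_product)
    also have "\<dots> = (\<Sum>k\<in>I. \<Sum>l\<in>I. (if k = l then (S j k)\<^sup>2 else 0) + T j k l)"
      by (intro sum.cong) (auto simp: T_def power2_eq_square)
    also have "\<dots> = (\<Sum>k\<in>I. (S j k)\<^sup>2) + (\<Sum>k\<in>I. \<Sum>l\<in>I. T j k l)"
      using \<open>finite I\<close> by (simp add: sum.distrib)
    finally show ?thesis .
  qed
  then have "(\<Sum>j\<in>I. (\<Sum>k\<in>I. S j k)\<^sup>2) = (\<Sum>j\<in>I. \<Sum>k\<in>I. (S j k)\<^sup>2) + X"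
    by (simp add: sum.distrib X_def)
  with X show ?thesis by simp
qed

text \<open>For R k = 1/(y_k - x) and S k l = 1/(y_k - y_l) the hypothesis is the partial fraction
  decomposition of 1/((y_k - x)(y_l - x)); the two halves of the mixed sum agree after exchanging k
  and l.\<close>

lemma sum_square_pair:
  fixes R :: "'i \<Rightarrow> 'a::comm_ring_1" and S :: "'i \<Rightarrow> 'i \<Rightarrow> 'a"
  assumes diag: "\<And>j. S j j = 0"
    and rel: "\<And>k l. k \<in> I \<Longrightarrow> l \<in> I \<Longrightarrow> k \<noteq> l \<Longrightarrow> R k * R l = - (R k * S k l + R l * S l k)"
    and "finite I"
  shows "(\<Sum>k\<in>I. R k)\<^sup>2 = (\<Sum>k\<in>I. (R k)\<^sup>2) - 2 * (\<Sum>k\<in>I. \<Sum>l\<in>I. R k * S k l)"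
proof -
  have "(\<Sum>k\<in>I. R k)\<^sup>2 = (\<Sum>k\<in>I. \<Sum>l\<in>I. R k * R l)"
    by (simp add: power2_eq_square sum_product)
  also have "\<dots> = (\<Sum>k\<in>I. \<Sum>l\<in>I. (if k = l then (R k)\<^sup>2 else 0) - R k * S k l - R l * S l k)"
    by (intro sum.cong) (auto simp: rel diag power2_eq_square)
  also have "\<dots> = (\<Sum>k\<in>I. (R k)\<^sup>2) - (\<Sum>k\<in>I. \<Sum>l\<in>I. R k * S k l) - (\<Sum>k\<in>I. \<Sum>l\<in>I. R l * S l k)"
    using \<open>finite I\<close> by (simp add: sum_subtractf)
  also have "(\<Sum>k\<in>I. \<Sum>l\<in>I. R l * S l k) = (\<Sum>k\<in>I. \<Sum>l\<in>I. R k * S k l)"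
    by (rule sum.swap)
  finally show ?thesis by (simp add: algebra_simps)
qed

section \<open>The simple poles as power series\<close>

definition eta :: "(nat \<Rightarrow> real) \<Rightarrow> nat \<Rightarrow> real fps" where
  "eta z k = fps_const (z k) * fps_X ^ k"

text \<open>In terms of \<open>y\<^sub>k = 1 / eta z k\<close> the following are \<open>1 / (y\<^sub>k - x\<^sub>i)\<close> and \<open>1 / (y\<^sub>j - y\<^sub>k)\<close>;
  the latter is expanded in \<open>y\<^sub>j / y\<^sub>k\<close> for \<open>j < k\<close>.\<close>

definition xy_pole :: "(nat \<Rightarrow> real) \<Rightarrow> (nat \<Rightarrow> real) \<Rightarrow> nat \<Rightarrow> nat \<Rightarrow> real fps" where
  "xy_pole x z i k = eta z k * binom_fps (-1) (x i * z k) k"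

definition yy_pole :: "(nat \<Rightarrow> real) \<Rightarrow> nat \<Rightarrow> nat \<Rightarrow> real fps" where
  "yy_pole z j k =
     (if j < k then - (eta z k * binom_fps (-1) (z k / z j) (k - j))
      else if k < j then eta z j * binom_fps (-1) (z j / z k) (j - k) else 0)"

lemma yy_pole_diag [simp]: "yy_pole z j j = 0"
  by (simp add: yy_pole_def)

lemma yy_pole_anti: "yy_pole z k j = - yy_pole z j k"
  by (simp add: yy_pole_def)

lemma eta_ratio:
  assumes "z j > 0" "j < k"
  shows "eta z k = fps_const (z k / z j) * fps_X ^ (k - j) * eta z j"
proof -
  have "fps_const (z k / z j) * fps_X ^ (k - j) * eta z j
     = (fps_const (z k / z j) * fps_const (z j)) * (fps_X ^ (k - j) * fps_X ^ j)"
    by (simp only: eta_def mult_ac)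
  also have "\<dots> = eta z k" using assms by (simp add: eta_def flip: power_add)
  finally show ?thesis by simp
qed

text \<open>The pole equals eta / (1 - x eta) with eta = 1/y. This cleared equation and its analogue
  for \<open>yy_pole\<close> turn the partial fraction identities into polynomial identities, after
  which the non-zero denominators are cancelled.\<close>

lemma xy_pole_eq:
  assumes "k > 0"
  shows "xy_pole x z i k * (1 - fps_const (x i) * eta z k) = eta z k"
  using binom_fps_minus_one[OF assms, of "x i * z k"]
  by (simp add: xy_pole_def eta_def mult_ac flip: fps_const_mult)

lemma yy_pole_eq:
  assumes "\<And>i. z i > 0" "j \<noteq> k"
  shows "yy_pole z j k * (eta z k - eta z j) = eta z j * eta z k"
proof -
  have *: "yy_pole z j k * (eta z k - eta z j) = eta z j * eta z k" if "j < k" for j k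
  proof -
    define \<rho> where "\<rho> = fps_const (z k / z j) * fps_X ^ (k - j)"
    have "binom_fps (-1) (z k / z j) (k - j) * (1 - \<rho>) = 1"
      using that unfolding \<rho>_def by (intro binom_fps_minus_one) auto
    moreover have "eta z k = \<rho> * eta z j"
      using eta_ratio[of z j k] assms that by (simp add: \<rho>_def)
    ultimately show ?thesis using that by (simp add: yy_pole_def) algebra
  qed
  show ?thesis
  proof (cases "j < k")
    case False
    then have "k < j" using assms by auto
    from *[OF this] show ?thesis by (simp add: yy_pole_anti[of z j k] algebra_simps)
  qed (use * in auto)
qed

lemma eta_neq:
  assumes "\<And>i. z i > 0" "j \<noteq> k"
  shows "eta z j \<noteq> eta z k"
proof
  assume "eta z j = eta z k"
  then have "eta z j $ j = eta z k $ j" by simp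
  with assms show False by (simp add: eta_def less_imp_neq[symmetric])
qed

lemma eta_neq_0: "z k > 0 \<Longrightarrow> eta z k \<noteq> 0"
  by (simp add: eta_def)

lemma xy_pole_product:
  assumes z: "\<And>i. z i > 0" and "k > 0" "l > 0" "k \<noteq> l"
  shows "xy_pole x z i k * xy_pole x z i l
    = - (xy_pole x z i k * yy_pole z k l + xy_pole x z i l * yy_pole z l k)"
proof -
  define a b r q s X where "a = eta z k" and "b = eta z l" and "r = xy_pole x z i k"
    and "q = xy_pole x z i l" and "s = yy_pole z k l" and "X = fps_const (x i)"
  have r: "r * (1 - X * a) = a" and q: "q * (1 - X * b) = b"
    unfolding r_def q_def a_def b_def X_def using assms by (auto intro: xy_pole_eq)
  have s: "s * (b - a) = a * b"
    unfolding s_def a_def b_def using assms by (intro yy_pole_eq) auto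
  \<comment> \<open>Each factor of the multiplier clears one denominator. What remains is a b (b -
    a) + (a (1 - X b) - b (1 - X a)) a b = 0.\<close>
  have "(r * q + (r - q) * s) * ((b - a) * (1 - X * a) * (1 - X * b))
    = (r * (1 - X * a)) * (q * (1 - X * b)) * (b - a)
      + ((r * (1 - X * a)) * (1 - X * b) - (q * (1 - X * b)) * (1 - X * a)) * (s * (b - a))"
    by (simp add: algebra_simps)
  also have "\<dots> = 0" unfolding r q s by (simp add: algebra_simps)
  finally have "(r * q + (r - q) * s) * ((b - a) * (1 - X * a) * (1 - X * b)) = 0" .
  moreover have "a \<noteq> 0" "b \<noteq> 0" unfolding a_def b_def using z by (simp_all add: eta_neq_0)
  with r q have "1 - X * a \<noteq> 0" "1 - X * b \<noteq> 0" by auto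
  moreover have "b - a \<noteq> 0" unfolding a_def b_def using eta_neq[of z l k] assms by auto
  ultimately have "r * q + (r - q) * s = 0" by simp
  then show ?thesis
    unfolding yy_pole_anti[of z l k] r_def q_def s_def by (simp add: algebra_simps eq_neg_iff_add_eq_0)
qed

text \<open>The classical cyclic identity for 1/((y_j - y_k)(y_j - y_l)), again obtained by clearing
  denominators; it excludes three-body terms from the transformed operator.\<close>

lemma yy_pole_triple:
  assumes z: "\<And>i. z i > 0" and "j \<noteq> k" "j \<noteq> l" "k \<noteq> l"
  shows "yy_pole z j k * yy_pole z j l + yy_pole z k j * yy_pole z k l + yy_pole z l j * yy_pole z l k = 0"
proof -
  define a b c s t u where "a = eta z j" and "b = eta z k" and "c = eta z l"
    and "s = yy_pole z j k" and "t = yy_pole z j l" and "u = yy_pole z k l"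
  have e: "s * (b - a) = a * b" "t * (c - a) = a * c" "u * (c - b) = b * c"
    unfolding s_def t_def u_def a_def b_def c_def using assms by (auto intro!: yy_pole_eq)
  have "(s * t - s * u + t * u) * ((b - a) * (c - a) * (c - b))
    = (s * (b - a)) * (t * (c - a)) * (c - b) - (s * (b - a)) * (u * (c - b)) * (c - a)
      + (t * (c - a)) * (u * (c - b)) * (b - a)"
    by (simp add: algebra_simps)
  also have "\<dots> = 0" unfolding e by (simp add: algebra_simps)
  finally have "(s * t - s * u + t * u) * ((b - a) * (c - a) * (c - b)) = 0" .
  moreover have "(b - a) * (c - a) * (c - b) \<noteq> 0"
    unfolding a_def b_def c_def using eta_neq[of z] assms by auto
  ultimately have "s * t - s * u + t * u = 0" by simp
  then show ?thesis
    unfolding yy_pole_anti[of z k j] yy_pole_anti[of z l j] yy_pole_anti[of z l k]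
      s_def t_def u_def by (simp add: algebra_simps)
qed

definition fps_kernel :: "nat \<Rightarrow> real \<Rightarrow> (nat \<Rightarrow> real) \<Rightarrow> (nat \<Rightarrow> real) \<Rightarrow> real fps" where
  "fps_kernel N lam x z = (\<Prod>(j, k)\<in>index_pairs N. binom_fps lam (z k / z j) (k - j))
     * (\<Prod>(i, k)\<in>{1..N} \<times> {1..N}. binom_fps (- lam) (x i * z k) k)"

text \<open>Multiplying the kernel by prod_j y_j^(lam (j-N-1)) cancels every power of y left over
  from the ratios and gives prod_(j<k) (y_k - y_j)^lam / prod_(i,k) (y_k - x_i)^lam. The logarithmic
  derivative of this function in y_j is \<open>- lam * y_drift N x z j\<close>, a pure sum of
  poles.\<close>

definition y_drift :: "nat \<Rightarrow> (nat \<Rightarrow> real) \<Rightarrow> (nat \<Rightarrow> real) \<Rightarrow> nat \<Rightarrow> real fps" where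
  "y_drift N x z j = (\<Sum>i=1..N. xy_pole x z i j) - (\<Sum>k=1..N. yy_pole z j k)"

text \<open>The operator identity divided by the kernel. On the left stand the second x-derivatives
  and the difference quotients (d_i - d_k)/(x_i - x_k) of the logarithm, where the quotient of two
  poles is their product. On the right stand the second y-derivatives of the kernel with its powers
  of y, and the inverse square interaction.\<close>

lemma kernel_poles:
  assumes z: "\<And>i. z i > 0"
  shows "(\<Sum>i=1..N. fps_const (lam\<^sup>2) * (\<Sum>k=1..N. xy_pole x z i k)\<^sup>2
            + fps_const lam * (\<Sum>k=1..N. (xy_pole x z i k)\<^sup>2))
      + fps_const (2 * lam\<^sup>2) * (\<Sum>(i, i')\<in>index_pairs N. \<Sum>k=1..N. xy_pole x z i k * xy_pole x z i' k)
    = (\<Sum>j=1..N. fps_const (lam\<^sup>2) * (y_drift N x z j)\<^sup>2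
            + fps_const lam * ((\<Sum>i=1..N. (xy_pole x z i j)\<^sup>2) - (\<Sum>k=1..N. (yy_pole z j k)\<^sup>2)))
      - fps_const (2 * lam * (lam - 1)) * (\<Sum>(j, k)\<in>index_pairs N. (yy_pole z j k)\<^sup>2)"
proof -
  define R where "R = xy_pole x z"
  define S where "S = yy_pole z"
  define L where "L = fps_const lam"
  define RR where "RR = (\<Sum>i=1..N. \<Sum>k=1..N. (R i k)\<^sup>2)"
  define SS where "SS = (\<Sum>i=1..N. \<Sum>k=1..N. (S i k)\<^sup>2)"
  define CC where "CC = (\<Sum>k=1..N. (\<Sum>i=1..N. R i k)\<^sup>2)"
  define RS where "RS = (\<Sum>k=1..N. (\<Sum>i=1..N. R i k) * (\<Sum>l=1..N. S k l))"
  have L2: "fps_const (lam\<^sup>2) = L * L" "fps_const (2 * lam\<^sup>2) = 2 * (L * L)"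
    "fps_const (2 * lam * (lam - 1)) = 2 * (L * L - L)"
    unfolding L_def power2_eq_square
    by (simp_all add: algebra_simps numeral_fps_const)
  have rows: "(\<Sum>i=1..N. (\<Sum>k=1..N. R i k)\<^sup>2) = RR - 2 * RS"
  proof -
    have "(\<Sum>i=1..N. (\<Sum>k=1..N. R i k)\<^sup>2)
        = (\<Sum>i=1..N. (\<Sum>k=1..N. (R i k)\<^sup>2) - 2 * (\<Sum>k=1..N. \<Sum>l=1..N. R i k * S k l))"
      unfolding R_def S_def using z by (intro sum.cong refl sum_square_pair xy_pole_product) auto
    also have "\<dots> = RR - 2 * (\<Sum>i=1..N. \<Sum>k=1..N. \<Sum>l=1..N. R i k * S k l)"
      by (simp add: RR_def sum_subtractf sum_distrib_left)
    also have "(\<Sum>i=1..N. \<Sum>k=1..N. \<Sum>l=1..N. R i k * S k l) = RS"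
      unfolding RS_def sum_product by (rule sum.swap)
    finally show ?thesis .
  qed
  have SSS: "(\<Sum>j=1..N. (\<Sum>k=1..N. S j k)\<^sup>2) = SS"
    unfolding SS_def S_def
    by (rule sum_square_triple) (use z in \<open>auto simp: fps_numeral_fps_const intro: yy_pole_triple yy_pole_anti[of z]\<close>)
  have RR': "(\<Sum>k=1..N. \<Sum>i=1..N. (R i k)\<^sup>2) = RR"
    unfolding RR_def by (rule sum.swap)
  have cols: "2 * (\<Sum>(i, i')\<in>index_pairs N. \<Sum>k=1..N. R i k * R i' k) = CC - RR"
  proof -
    have "CC = (\<Sum>k=1..N. \<Sum>i=1..N. \<Sum>i'=1..N. R i k * R i' k)"
      by (simp add: CC_def power2_eq_square sum_product)
    also have "\<dots> = (\<Sum>i=1..N. \<Sum>k=1..N. \<Sum>i'=1..N. R i k * R i' k)"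
      by (rule sum.swap)
    also have "\<dots> = (\<Sum>i=1..N. \<Sum>i'=1..N. \<Sum>k=1..N. R i k * R i' k)"
      by (intro sum.cong refl sum.swap)
    also have "\<dots> = 2 * (\<Sum>(i, i')\<in>index_pairs N. \<Sum>k=1..N. R i k * R i' k) + RR"
      by (subst sum_index_pairs_symmetric) (simp_all add: mult.commute RR_def power2_eq_square)
    finally show ?thesis by simp
  qed
  have pairs: "2 * (\<Sum>(j, k)\<in>index_pairs N. (S j k)\<^sup>2) = SS"
  proof -
    have "(S j k)\<^sup>2 = (S k j)\<^sup>2" for j k
      unfolding S_def by (subst yy_pole_anti) simp
    then show ?thesis
      unfolding SS_def by (subst sum_index_pairs_symmetric) (simp_all add: S_def)
  qed
  have drift: "(\<Sum>j=1..N. ((\<Sum>i=1..N. R i j) - (\<Sum>k=1..N. S j k))\<^sup>2) = CC - 2 * RS + SS"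
    unfolding SSS [symmetric] CC_def RS_def
    by (simp add: power2_diff sum.distrib sum_subtractf mult.assoc flip: sum_distrib_left)
  \<comment> \<open>Both sides reduce to lam^2 (CC - 2 RS) + lam RR. The second y-derivatives
    produce the surplus (lam^2 - lam) SS, which the interaction removes; this is the origin of the
    coupling lam (lam - 1).\<close>
  have "(\<Sum>i=1..N. L * L * (\<Sum>k=1..N. R i k)\<^sup>2 + L * (\<Sum>k=1..N. (R i k)\<^sup>2))
      + 2 * (L * L) * (\<Sum>(i, i')\<in>index_pairs N. \<Sum>k=1..N. R i k * R i' k)
    = L * L * (\<Sum>i=1..N. (\<Sum>k=1..N. R i k)\<^sup>2) + L * RR
      + L * L * (2 * (\<Sum>(i, i')\<in>index_pairs N. \<Sum>k=1..N. R i k * R i' k))"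
    by (simp add: sum.distrib sum_distrib_left RR_def mult_ac)
  also have "\<dots> = L * L * (CC - 2 * RS + SS) + L * (RR - SS) - (L * L - L) * SS"
    unfolding rows cols by (simp add: algebra_simps)
  also have "\<dots> = (\<Sum>j=1..N. L * L * ((\<Sum>i=1..N. R i j) - (\<Sum>k=1..N. S j k))\<^sup>2
            + L * ((\<Sum>i=1..N. (R i j)\<^sup>2) - (\<Sum>k=1..N. (S j k)\<^sup>2)))
      - (L * L - L) * (2 * (\<Sum>(j, k)\<in>index_pairs N. (S j k)\<^sup>2))"
    unfolding pairs
    by (simp add: drift RR' SS_def [symmetric] sum.distrib sum_subtractf
        del: One_nat_def flip: sum_distrib_left)
  finally show ?thesis
    unfolding y_drift_def L2 R_def [symmetric] S_def [symmetric] L_def [symmetric]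
    by (simp only: mult_ac)
qed


subsection \<open>Logarithmic derivatives of the kernel\<close>

lemma has_fps_derivative_at_cong:
  assumes "has_fps_derivative_at F D t" "D = D'"
  shows "has_fps_derivative_at F D' t"
  using assms by simp

lemma has_fps_derivative_at_transform:
  assumes "has_fps_derivative_at F D t" "eventually (\<lambda>s. F s = G s) (nhds t)"
  shows "has_fps_derivative_at G D t"
  unfolding has_fps_derivative_at_def
proof
  fix n
  have "eventually (\<lambda>s. F s $ n = G s $ n) (nhds t)"
    using assms(2) by eventually_elim simp
  then show "((\<lambda>s. G s $ n) has_real_derivative D $ n) (at t)"
    using assms(1) unfolding has_fps_derivative_at_def
    by (metis DERIV_cong_ev)
qed

lemma binom_fps_minus_one_shift:
  assumes "m > 0"
  shows "1 + fps_const a * fps_X ^ m * binom_fps (-1) a m = binom_fps (-1) a m"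
  using binom_fps_minus_one[OF assms, of a] by (simp add: algebra_simps)

lemma binom_fps_minus_one_shift':
  assumes "m > 0"
  shows "fps_const a * fps_X ^ m * binom_fps (-1) a m = binom_fps (-1) a m - 1"
  using binom_fps_minus_one_shift[OF assms, of a] by (metis add_diff_cancel_left')

lemma xy_pole_deriv_x:
  assumes "k > 0"
  shows "has_fps_derivative_at (\<lambda>t. xy_pole (x(i := t)) z i k) ((xy_pole x z i k)\<^sup>2) (x i)"
proof -
  have "((\<lambda>t. t * z k) has_real_derivative z k) (at (x i))"
    by (auto intro!: derivative_eq_intros)
  from has_fps_derivative_at_cmult[OF has_fps_derivative_at_binom_fps[OF assms this, of "-1"], of "eta z k"]
  show ?thesis
    by (simp add: xy_pole_def power2_eq_square eta_def mult_ac)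
qed

lemma kernel_deriv_x:
  assumes i: "i \<in> {1..N}"
  shows "has_fps_derivative_at (\<lambda>t. fps_kernel N lam (x(i := t)) z)
    (fps_const lam * (\<Sum>k=1..N. xy_pole x z i k) * fps_kernel N lam x z) (x i)"
proof -
  define L where "L = (\<lambda>(i', k). if i' = i then fps_const lam * xy_pole x z i k else 0)"
  have "has_fps_derivative_at
      (\<lambda>t. \<Prod>p\<in>{1..N} \<times> {1..N}. binom_fps (- lam) ((x(i := t)) (fst p) * z (snd p)) (snd p))
      ((\<Sum>p\<in>{1..N} \<times> {1..N}. L p) *
       (\<Prod>p\<in>{1..N} \<times> {1..N}. binom_fps (- lam) ((x(i := x i)) (fst p) * z (snd p)) (snd p))) (x i)"
  proof (intro has_fps_derivative_at_prod)
    fix p :: "nat \<times> nat" assume "p \<in> {1..N} \<times> {1..N}"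
    then have m: "snd p > 0" by auto
    show "has_fps_derivative_at (\<lambda>t. binom_fps (- lam) ((x(i := t)) (fst p) * z (snd p)) (snd p))
        (L p * binom_fps (- lam) ((x(i := x i)) (fst p) * z (snd p)) (snd p)) (x i)"
    proof (cases "fst p = i")
      case True
      have "((\<lambda>t. t * z (snd p)) has_real_derivative z (snd p)) (at (x i))"
        by (auto intro!: derivative_eq_intros)
      from has_fps_derivative_at_binom_fps[OF m this, of "- lam"] True
      show ?thesis
        by (simp add: L_def case_prod_beta xy_pole_def eta_def mult_ac flip: fps_const_mult)
    next
      case False
      then show ?thesis by (simp add: L_def case_prod_beta has_fps_derivative_at_const)
    qed
  qed auto
  also have "(\<Sum>p\<in>{1..N} \<times> {1..N}. L p) = (\<Sum>i'=1..N. \<Sum>k=1..N. L (i', k))"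
    by (simp add: sum.cartesian_product)
  also have "\<dots> = (\<Sum>i'=1..N. if i' = i then fps_const lam * (\<Sum>k=1..N. xy_pole x z i k) else 0)"
    by (intro sum.cong) (auto simp: L_def sum_distrib_left)
  also have "\<dots> = fps_const lam * (\<Sum>k=1..N. xy_pole x z i k)"
    using i by simp
  finally have D: "has_fps_derivative_at
      (\<lambda>t. \<Prod>p\<in>{1..N} \<times> {1..N}. binom_fps (- lam) ((x(i := t)) (fst p) * z (snd p)) (snd p))
      (fps_const lam * (\<Sum>k=1..N. xy_pole x z i k) *
       (\<Prod>p\<in>{1..N} \<times> {1..N}. binom_fps (- lam) (x (fst p) * z (snd p)) (snd p))) (x i)"
    by simp
  show ?thesis
    unfolding fps_kernel_def case_prod_beta mult.left_commute[of "fps_const lam * _"]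
    by (rule has_fps_derivative_at_cmult[OF D])
qed

lemma kernel_deriv2_x:
  assumes i: "i \<in> {1..N}"
  shows "has_fps_derivative_at
    (\<lambda>t. fps_const lam * (\<Sum>k=1..N. xy_pole (x(i := t)) z i k) * fps_kernel N lam (x(i := t)) z)
    ((fps_const (lam\<^sup>2) * (\<Sum>k=1..N. xy_pole x z i k)\<^sup>2
      + fps_const lam * (\<Sum>k=1..N. (xy_pole x z i k)\<^sup>2)) * fps_kernel N lam x z) (x i)"
proof -
  have "has_fps_derivative_at (\<lambda>t. fps_const lam * (\<Sum>k=1..N. xy_pole (x(i := t)) z i k))
      (fps_const lam * (\<Sum>k=1..N. (xy_pole x z i k)\<^sup>2)) (x i)"
    by (intro has_fps_derivative_at_cmult has_fps_derivative_at_sum xy_pole_deriv_x) auto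
  from has_fps_derivative_at_mult[where F = "\<lambda>t. fps_const lam * (\<Sum>k=1..N. xy_pole (x(i := t)) z i k)"
      and G = "\<lambda>t. fps_kernel N lam (x(i := t)) z", OF this kernel_deriv_x[OF i]]
  show ?thesis
    by (rule has_fps_derivative_at_cong)
       (simp add: power2_eq_square algebra_simps flip: fps_const_mult)
qed

text \<open>This is z_j d/dz_j, that is - y_j d/dy_j, applied to the logarithm of the kernel and
  divided by lam. It is written with numerators so that only non-negative powers of T occur.\<close>

definition y_log :: "nat \<Rightarrow> (nat \<Rightarrow> real) \<Rightarrow> (nat \<Rightarrow> real) \<Rightarrow> nat \<Rightarrow> real fps" where
  "y_log N x z j =
     (\<Sum>i=1..N. fps_const (x i * z j) * fps_X ^ j * binom_fps (-1) (x i * z j) j)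
     + (\<Sum>k=1..N. if j < k then fps_const (z k / z j) * fps_X ^ (k - j) * binom_fps (-1) (z k / z j) (k - j)
         else if k < j then - (fps_const (z j / z k) * fps_X ^ (j - k) * binom_fps (-1) (z j / z k) (j - k))
         else 0)"

text \<open>By t/(1-t) = 1/(1-t) - 1 each of the N poles in x leaves -1 and each k < j leaves +1, in
  total j - 1 - N. The summand N + 1 - j, contributed by y_j^(lam (j-N-1)), cancels exactly this
  constant.\<close>

lemma eta_y_log:
  assumes z: "\<And>i. z i > 0" and j: "j \<in> {1..N}"
  shows "eta z j * (y_log N x z j + fps_const (real N + 1 - real j)) = y_drift N x z j"
proof -
  have "(\<Sum>k=1..N. if k < j then 1 else (0::real fps)) = of_nat (card ({1..N} \<inter> {k. k < j}))"
    by (simp add: sum.If_cases)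
  also have "{1..N} \<inter> {k. k < j} = {1..<j}" using j by auto
  finally have cnt: "(\<Sum>k=1..N. if k < j then 1 else (0::real fps)) = fps_const (real j - 1)"
    using j by (simp add: of_nat_diff fps_of_nat [symmetric] flip: fps_const_1_eq_1 fps_const_sub)
  have x: "eta z j * (fps_const (x i * z j) * fps_X ^ j * binom_fps (-1) (x i * z j) j)
      = xy_pole x z i j - eta z j" for i
    using binom_fps_minus_one_shift'[of j "x i * z j"] j
    by (simp only: xy_pole_def) (simp add: right_diff_distrib)
  have y: "eta z j * (if j < k then fps_const (z k / z j) * fps_X ^ (k - j) * binom_fps (-1) (z k / z j) (k - j)
         else if k < j then - (fps_const (z j / z k) * fps_X ^ (j - k) * binom_fps (-1) (z j / z k) (j - k))
         else 0) = (if k < j then 1 else 0) * eta z j - yy_pole z j k" for k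
  proof -
    consider "j < k" | "k < j" | "k = j" by linarith
    then show ?thesis
    proof cases
      case 1
      then show ?thesis using eta_ratio[OF z, of j k] by (simp add: yy_pole_def mult_ac)
    next
      case 2
      then have "fps_const (z j / z k) * fps_X ^ (j - k) * binom_fps (-1) (z j / z k) (j - k)
          = binom_fps (-1) (z j / z k) (j - k) - 1"
        by (intro binom_fps_minus_one_shift') auto
      with 2 show ?thesis
        by (simp only: yy_pole_def) (simp add: right_diff_distrib)
    qed auto
  qed
  have "eta z j * y_log N x z j = (\<Sum>i=1..N. xy_pole x z i j - eta z j)
      + (\<Sum>k=1..N. (if k < j then 1 else 0) * eta z j - yy_pole z j k)"
    unfolding y_log_def distrib_left sum_distrib_left x y ..
  also have "\<dots> = y_drift N x z j - of_nat N * eta z j + (\<Sum>k=1..N. if k < j then 1 else 0) * eta z j"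
    by (simp add: y_drift_def sum_subtractf sum_distrib_right)
  finally show ?thesis
    unfolding cnt by (simp add: algebra_simps fps_of_nat [symmetric] flip: fps_const_add fps_const_sub)
qed

lemma kernel_deriv_z:
  assumes z: "\<And>i. z i > 0" and j: "j \<in> {1..N}"
  shows "has_fps_derivative_at (\<lambda>t. fps_kernel N lam x (z(j := t)))
    (fps_const (1 / z j) * (fps_const lam * y_log N x z j * fps_kernel N lam x z)) (z j)"
proof -
  define C where "C = fps_const (1 / z j) * fps_const lam"
  have C: "C = fps_const (lam / z j)" by (simp add: C_def)
  \<comment> \<open>In the factor of a pair, z_j is the denominator of the ratio if j is the smaller
    index and the numerator otherwise; hence the opposite signs of \<open>f\<close> and
    \<open>g\<close>.\<close>
  define f where "f = (\<lambda>k. C * (fps_const (z k / z j) * fps_X ^ (k - j) * binom_fps (-1) (z k / z j) (k - j)))"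
  define g where "g = (\<lambda>k. C * (- (fps_const (z j / z k) * fps_X ^ (j - k) * binom_fps (-1) (z j / z k) (j - k))))"
  define L1 where "L1 = (\<lambda>(a, b). if a = j then f b else if b = j then g a else 0)"
  define L2 where "L2 = (\<lambda>(i, k). if k = j then C * (fps_const (x i * z j) * fps_X ^ j * binom_fps (-1) (x i * z j) j) else 0)"
  have zj: "z j \<noteq> 0" using z[of j] by simp
  have "has_fps_derivative_at
      (\<lambda>t. \<Prod>p\<in>{1..N} \<times> {1..N}. binom_fps (- lam) (x (fst p) * (z(j := t)) (snd p)) (snd p))
      ((\<Sum>p\<in>{1..N} \<times> {1..N}. L2 p) *
       (\<Prod>p\<in>{1..N} \<times> {1..N}. binom_fps (- lam) (x (fst p) * (z(j := z j)) (snd p)) (snd p))) (z j)"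
  proof (intro has_fps_derivative_at_prod)
    fix p :: "nat \<times> nat" assume "p \<in> {1..N} \<times> {1..N}"
    then have m: "snd p > 0" by auto
    show "has_fps_derivative_at (\<lambda>t. binom_fps (- lam) (x (fst p) * (z(j := t)) (snd p)) (snd p))
        (L2 p * binom_fps (- lam) (x (fst p) * (z(j := z j)) (snd p)) (snd p)) (z j)"
    proof (cases "snd p = j")
      case True
      have "((\<lambda>t. x (fst p) * t) has_real_derivative x (fst p)) (at (z j))"
        by (auto intro!: derivative_eq_intros)
      from has_fps_derivative_at_binom_fps[OF m this, of "- lam"] True
      show ?thesis using zj
        by (simp add: L2_def C case_prod_beta mult.assoc[symmetric])
    next
      case False
      then show ?thesis by (simp add: L2_def case_prod_beta has_fps_derivative_at_const)
    qed
  qed auto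
  also have "(\<Sum>p\<in>{1..N} \<times> {1..N}. L2 p) = (\<Sum>i=1..N. \<Sum>k=1..N. L2 (i, k))"
    by (simp add: sum.cartesian_product)
  also have "\<dots> = C * (\<Sum>i=1..N. fps_const (x i * z j) * fps_X ^ j * binom_fps (-1) (x i * z j) j)"
    using j by (simp add: L2_def sum_distrib_left)
  finally have D2: "has_fps_derivative_at
      (\<lambda>t. \<Prod>p\<in>{1..N} \<times> {1..N}. binom_fps (- lam) (x (fst p) * (z(j := t)) (snd p)) (snd p))
      (C * (\<Sum>i=1..N. fps_const (x i * z j) * fps_X ^ j * binom_fps (-1) (x i * z j) j) *
       (\<Prod>p\<in>{1..N} \<times> {1..N}. binom_fps (- lam) (x (fst p) * z (snd p)) (snd p))) (z j)"
    by simp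
  have "has_fps_derivative_at
      (\<lambda>t. \<Prod>p\<in>index_pairs N. binom_fps lam ((z(j := t)) (snd p) / (z(j := t)) (fst p)) (snd p - fst p))
      ((\<Sum>p\<in>index_pairs N. L1 p) *
       (\<Prod>p\<in>index_pairs N. binom_fps lam ((z(j := z j)) (snd p) / (z(j := z j)) (fst p)) (snd p - fst p))) (z j)"
  proof (intro has_fps_derivative_at_prod finite_index_pairs)
    fix p :: "nat \<times> nat" assume p: "p \<in> index_pairs N"
    obtain a b where ab: "p = (a, b)" by force
    have m: "b - a > 0" and ne: "a \<noteq> b" using p ab by (auto simp: index_pairs_def)
    show "has_fps_derivative_at
        (\<lambda>t. binom_fps lam ((z(j := t)) (snd p) / (z(j := t)) (fst p)) (snd p - fst p))
        (L1 p * binom_fps lam ((z(j := z j)) (snd p) / (z(j := z j)) (fst p)) (snd p - fst p)) (z j)"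
    proof (cases "a = j \<or> b = j")
      case False
      then show ?thesis by (simp add: L1_def ab has_fps_derivative_at_const)
    next
      case True
      then show ?thesis
      proof
        assume a: "a = j"
        have "((\<lambda>t. z b / t) has_real_derivative - (z b / (z j)\<^sup>2)) (at (z j))"
          using zj by (auto intro!: derivative_eq_intros simp: power2_eq_square)
        from has_fps_derivative_at_binom_fps[OF m this, of lam] a ne
        show ?thesis using zj
          by (simp add: L1_def f_def C ab mult.assoc[symmetric] power2_eq_square)
      next
        assume b: "b = j"
        have za: "z a \<noteq> 0" using z[of a] by simp
        then have "((\<lambda>t. t / z a) has_real_derivative 1 / z a) (at (z j))"
          by (auto intro!: derivative_eq_intros)
        note D = has_fps_derivative_at_binom_fps[OF m this, of lam]
        from D show ?thesis using zj b ne
          by (simp add: za L1_def g_def C ab mult.assoc[symmetric] flip: fps_const_neg)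
      qed
    qed
  qed
  also have "(\<Sum>p\<in>index_pairs N. L1 p) = (\<Sum>k=1..N. if j < k then f k else if k < j then g k else 0)"
    unfolding L1_def using sum_index_pairs_incident[OF j, of f g] by simp
  finally have D1: "has_fps_derivative_at
      (\<lambda>t. \<Prod>p\<in>index_pairs N. binom_fps lam ((z(j := t)) (snd p) / (z(j := t)) (fst p)) (snd p - fst p))
      ((\<Sum>k=1..N. if j < k then f k else if k < j then g k else 0) *
       (\<Prod>p\<in>index_pairs N. binom_fps lam (z (snd p) / z (fst p)) (snd p - fst p))) (z j)"
    by simp
  have fg: "(\<Sum>k=1..N. if j < k then f k else if k < j then g k else 0)
      + C * (\<Sum>i=1..N. fps_const (x i * z j) * fps_X ^ j * binom_fps (-1) (x i * z j) j)
      = fps_const (1 / z j) * (fps_const lam * y_log N x z j)"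
  proof -
    have "(\<Sum>k=1..N. if j < k then f k else if k < j then g k else 0)
      = C * (\<Sum>k=1..N. if j < k then fps_const (z k / z j) * fps_X ^ (k - j) * binom_fps (-1) (z k / z j) (k - j)
         else if k < j then - (fps_const (z j / z k) * fps_X ^ (j - k) * binom_fps (-1) (z j / z k) (j - k))
         else 0)"
      unfolding sum_distrib_left f_def g_def by (intro sum.cong) auto
    then show ?thesis
      unfolding y_log_def mult.assoc[symmetric] C_def[symmetric] by (simp only: distrib_left add.commute)
  qed
  have "has_fps_derivative_at (\<lambda>t. fps_kernel N lam x (z(j := t)))
    ((\<Sum>k=1..N. if j < k then f k else if k < j then g k else 0) *
       (\<Prod>p\<in>index_pairs N. binom_fps lam (z (snd p) / z (fst p)) (snd p - fst p))
      * (\<Prod>p\<in>{1..N} \<times> {1..N}. binom_fps (- lam) (x (fst p) * (z(j := z j)) (snd p)) (snd p))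
     + (\<Prod>p\<in>index_pairs N. binom_fps lam ((z(j := z j)) (snd p) / (z(j := z j)) (fst p)) (snd p - fst p))
      * (C * (\<Sum>i=1..N. fps_const (x i * z j) * fps_X ^ j * binom_fps (-1) (x i * z j) j) *
       (\<Prod>p\<in>{1..N} \<times> {1..N}. binom_fps (- lam) (x (fst p) * z (snd p)) (snd p)))) (z j)"
    unfolding fps_kernel_def case_prod_beta by (rule has_fps_derivative_at_mult[OF D1 D2])
  also have "(\<Sum>k=1..N. if j < k then f k else if k < j then g k else 0) *
       (\<Prod>p\<in>index_pairs N. binom_fps lam (z (snd p) / z (fst p)) (snd p - fst p))
      * (\<Prod>p\<in>{1..N} \<times> {1..N}. binom_fps (- lam) (x (fst p) * (z(j := z j)) (snd p)) (snd p))
     + (\<Prod>p\<in>index_pairs N. binom_fps lam ((z(j := z j)) (snd p) / (z(j := z j)) (fst p)) (snd p - fst p))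
      * (C * (\<Sum>i=1..N. fps_const (x i * z j) * fps_X ^ j * binom_fps (-1) (x i * z j) j) *
       (\<Prod>p\<in>{1..N} \<times> {1..N}. binom_fps (- lam) (x (fst p) * z (snd p)) (snd p)))
    = ((\<Sum>k=1..N. if j < k then f k else if k < j then g k else 0)
      + C * (\<Sum>i=1..N. fps_const (x i * z j) * fps_X ^ j * binom_fps (-1) (x i * z j) j)) * fps_kernel N lam x z"
    unfolding fps_kernel_def case_prod_beta fun_upd_triv by (simp only: distrib_right distrib_left mult_ac)
  finally show ?thesis unfolding fg by (simp only: mult.assoc)
qed

text \<open>Since y_j = 1/(z_j T^j), the operator z_j eta_j d/dz_j is - d/dy_j, which maps 1/(y_j -
  c) to its square. The derivative D itself is wanted only in this combination.\<close>

lemma y_drift_deriv_z: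
  assumes z: "\<And>i. z i > 0" and j: "j \<in> {1..N}"
  obtains D where "has_fps_derivative_at (\<lambda>t. y_drift N x (z(j := t)) j) D (z j)"
    "fps_const (z j) * (eta z j * D) = (\<Sum>i=1..N. (xy_pole x z i j)\<^sup>2) - (\<Sum>k=1..N. (yy_pole z j k)\<^sup>2)"
proof -
  have zj: "z j \<noteq> 0" using z[of j] by simp
  have j0: "j > 0" using j by simp
  have eta': "has_fps_derivative_at (\<lambda>t. eta (z(j := t)) j) (fps_X ^ j) (z j)"
    using has_fps_derivative_at_mult[OF has_fps_derivative_at_fps_const has_fps_derivative_at_const,
        OF DERIV_ident, of "fps_X ^ j" "z j"]
    by (simp add: eta_def)
  define DR where "DR = (\<lambda>i. fps_X ^ j * (binom_fps (-1) (x i * z j) j)\<^sup>2)"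
  \<comment> \<open>The common shape of the poles with z_j in the numerator: c = x_i and m = j for
    those in x, c = 1/z_k and m = j - k for k < j. With b the geometric series, the product rule
    gives T^j b (1 + c z_j T^m b) = T^j b^2.\<close>
  have pole_deriv: "has_fps_derivative_at (\<lambda>t. eta (z(j := t)) j * binom_fps (-1) (c * t) m)
      (fps_X ^ j * (binom_fps (-1) (c * z j) m)\<^sup>2) (z j)" if m: "m > 0" for c m
  proof -
    have "((\<lambda>t. c * t) has_real_derivative c) (at (z j))"
      by (auto intro!: derivative_eq_intros)
    from has_fps_derivative_at_mult[OF eta' has_fps_derivative_at_binom_fps[OF m this, of "-1"]]
    show ?thesis
    proof (rule has_fps_derivative_at_cong)
      define b where "b = binom_fps (-1) (c * z j) m"
      have b: "b = 1 + fps_const (c * z j) * fps_X ^ m * b"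
        unfolding b_def using binom_fps_minus_one_shift[OF m] by simp
      have "fps_X ^ j * b + eta (z(j := z j)) j * (fps_const (- (- 1) * c) * fps_X ^ m * b * b)
        = fps_X ^ j * b * (1 + fps_const (c * z j) * fps_X ^ m * b)"
        by (simp add: eta_def algebra_simps flip: fps_const_mult)
      also have "\<dots> = fps_X ^ j * b\<^sup>2" unfolding b [symmetric] by (simp add: power2_eq_square mult_ac)
      finally show "fps_X ^ j * binom_fps (- 1) (c * z j) m +
         eta (z(j := z j)) j * (fps_const (- (- 1) * c) * fps_X ^ m * binom_fps (- 1) (c * z j) m * binom_fps (- 1) (c * z j) m) =
        fps_X ^ j * (binom_fps (- 1) (c * z j) m)\<^sup>2"
        unfolding b_def .
    qed
  qed
  have R: "has_fps_derivative_at (\<lambda>t. xy_pole x (z(j := t)) i j) (DR i) (z j)" for i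
    using pole_deriv[OF j0, of "x i"] by (simp add: xy_pole_def DR_def)
  have R2: "fps_const (z j) * (eta z j * DR i) = (xy_pole x z i j)\<^sup>2" for i
    by (simp add: DR_def xy_pole_def eta_def power2_eq_square mult_ac)
  define DS where "DS = (\<lambda>k. if j < k then eta z k * (fps_const (z k / (z j)\<^sup>2) * fps_X ^ (k - j) * (binom_fps (-1) (z k / z j) (k - j))\<^sup>2)
     else if k < j then fps_X ^ j * (binom_fps (-1) (z j / z k) (j - k))\<^sup>2 else 0)"
  have S: "has_fps_derivative_at (\<lambda>t. yy_pole (z(j := t)) j k) (DS k) (z j)" for k
  proof -
    consider "j < k" | "k < j" | "k = j" by linarith
    then show ?thesis
    proof cases
      case 1
      have "((\<lambda>t. z k / t) has_real_derivative - (z k / (z j)\<^sup>2)) (at (z j))"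
        using zj by (auto intro!: derivative_eq_intros simp: power2_eq_square)
      from has_fps_derivative_at_minus[OF has_fps_derivative_at_cmult[OF has_fps_derivative_at_binom_fps[OF _ this, of "k - j" "-1"], of "eta z k"]] 1
      show ?thesis by (simp add: yy_pole_def eta_def DS_def power2_eq_square mult_ac flip: fps_const_neg)
    next
      case 2
      then show ?thesis using pole_deriv[of "j - k" "1 / z k"] by (simp add: yy_pole_def DS_def)
    qed (simp add: DS_def has_fps_derivative_at_const)
  qed
  have S2: "fps_const (z j) * (eta z j * DS k) = (yy_pole z j k)\<^sup>2" for k
  proof -
    consider "j < k" | "k < j" | "k = j" by linarith
    then show ?thesis
    proof cases
      case 1
      define b where "b = binom_fps (-1) (z k / z j) (k - j)"
      have c: "fps_const (z k / (z j)\<^sup>2) * fps_const (z j) = fps_const (z k / z j)"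
        using zj by (simp add: power2_eq_square)
      have "fps_const (z j) * (eta z j * DS k)
         = (fps_const (z k / (z j)\<^sup>2) * fps_const (z j)) * fps_X ^ (k - j) * eta z j * (eta z k * b\<^sup>2)"
        using 1 by (simp only: DS_def b_def mult_ac if_True)
      also have "\<dots> = eta z k * (eta z k * b\<^sup>2)"
        unfolding c eta_ratio[of z j k, OF z 1, symmetric] ..
      finally show ?thesis using 1 by (simp add: yy_pole_def b_def power2_eq_square mult_ac)
    next
      case 2
      then show ?thesis by (simp add: yy_pole_def DS_def eta_def power2_eq_square mult_ac)
    qed (simp add: DS_def)
  qed
  show ?thesis
  proof
    show "has_fps_derivative_at (\<lambda>t. y_drift N x (z(j := t)) j) ((\<Sum>i=1..N. DR i) - (\<Sum>k=1..N. DS k)) (z j)"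
      unfolding y_drift_def
      by (intro has_fps_derivative_at_diff has_fps_derivative_at_sum R S)
    show "fps_const (z j) * (eta z j * ((\<Sum>i=1..N. DR i) - (\<Sum>k=1..N. DS k)))
      = (\<Sum>i=1..N. (xy_pole x z i j)\<^sup>2) - (\<Sum>k=1..N. (yy_pole z j k)\<^sup>2)"
      unfolding right_diff_distrib sum_distrib_left R2 S2 ..
  qed
qed


subsection \<open>Laurent coefficients of the kernel\<close>

definition tail :: "nat \<Rightarrow> (nat \<Rightarrow> int) \<Rightarrow> nat \<Rightarrow> int" where
  "tail N m k = (\<Sum>j=k..N. m j)"

text \<open>The dual description of the cone generated by e_k and e_k - e_j for j < k, which are the
  exponents in z of x_i/y_k and y_j/y_k. The pairing with (1, ..., N), called \<open>height\<close>,
  is the power of T that accompanies a monomial.\<close>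

definition exp_cone :: "nat \<Rightarrow> (nat \<Rightarrow> int) \<Rightarrow> bool" where
  "exp_cone N m \<longleftrightarrow> (\<forall>k\<in>{1..N}. 0 \<le> tail N m k)"

definition height :: "nat \<Rightarrow> (nat \<Rightarrow> int) \<Rightarrow> int" where
  "height N m = (\<Sum>j=1..N. m j * int j)"

definition cone_at :: "nat \<Rightarrow> nat \<Rightarrow> (nat \<Rightarrow> int) set" where
  "cone_at N d = {m \<in> {1..N} \<rightarrow>\<^sub>E UNIV. exp_cone N m \<and> height N m = int d}"

lemma tail_cong: "(\<And>j. j \<in> {1..N} \<Longrightarrow> m j = m' j) \<Longrightarrow> k \<ge> 1 \<Longrightarrow> tail N m k = tail N m' k"
  unfolding tail_def by (intro sum.cong) auto

lemma exp_cone_cong: "(\<And>j. j \<in> {1..N} \<Longrightarrow> m j = m' j) \<Longrightarrow> exp_cone N m = exp_cone N m'"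
  unfolding exp_cone_def using tail_cong[of N m m'] by auto

lemma height_cong: "(\<And>j. j \<in> {1..N} \<Longrightarrow> m j = m' j) \<Longrightarrow> height N m = height N m'"
  unfolding height_def by (intro sum.cong) auto

lemma tail_add: "tail N (\<lambda>i. m i + v i) k = tail N m k + tail N v k"
  by (simp add: tail_def sum.distrib)

lemma tail_diff: "tail N (\<lambda>i. m i - v i) k = tail N m k - tail N v k"
  by (simp add: tail_def sum_subtractf)

lemma height_add: "height N (\<lambda>i. m i + v i) = height N m + height N v"
  by (simp add: height_def sum.distrib distrib_right)

lemma height_diff: "height N (\<lambda>i. m i - v i) = height N m - height N v"
  by (simp add: height_def sum_subtractf left_diff_distrib)

lemma exp_cone_add: "exp_cone N m \<Longrightarrow> exp_cone N v \<Longrightarrow> exp_cone N (\<lambda>i. m i + v i)"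
  by (auto simp: exp_cone_def tail_add)

text \<open>Summation by parts. In the cone all summands are non-negative, so the height bounds
  every tail, and each height is attained by finitely many exponents only.\<close>

lemma height_eq_sum_tail: "height N m = (\<Sum>k=1..N. tail N m k)"
proof -
  have "(\<Sum>k=1..N. tail N m k) = (\<Sum>k=1..N. \<Sum>j=1..N. if k \<le> j then m j else 0)"
    unfolding tail_def
    by (intro sum.cong refl sum.mono_neutral_cong_left) auto
  also have "\<dots> = (\<Sum>j=1..N. \<Sum>k=1..N. if k \<le> j then m j else 0)"
    by (rule sum.swap)
  also have "\<dots> = (\<Sum>j=1..N. m j * int j)"
  proof (intro sum.cong refl)
    fix j assume "j \<in> {1..N}"
    then have "{k \<in> {1..N}. k \<le> j} = {1..j}" by auto
    then show "(\<Sum>k=1..N. if k \<le> j then m j else 0) = m j * int j"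
      by (simp flip: sum.inter_filter)
  qed
  finally show ?thesis by (simp add: height_def)
qed

lemma tail_le_height:
  assumes "exp_cone N m" "k \<in> {1..N}"
  shows "tail N m k \<le> height N m"
  unfolding height_eq_sum_tail using assms by (intro member_le_sum) (auto simp: exp_cone_def)

lemma exp_cone_height_nonneg: "exp_cone N m \<Longrightarrow> 0 \<le> height N m"
  unfolding height_eq_sum_tail by (intro sum_nonneg) (auto simp: exp_cone_def)

lemma finite_cone_height:
  "finite {m \<in> {1..N} \<rightarrow>\<^sub>E UNIV. exp_cone N m \<and> height N m \<le> d}"
proof (rule finite_subset)
  show "{m \<in> {1..N} \<rightarrow>\<^sub>E UNIV. exp_cone N m \<and> height N m \<le> d} \<subseteq> {1..N} \<rightarrow>\<^sub>E {-d..d}"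
  proof (intro subsetI)
    fix m assume "m \<in> {m \<in> {1..N} \<rightarrow>\<^sub>E UNIV. exp_cone N m \<and> height N m \<le> d}"
    then have m: "m \<in> {1..N} \<rightarrow>\<^sub>E UNIV" "exp_cone N m" "height N m \<le> d" by auto
    \<comment> \<open>The empty tail at N + 1 is included so that every component, also the last
      one, is a difference of two consecutive tails in the interval from 0 to d.\<close>
    have t: "0 \<le> tail N m k" "tail N m k \<le> d" if "k \<in> {1..Suc N}" for k
    proof -
      have "0 \<le> tail N m k \<and> tail N m k \<le> d"
      proof (cases "k = Suc N")
        case True
        then show ?thesis using exp_cone_height_nonneg[OF m(2)] m(3) by (simp add: tail_def)
      next
        case False
        then have "k \<in> {1..N}" using that by auto
        then show ?thesis using tail_le_height[OF m(2), of k] m by (auto simp: exp_cone_def)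
      qed
      then show "0 \<le> tail N m k" "tail N m k \<le> d" by auto
    qed
    show "m \<in> {1..N} \<rightarrow>\<^sub>E {-d..d}"
    proof (rule PiE_I)
      fix k assume k: "k \<in> {1..N}"
      then have "tail N m k = m k + tail N m (Suc k)"
        by (simp add: tail_def sum.atLeast_Suc_atMost)
      then show "m k \<in> {-d..d}" using t[of k] t[of "Suc k"] k by auto
    qed (use m in auto)
  qed
  show "finite ({1..N} \<rightarrow>\<^sub>E {-d..d})" by (intro finite_PiE) auto
qed

lemma finite_cone_at: "finite (cone_at N d)"
  by (rule finite_subset[OF _ finite_cone_height[of N "int d"]]) (auto simp: cone_at_def)

text \<open>The Laurent monomial z^m for z > 0. The form through \<open>exp\<close> and
  \<open>ln\<close> admits negative exponents and makes additivity in m and the derivative in z_j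
  immediate.\<close>

definition monom_at :: "nat \<Rightarrow> (nat \<Rightarrow> real) \<Rightarrow> (nat \<Rightarrow> int) \<Rightarrow> real" where
  "monom_at N z m = exp (\<Sum>j=1..N. of_int (m j) * ln (z j))"

lemma monom_at_pos: "monom_at N z m > 0"
  by (simp add: monom_at_def)

lemma monom_at_cong: "(\<And>j. j \<in> {1..N} \<Longrightarrow> m j = m' j) \<Longrightarrow> monom_at N z m = monom_at N z m'"
  unfolding monom_at_def by (intro arg_cong[of _ _ exp] sum.cong) auto

lemma monom_at_add: "monom_at N z (\<lambda>i. m i + v i) = monom_at N z m * monom_at N z v"
  by (simp add: monom_at_def sum.distrib distrib_right exp_add)

lemma monom_at_upd:
  assumes "j \<in> {1..N}"
  shows "monom_at N (z(j := t)) m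
    = exp (of_int (m j) * ln t) * exp (\<Sum>i\<in>{1..N} - {j}. of_int (m i) * ln (z i))"
  using assms unfolding monom_at_def exp_add [symmetric]
  by (subst sum.remove[of _ j]) (auto intro!: sum.cong)

lemma monom_at_deriv:
  assumes "j \<in> {1..N}" "z j > 0"
  shows "((\<lambda>t. monom_at N (z(j := t)) m) has_real_derivative of_int (m j) / z j * monom_at N z m) (at (z j))"
proof -
  have "monom_at N z m = monom_at N (z(j := z j)) m" by simp
  then show ?thesis
    unfolding monom_at_upd[OF assms(1)]
    using assms by (auto intro!: derivative_eq_intros)
qed

text \<open>Doubling z_j multiplies the monomial m by 2^(m j). Choosing j with m1 j distinct from m0
  j and subtracting 2^(m1 j) times the relation from the doubled one eliminates m1, while the
  coefficient of m0 is only multiplied by a non-zero number.\<close>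

lemma monom_at_independent:
  assumes "finite A" "A \<subseteq> {1..N} \<rightarrow>\<^sub>E UNIV"
    and "\<And>z. (\<And>i. z i > 0) \<Longrightarrow> (\<Sum>m\<in>A. a m * monom_at N z m) = 0"
    and "m0 \<in> A"
  shows "a m0 = 0"
  using assms
proof (induction "card A" arbitrary: A a rule: less_induct)
  case less
  show ?case
  proof (cases "A = {m0}")
    case True
    with less.prems(3)[of "\<lambda>_. 1"] show ?thesis
      using monom_at_pos[of N "\<lambda>_. 1" m0] by auto
  next
    case False
    then obtain m1 where m1: "m1 \<in> A" "m1 \<noteq> m0" using less.prems(4) by blast
    have "\<exists>j\<in>{1..N}. m1 j \<noteq> m0 j"
    proof (rule ccontr)
      assume "\<not> ?thesis"
      then have "m1 = m0" using m1(1) less.prems(2,4) by (intro PiE_ext[of m1 "{1..N}" "\<lambda>_. UNIV"]) auto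
      with m1 show False by simp
    qed
    then obtain j where j: "j \<in> {1..N}" "m1 j \<noteq> m0 j" by blast
    define b where "b = (\<lambda>m. a m * (exp (of_int (m j) * ln 2) - exp (of_int (m1 j) * ln 2)))"
    have "b m0 = 0"
    proof (rule less.hyps[of "A - {m1}"])
      show "card (A - {m1}) < card A"
        using m1 less.prems(1) by (rule_tac card_Diff1_less) auto
      fix z :: "nat \<Rightarrow> real" assume z: "\<And>i. z i > 0"
      have scale: "monom_at N (z(j := 2 * z j)) m = exp (of_int (m j) * ln 2) * monom_at N z m" for m
      proof -
        have "monom_at N z m = monom_at N (z(j := z j)) m" by simp
        then show ?thesis unfolding monom_at_upd[OF j(1)] using z[of j]
          by (simp add: ln_mult distrib_left exp_add)
      qed
      have "(\<Sum>m\<in>A - {m1}. b m * monom_at N z m) = (\<Sum>m\<in>A. b m * monom_at N z m)"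
        using less.prems(1) by (intro sum.mono_neutral_left) (auto simp: b_def)
      also have "\<dots> = (\<Sum>m\<in>A. a m * monom_at N (z(j := 2 * z j)) m)
          - exp (of_int (m1 j) * ln 2) * (\<Sum>m\<in>A. a m * monom_at N z m)"
        unfolding scale b_def sum_distrib_left sum_subtractf [symmetric]
        by (intro sum.cong) (auto simp: algebra_simps)
      also have "\<dots> = 0"
        using less.prems(3)[of z] less.prems(3)[of "z(j := 2 * z j)"] z by simp
      finally show "(\<Sum>m\<in>A - {m1}. b m * monom_at N z m) = 0" .
    qed (use less.prems m1 in auto)
    then show ?thesis using j by (simp add: b_def)
  qed
qed

text \<open>The series with exponents in the cone, graded by height so that every coefficient is a
  finite sum.\<close>

definition cone_series :: "nat \<Rightarrow> (nat \<Rightarrow> real) \<Rightarrow> ((nat \<Rightarrow> int) \<Rightarrow> real) \<Rightarrow> real fps" where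
  "cone_series N z a = Abs_fps (\<lambda>d. \<Sum>m\<in>cone_at N d. a m * monom_at N z m)"

lemma cone_series_unique:
  assumes "\<And>z. (\<And>i. z i > 0) \<Longrightarrow> cone_series N z a = cone_series N z b"
    and "m \<in> {1..N} \<rightarrow>\<^sub>E UNIV" "exp_cone N m"
  shows "a m = b m"
proof -
  define d where "d = nat (height N m)"
  have m: "m \<in> cone_at N d"
    using assms(2,3) exp_cone_height_nonneg[of N m] by (simp add: cone_at_def d_def)
  have "(\<lambda>m. a m - b m) m = 0"
  proof (rule monom_at_independent[OF finite_cone_at _ _ m])
    show "cone_at N d \<subseteq> {1..N} \<rightarrow>\<^sub>E UNIV" by (auto simp: cone_at_def)
    fix z :: "nat \<Rightarrow> real" assume "\<And>i. z i > 0"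
    then have "cone_series N z a $ d = cone_series N z b $ d" using assms(1) by simp
    then show "(\<Sum>m\<in>cone_at N d. (a m - b m) * monom_at N z m) = 0"
      by (simp add: cone_series_def left_diff_distrib sum_subtractf)
  qed
  then show ?thesis by simp
qed

lemma cone_series_add: "cone_series N z (\<lambda>m. a m + b m) = cone_series N z a + cone_series N z b"
  by (simp add: cone_series_def fps_eq_iff distrib_right sum.distrib)

lemma cone_series_diff: "cone_series N z (\<lambda>m. a m - b m) = cone_series N z a - cone_series N z b"
  by (simp add: cone_series_def fps_eq_iff left_diff_distrib sum_subtractf)

lemma cone_series_cmult: "cone_series N z (\<lambda>m. c * a m) = fps_const c * cone_series N z a"
  by (simp add: cone_series_def fps_eq_iff sum_distrib_left mult.assoc)

lemma cone_series_sum: "cone_series N z (\<lambda>m. \<Sum>i\<in>I. a i m) = (\<Sum>i\<in>I. cone_series N z (a i))"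
proof (induction I rule: infinite_finite_induct)
  case (insert i I)
  then show ?case by (simp add: cone_series_add)
qed (simp_all add: cone_series_def fps_eq_iff)

lemma cone_series_cong:
  "(\<And>m. m \<in> {1..N} \<rightarrow>\<^sub>E UNIV \<Longrightarrow> exp_cone N m \<Longrightarrow> a m = b m) \<Longrightarrow> cone_series N z a = cone_series N z b"
  unfolding cone_series_def fps_eq_iff by (auto simp: cone_at_def intro!: sum.cong)

lemma cone_series_deriv_z:
  assumes "j \<in> {1..N}" "z j > 0"
  shows "has_fps_derivative_at (\<lambda>t. cone_series N (z(j := t)) a)
    (fps_const (1 / z j) * cone_series N z (\<lambda>m. of_int (m j) * a m)) (z j)"
  unfolding has_fps_derivative_at_def
proof
  fix n
  have "((\<lambda>t. \<Sum>m\<in>cone_at N n. a m * monom_at N (z(j := t)) m) has_real_derivative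
      (\<Sum>m\<in>cone_at N n. a m * (of_int (m j) / z j * monom_at N z m))) (at (z j))"
    by (intro DERIV_sum DERIV_cmult monom_at_deriv assms)
  then show "((\<lambda>t. cone_series N (z(j := t)) a $ n) has_real_derivative
      (fps_const (1 / z j) * cone_series N z (\<lambda>m. of_int (m j) * a m)) $ n) (at (z j))"
    by (simp add: cone_series_def sum_divide_distrib mult_ac)
qed

text \<open>Exponent vectors are functions on all of \<open>nat\<close>, and a shifted vector need
  not be extensional on 1..N. Independence of the other values allows passing to the restriction and
  back.\<close>

definition local_on :: "nat \<Rightarrow> ((nat \<Rightarrow> int) \<Rightarrow> 'b) \<Rightarrow> bool" where
  "local_on N a \<longleftrightarrow> (\<forall>m m'. (\<forall>j\<in>{1..N}. m j = m' j) \<longrightarrow> a m = a m')"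

lemma local_onD: "local_on N a \<Longrightarrow> (\<And>j. j \<in> {1..N} \<Longrightarrow> m j = m' j) \<Longrightarrow> a m = a m'"
  by (auto simp: local_on_def)

text \<open>Translation by v is a bijection from the cone at height d - w onto those m at height d
  for which m - v lies in the cone; for the remaining m the translated coefficient is zero by the
  support hypothesis.\<close>

lemma cone_series_shift:
  assumes a: "local_on N a" and sup: "\<And>m. \<not> exp_cone N m \<Longrightarrow> a m = 0"
    and v: "exp_cone N v" "height N v = int w"
  shows "fps_const (monom_at N z v) * fps_X ^ w * cone_series N z a
    = cone_series N z (\<lambda>m. a (\<lambda>j. m j - v j))"
proof (rule fps_ext)
  fix d
  define B where "B = {m \<in> cone_at N d. exp_cone N (\<lambda>j. m j - v j)}"
  have rhs: "cone_series N z (\<lambda>m. a (\<lambda>j. m j - v j)) $ d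
      = (\<Sum>m\<in>B. a (\<lambda>j. m j - v j) * monom_at N z m)"
    unfolding cone_series_def fps_nth_Abs_fps
    by (rule sum.mono_neutral_right[OF finite_cone_at]) (auto simp: B_def sup)
  have lhs: "(fps_const (monom_at N z v) * fps_X ^ w * cone_series N z a) $ d
      = (if d < w then 0 else \<Sum>m\<in>cone_at N (d - w). a m * (monom_at N z m * monom_at N z v))"
    by (simp add: mult.assoc fps_X_power_mult_nth cone_series_def sum_distrib_left mult_ac)
  show "(fps_const (monom_at N z v) * fps_X ^ w * cone_series N z a) $ d =
    cone_series N z (\<lambda>m. a (\<lambda>j. m j - v j)) $ d"
  proof (cases "d < w")
    case True
    have "B = {}"
      using True v(2) by (auto simp: B_def cone_at_def height_diff dest!: exp_cone_height_nonneg)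
    with True show ?thesis unfolding lhs rhs by simp
  next
    case False
    have "(\<Sum>m\<in>cone_at N (d - w). a m * (monom_at N z m * monom_at N z v))
      = (\<Sum>m\<in>B. a (\<lambda>j. m j - v j) * monom_at N z m)"
    proof (rule sum.reindex_bij_witness[of _ "\<lambda>m. restrict (\<lambda>j. m j - v j) {1..N}"
          "\<lambda>m. restrict (\<lambda>j. m j + v j) {1..N}"])
      fix m assume m: "m \<in> cone_at N (d - w)"
      then have ext: "m \<in> {1..N} \<rightarrow>\<^sub>E UNIV" and c: "exp_cone N m" and h: "height N m = int (d - w)"
        by (auto simp: cone_at_def)
      show "restrict (\<lambda>j. restrict (\<lambda>j. m j + v j) {1..N} j - v j) {1..N} = m"
        using ext by (intro PiE_ext[of _ "{1..N}" "\<lambda>_. UNIV"]) auto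
      have h': "height N (restrict (\<lambda>j. m j + v j) {1..N}) = int d"
        using False h v(2) height_add[of N m v] by (subst height_cong[of N _ "\<lambda>j. m j + v j"]) auto
      have c': "exp_cone N (restrict (\<lambda>j. m j + v j) {1..N})"
        using exp_cone_add[OF c v(1)] by (subst exp_cone_cong[of N _ "\<lambda>j. m j + v j"]) auto
      have c'': "exp_cone N (\<lambda>j. restrict (\<lambda>j. m j + v j) {1..N} j - v j)"
        using c by (subst exp_cone_cong[of N _ m]) auto
      show "restrict (\<lambda>j. m j + v j) {1..N} \<in> B"
        using h' c' c'' by (auto simp: B_def cone_at_def)
      have "a (\<lambda>j. restrict (\<lambda>j. m j + v j) {1..N} j - v j) = a m"
        by (rule local_onD[OF a]) auto
      moreover have "monom_at N z (restrict (\<lambda>j. m j + v j) {1..N}) = monom_at N z (\<lambda>j. m j + v j)"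
        by (rule monom_at_cong) auto
      ultimately show "a (\<lambda>j. restrict (\<lambda>j. m j + v j) {1..N} j - v j)
          * monom_at N z (restrict (\<lambda>j. m j + v j) {1..N})
          = a m * (monom_at N z m * monom_at N z v)"
        by (simp add: monom_at_add)
    next
      fix m assume m: "m \<in> B"
      then have ext: "m \<in> {1..N} \<rightarrow>\<^sub>E UNIV" and c: "exp_cone N (\<lambda>j. m j - v j)" and h: "height N m = int d"
        by (auto simp: cone_at_def B_def)
      show "restrict (\<lambda>j. restrict (\<lambda>j. m j - v j) {1..N} j + v j) {1..N} = m"
        using ext by (intro PiE_ext[of _ "{1..N}" "\<lambda>_. UNIV"]) auto
      have "height N (restrict (\<lambda>j. m j - v j) {1..N}) = int (d - w)"
        using False h v(2) height_diff[of N m v] by (subst height_cong[of N _ "\<lambda>j. m j - v j"]) auto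
      moreover have "exp_cone N (restrict (\<lambda>j. m j - v j) {1..N})"
        using c by (subst exp_cone_cong[of N _ "\<lambda>j. m j - v j"]) auto
      ultimately show "restrict (\<lambda>j. m j - v j) {1..N} \<in> cone_at N (d - w)"
        by (auto simp: cone_at_def)
    qed
    then show ?thesis unfolding lhs rhs using False by simp
  qed
qed

definition unit_vec :: "nat \<Rightarrow> nat \<Rightarrow> int" where
  "unit_vec k i = of_bool (i = k)"

lemma tail_unit_vec: "k \<in> {1..N} \<Longrightarrow> tail N (unit_vec k) i = of_bool (i \<le> k)"
  by (auto simp: tail_def unit_vec_def of_bool_def)

lemma height_unit_vec: "k \<in> {1..N} \<Longrightarrow> height N (unit_vec k) = int k"
  by (simp add: height_def unit_vec_def of_bool_def if_distrib if_distribR cong: if_cong)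

lemma monom_at_unit_vec:
  assumes "k \<in> {1..N}" "z k > 0"
  shows "monom_at N z (unit_vec k) = z k"
proof -
  have "(\<Sum>j=1..N. of_int (unit_vec k j) * ln (z j)) = (\<Sum>j=1..N. if j = k then ln (z k) else 0)"
    by (intro sum.cong) (auto simp: unit_vec_def)
  then show ?thesis using assms by (simp add: monom_at_def)
qed

lemma cone_series_eta:
  assumes "local_on N a" "\<And>m. \<not> exp_cone N m \<Longrightarrow> a m = 0" "k \<in> {1..N}" "z k > 0"
  shows "eta z k * cone_series N z a = cone_series N z (\<lambda>m. a (\<lambda>j. m j - unit_vec k j))"
proof -
  have "exp_cone N (unit_vec k)" using assms(3) by (auto simp: exp_cone_def tail_unit_vec)
  from cone_series_shift[OF assms(1,2) this height_unit_vec[OF assms(3)], of z]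
  show ?thesis using monom_at_unit_vec[of k N z] assms(3,4) by (simp add: eta_def)
qed

lemma cone_series_ratio:
  assumes "local_on N a" "\<And>m. \<not> exp_cone N m \<Longrightarrow> a m = 0"
    and jk: "(j, k) \<in> index_pairs N" and z: "\<And>i. z i > 0"
  shows "fps_const (z k / z j) * fps_X ^ (k - j) * cone_series N z a
    = cone_series N z (\<lambda>m. a (\<lambda>i. m i - (unit_vec k i - unit_vec j i)))"
proof -
  have jk': "j \<in> {1..N}" "k \<in> {1..N}" "j < k" using jk by (auto simp: index_pairs_def)
  have c: "exp_cone N (\<lambda>i. unit_vec k i - unit_vec j i)"
    using jk' by (auto simp: exp_cone_def tail_unit_vec tail_diff)
  have h: "height N (\<lambda>i. unit_vec k i - unit_vec j i) = int (k - j)"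
    using jk' by (auto simp: height_unit_vec height_diff)
  have "monom_at N z (unit_vec k) = monom_at N z (\<lambda>i. unit_vec k i - unit_vec j i) * monom_at N z (unit_vec j)"
    unfolding monom_at_add [symmetric] by simp
  then have "monom_at N z (\<lambda>i. unit_vec k i - unit_vec j i) = z k / z j"
    using jk' z[of j] z[of k] by (simp add: monom_at_unit_vec field_simps)
  with cone_series_shift[OF assms(1,2) c h, of z] show ?thesis by simp
qed

text \<open>The degree is counted in \<open>z\<^sub>j = 1 / y\<^sub>j\<close>, so \<open>kernel_coeff N lam x m\<close> below belongs to
  \<open>\<Prod>\<^sub>j y\<^sub>j\<^bsup>-m j\<^esup>\<close>.\<close>

definition y_degree :: "nat \<Rightarrow> (nat \<times> nat \<Rightarrow> nat) \<Rightarrow> (nat \<times> nat \<Rightarrow> nat) \<Rightarrow> nat \<Rightarrow> int" where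
  "y_degree N p q j = (\<Sum>i\<in>{1..<j}. int (p (i, j))) - (\<Sum>k\<in>{j<..N}. int (p (j, k)))
     + (\<Sum>i\<in>{1..N}. int (q (i, j)))"

text \<open>Exchange of summation for an arbitrary linear functional l of the degree. With l j = j
  it yields the height, with the indicator of k \<le> j a tail, with l j = ln (z j) the monomial,
  and with l = 1 the degree in x.\<close>

lemma y_degree_linear:
  fixes l :: "nat \<Rightarrow> 'a::comm_ring_1"
  shows "(\<Sum>j=1..N. of_int (y_degree N p q j) * l j)
    = (\<Sum>(j, k)\<in>index_pairs N. of_nat (p (j, k)) * (l k - l j))
      + (\<Sum>(i, k)\<in>{1..N} \<times> {1..N}. of_nat (q (i, k)) * l k)"
proof -
  have d: "(of_int (y_degree N p q j) :: 'a) = (\<Sum>i=1..N. if i < j then of_nat (p (i, j)) else 0)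
     - (\<Sum>k=1..N. if j < k then of_nat (p (j, k)) else 0) + (\<Sum>i=1..N. of_nat (q (i, j)))"
    if j: "j \<in> {1..N}" for j
  proof -
    have "(\<Sum>i\<in>{1..<j}. of_nat (p (i, j))) = (\<Sum>i=1..N. if i < j then of_nat (p (i, j)) else (0::'a))"
      using j by (intro sum.mono_neutral_cong_left) auto
    moreover have "(\<Sum>k\<in>{j<..N}. of_nat (p (j, k))) = (\<Sum>k=1..N. if j < k then of_nat (p (j, k)) else (0::'a))"
      using j by (intro sum.mono_neutral_cong_left) auto
    ultimately show ?thesis by (simp add: y_degree_def)
  qed
  have "(\<Sum>j=1..N. of_int (y_degree N p q j) * l j)
    = (\<Sum>j=1..N. \<Sum>i=1..N. if i < j then of_nat (p (i, j)) * l j else 0)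
      - (\<Sum>j=1..N. \<Sum>k=1..N. if j < k then of_nat (p (j, k)) * l j else 0)
      + (\<Sum>j=1..N. \<Sum>i=1..N. of_nat (q (i, j)) * l j)"
  proof -
    have "(\<Sum>j=1..N. of_int (y_degree N p q j) * l j)
      = (\<Sum>j=1..N. (\<Sum>i=1..N. if i < j then of_nat (p (i, j)) * l j else 0)
      - (\<Sum>k=1..N. if j < k then of_nat (p (j, k)) * l j else 0)
      + (\<Sum>i=1..N. of_nat (q (i, j)) * l j))"
      by (intro sum.cong refl) (simp add: d distrib_right left_diff_distrib sum_distrib_right
          if_distribR if_distrib[of "\<lambda>x. x * _"] cong: if_cong)
    then show ?thesis by (simp add: sum.distrib sum_subtractf)
  qed
  also have "(\<Sum>j=1..N. \<Sum>i=1..N. if i < j then of_nat (p (i, j)) * l j else 0)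
      = (\<Sum>i=1..N. \<Sum>j=1..N. if i < j then of_nat (p (i, j)) * l j else 0)"
    by (rule sum.swap)
  also have "(\<Sum>j=1..N. \<Sum>i=1..N. of_nat (q (i, j)) * l j) = (\<Sum>i=1..N. \<Sum>j=1..N. of_nat (q (i, j)) * l j)"
    by (rule sum.swap)
  finally have F: "(\<Sum>j=1..N. of_int (y_degree N p q j) * l j)
    = (\<Sum>i=1..N. \<Sum>j=1..N. if i < j then of_nat (p (i, j)) * l j else 0)
      - (\<Sum>j=1..N. \<Sum>k=1..N. if j < k then of_nat (p (j, k)) * l j else 0)
      + (\<Sum>i=1..N. \<Sum>j=1..N. of_nat (q (i, j)) * l j)" .
  have "(\<Sum>i=1..N. \<Sum>j=1..N. if i < j then of_nat (p (i, j)) * l j else 0)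
      - (\<Sum>j=1..N. \<Sum>k=1..N. if j < k then of_nat (p (j, k)) * l j else 0)
    = (\<Sum>(j, k)\<in>index_pairs N. of_nat (p (j, k)) * (l k - l j))"
    unfolding sum_index_pairs sum_subtractf [symmetric] right_diff_distrib
    by (intro sum.cong) auto
  then show ?thesis unfolding F by (simp add: sum.cartesian_product)
qed

definition kernel_indices :: "nat \<Rightarrow> ((nat \<times> nat \<Rightarrow> nat) \<times> (nat \<times> nat \<Rightarrow> nat)) set" where
  "kernel_indices N = (index_pairs N \<rightarrow>\<^sub>E UNIV) \<times> ({1..N} \<times> {1..N} \<rightarrow>\<^sub>E UNIV)"

definition kernel_term ::
  "nat \<Rightarrow> real \<Rightarrow> (nat \<Rightarrow> real) \<Rightarrow> (nat \<times> nat \<Rightarrow> nat) \<Rightarrow> (nat \<times> nat \<Rightarrow> nat) \<Rightarrow> real" where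
  "kernel_term N lam x p q = (\<Prod>jk\<in>index_pairs N. (lam gchoose p jk) * (-1) ^ p jk)
     * (\<Prod>(j, k)\<in>{1..N} \<times> {1..N}. ((- lam) gchoose q (j, k)) * (- x j) ^ q (j, k))"

definition kernel_coeff :: "nat \<Rightarrow> real \<Rightarrow> (nat \<Rightarrow> real) \<Rightarrow> (nat \<Rightarrow> int) \<Rightarrow> real" where
  "kernel_coeff N lam x m =
     (\<Sum>(p, q)\<in>{(p, q). (p, q) \<in> kernel_indices N \<and> (\<forall>j\<in>{1..N}. y_degree N p q j = m j)}.
        kernel_term N lam x p q)"

definition kernel_weight :: "nat \<Rightarrow> (nat \<times> nat \<Rightarrow> nat) \<Rightarrow> (nat \<times> nat \<Rightarrow> nat) \<Rightarrow> nat" where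
  "kernel_weight N p q = (\<Sum>jk\<in>index_pairs N. (snd jk - fst jk) * p jk)
     + (\<Sum>ik\<in>{1..N} \<times> {1..N}. snd ik * q ik)"

lemma kernel_weight_eq_height: "int (kernel_weight N p q) = height N (y_degree N p q)"
proof -
  have "height N (y_degree N p q)
    = (\<Sum>(j, k)\<in>index_pairs N. int (p (j, k)) * (int k - int j))
      + (\<Sum>(i, k)\<in>{1..N} \<times> {1..N}. int (q (i, k)) * int k)"
    unfolding height_def using y_degree_linear[of N p q int] by simp
  also have "\<dots> = int (kernel_weight N p q)"
    unfolding kernel_weight_def of_nat_add of_nat_sum
    by (intro arg_cong2[of _ _ _ _ "(+)"] sum.cong) (auto simp: index_pairs_def of_nat_diff mult.commute)
  finally show ?thesis ..
qed

lemma exp_cone_y_degree: "exp_cone N (y_degree N p q)"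
  unfolding exp_cone_def
proof
  fix k assume k: "k \<in> {1..N}"
  have "tail N (y_degree N p q) k = (\<Sum>j=1..N. y_degree N p q j * of_bool (k \<le> j))"
    unfolding tail_def using k by (intro sum.mono_neutral_cong_left) auto
  also have "\<dots> = (\<Sum>(j, i)\<in>index_pairs N. int (p (j, i)) * (of_bool (k \<le> i) - of_bool (k \<le> j)))
      + (\<Sum>(j, i)\<in>{1..N} \<times> {1..N}. int (q (j, i)) * of_bool (k \<le> i))"
    using y_degree_linear[of N p q "\<lambda>j. of_bool (k \<le> j) :: int"] by simp
  also have "\<dots> \<ge> 0"
    by (intro add_nonneg_nonneg sum_nonneg) (auto simp: index_pairs_def)
  finally show "0 \<le> tail N (y_degree N p q) k" .
qed

lemma monom_at_y_degree:
  assumes z: "\<And>i. z i > 0"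
  shows "(\<Prod>jk\<in>index_pairs N. (z (snd jk) / z (fst jk)) ^ p jk)
     * (\<Prod>ik\<in>{1..N} \<times> {1..N}. z (snd ik) ^ q ik) = monom_at N z (y_degree N p q)"
proof -
  have pow: "t ^ n = exp (real n * ln t)" if "t > 0" for t :: real and n :: nat
    using that by (simp add: exp_of_nat_mult)
  have z0: "z i \<noteq> 0" for i using z[of i] by simp
  have "(\<Prod>jk\<in>index_pairs N. (z (snd jk) / z (fst jk)) ^ p jk)
    = exp (\<Sum>(j, k)\<in>index_pairs N. real (p (j, k)) * (ln (z k) - ln (z j)))"
    using z by (simp add: exp_sum finite_index_pairs case_prod_beta pow ln_div z0)
  moreover have "(\<Prod>ik\<in>{1..N} \<times> {1..N}. z (snd ik) ^ q ik)
    = exp (\<Sum>(i, k)\<in>{1..N} \<times> {1..N}. real (q (i, k)) * ln (z k))"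
    using z by (simp add: exp_sum case_prod_beta pow)
  ultimately show ?thesis
    unfolding monom_at_def y_degree_linear exp_add by simp
qed

lemma finite_kernel_weight: "finite {(p, q). (p, q) \<in> kernel_indices N \<and> kernel_weight N p q \<le> d}"
proof (rule finite_subset)
  show "{(p, q). (p, q) \<in> kernel_indices N \<and> kernel_weight N p q \<le> d}
    \<subseteq> {p \<in> index_pairs N \<rightarrow>\<^sub>E UNIV. (\<Sum>jk\<in>index_pairs N. (snd jk - fst jk) * p jk) \<le> d}
     \<times> {q \<in> {1..N} \<times> {1..N} \<rightarrow>\<^sub>E UNIV. (\<Sum>ik\<in>{1..N} \<times> {1..N}. snd ik * q ik) \<le> d}"
    by (auto simp: kernel_indices_def kernel_weight_def)
  show "finite ({p \<in> index_pairs N \<rightarrow>\<^sub>E (UNIV :: nat set). (\<Sum>jk\<in>index_pairs N. (snd jk - fst jk) * p jk) \<le> d}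
     \<times> {q \<in> {1..N} \<times> {1..N} \<rightarrow>\<^sub>E (UNIV :: nat set). (\<Sum>ik\<in>{1..N} \<times> {1..N}. snd ik * q ik) \<le> d})"
    by (intro finite_cartesian_product finite_weighted_exponents finite_index_pairs)
       (auto simp: index_pairs_def)
qed

lemma finite_kernel_coeff_indices:
  "finite {(p, q). (p, q) \<in> kernel_indices N \<and> (\<forall>j\<in>{1..N}. y_degree N p q j = m j)}"
proof (rule finite_subset[OF _ finite_kernel_weight])
  show "{(p, q). (p, q) \<in> kernel_indices N \<and> (\<forall>j\<in>{1..N}. y_degree N p q j = m j)}
    \<subseteq> {(p, q). (p, q) \<in> kernel_indices N \<and> kernel_weight N p q \<le> nat (height N m)}"
  proof clarify
    fix p q assume "(p, q) \<in> kernel_indices N" "\<forall>j\<in>{1..N}. y_degree N p q j = m j"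
    then have "int (kernel_weight N p q) = height N m"
      unfolding kernel_weight_eq_height by (intro height_cong) auto
    then show "kernel_weight N p q \<le> nat (height N m)" by simp
  qed
qed

lemma kernel_coeff_eq_0:
  assumes "\<not> exp_cone N m"
  shows "kernel_coeff N lam x m = 0"
proof -
  have "{(p, q). (p, q) \<in> kernel_indices N \<and> (\<forall>j\<in>{1..N}. y_degree N p q j = m j)} = {}"
    using assms exp_cone_y_degree[of N] exp_cone_cong[of N _ m] by blast
  then show ?thesis by (simp only: kernel_coeff_def) simp
qed

lemma local_on_kernel_coeff: "local_on N (kernel_coeff N lam x)"
  by (auto simp: local_on_def kernel_coeff_def intro!: sum.cong)

lemma fps_kernel_nth:
  assumes z: "\<And>i. z i > 0"
  shows "fps_kernel N lam x z $ d
    = (\<Sum>(p, q)\<in>{(p, q). (p, q) \<in> kernel_indices N \<and> kernel_weight N p q = d}.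
        kernel_term N lam x p q * monom_at N z (y_degree N p q))"
proof -
  define Ps where "Ps = (\<lambda>e. {p \<in> index_pairs N \<rightarrow>\<^sub>E (UNIV :: nat set). (\<Sum>jk\<in>index_pairs N. (snd jk - fst jk) * p jk) = e})"
  define Qs where "Qs = (\<lambda>e. {q \<in> {1..N} \<times> {1..N} \<rightarrow>\<^sub>E (UNIV :: nat set). (\<Sum>ik\<in>{1..N} \<times> {1..N}. snd ik * q ik) = e})"
  define A where "A = (\<lambda>p. \<Prod>jk\<in>index_pairs N. (lam gchoose p jk) * (- (z (snd jk) / z (fst jk))) ^ p jk)"
  define B where "B = (\<lambda>q. \<Prod>ik\<in>{1..N} \<times> {1..N}. ((- lam) gchoose q ik) * (- (x (fst ik) * z (snd ik))) ^ q ik)"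
  have finP: "finite (Ps e)" for e
  proof -
    have "finite {p \<in> index_pairs N \<rightarrow>\<^sub>E (UNIV :: nat set). (\<Sum>jk\<in>index_pairs N. (snd jk - fst jk) * p jk) \<le> e}"
      by (rule finite_weighted_exponents[OF finite_index_pairs]) (auto simp: index_pairs_def)
    then show ?thesis by (rule finite_subset[rotated]) (auto simp: Ps_def)
  qed
  have finQ: "finite (Qs e)" for e unfolding Qs_def
    by (rule finite_subset[OF _ finite_weighted_exponents[of "{1..N} \<times> {1..N}" snd e]]) auto
  have 1: "(\<Prod>(j, k)\<in>index_pairs N. binom_fps lam (z k / z j) (k - j)) $ e = (\<Sum>p\<in>Ps e. A p)" for e
    unfolding case_prod_beta Ps_def A_def
    by (subst prod_binom_fps_nth[OF finite_index_pairs]) (auto simp: index_pairs_def)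
  have 2: "(\<Prod>(i, k)\<in>{1..N} \<times> {1..N}. binom_fps (- lam) (x i * z k) k) $ e = (\<Sum>q\<in>Qs e. B q)" for e
    unfolding case_prod_beta Qs_def B_def
    by (subst prod_binom_fps_nth) auto
  have AB: "A p * B q = kernel_term N lam x p q * monom_at N z (y_degree N p q)" for p q
  proof -
    have "A p = (\<Prod>jk\<in>index_pairs N. (lam gchoose p jk) * (-1) ^ p jk)
        * (\<Prod>jk\<in>index_pairs N. (z (snd jk) / z (fst jk)) ^ p jk)"
      unfolding A_def prod.distrib [symmetric]
      by (intro prod.cong refl) (simp add: power_mult_distrib [symmetric] mult.assoc)
    moreover have "B q = (\<Prod>(j, k)\<in>{1..N} \<times> {1..N}. ((- lam) gchoose q (j, k)) * (- x j) ^ q (j, k))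
        * (\<Prod>ik\<in>{1..N} \<times> {1..N}. z (snd ik) ^ q ik)"
      unfolding B_def prod.distrib [symmetric] case_prod_beta
      by (intro prod.cong refl) (simp add: power_mult_distrib [symmetric] mult.assoc)
    ultimately show ?thesis
      unfolding kernel_term_def monom_at_y_degree[where z = z and N = N and p = p and q = q, OF z, symmetric] by (simp only: mult_ac)
  qed
  have "fps_kernel N lam x z $ d = (\<Sum>e=0..d. (\<Sum>p\<in>Ps e. A p) * (\<Sum>q\<in>Qs (d - e). B q))"
    unfolding fps_kernel_def fps_mult_nth 1 2 ..
  also have "\<dots> = (\<Sum>e=0..d. \<Sum>(p, q)\<in>Ps e \<times> Qs (d - e). A p * B q)"
    by (simp add: sum_product sum.cartesian_product)
  also have "\<dots> = (\<Sum>(e, p, q)\<in>(SIGMA e:{0..d}. Ps e \<times> Qs (d - e)). A p * B q)"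
    using finP finQ by (subst sum.Sigma) (auto simp: case_prod_beta)
  also have "\<dots> = (\<Sum>(p, q)\<in>{(p, q). (p, q) \<in> kernel_indices N \<and> kernel_weight N p q = d}. A p * B q)"
    by (rule sum.reindex_bij_witness[of _
          "\<lambda>(p, q). ((\<Sum>jk\<in>index_pairs N. (snd jk - fst jk) * p jk), p, q)" "\<lambda>(e, p, q). (p, q)"])
       (auto simp: Ps_def Qs_def kernel_indices_def kernel_weight_def)
  finally show ?thesis unfolding AB .
qed

text \<open>The expanded product is sorted by degree: the degree of (p, q) determines the monomial,
  lies in the cone, and has the power of T as its height.\<close>

lemma fps_kernel_eq_cone_series:
  assumes z: "\<And>i. z i > 0"
  shows "fps_kernel N lam x z = cone_series N z (kernel_coeff N lam x)"
proof (rule fps_ext)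
  fix d
  define S where "S = {pq \<in> kernel_indices N. kernel_weight N (fst pq) (snd pq) = d}"
  define g where "g = (\<lambda>pq. restrict (y_degree N (fst pq) (snd pq)) {1..N})"
  define h where "h = (\<lambda>pq. kernel_term N lam x (fst pq) (snd pq) * monom_at N z (y_degree N (fst pq) (snd pq)))"
  have S: "finite S"
    by (rule finite_subset[OF _ finite_kernel_weight[of N d]]) (auto simp: S_def)
  have g: "g ` S \<subseteq> cone_at N d"
  proof
    fix m assume "m \<in> g ` S"
    then obtain p q where pq: "(p, q) \<in> S" "m = restrict (y_degree N p q) {1..N}"
      by (auto simp: g_def)
    have "height N m = height N (y_degree N p q)" "exp_cone N m = exp_cone N (y_degree N p q)"
      unfolding pq(2) by (auto intro!: height_cong exp_cone_cong)
    then show "m \<in> cone_at N d"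
      using pq exp_cone_y_degree[of N p q] kernel_weight_eq_height[of N p q]
      by (auto simp: cone_at_def S_def)
  qed
  have "fps_kernel N lam x z $ d = sum h S"
    unfolding fps_kernel_nth[OF z] S_def h_def by (intro sum.cong) auto
  also have "\<dots> = (\<Sum>m\<in>cone_at N d. sum h {pq \<in> S. g pq = m})"
    by (rule sum.group [symmetric]) (use S g finite_cone_at in auto)
  also have "\<dots> = (\<Sum>m\<in>cone_at N d. kernel_coeff N lam x m * monom_at N z m)"
  proof (intro sum.cong refl)
    fix m assume m: "m \<in> cone_at N d"
    have eq: "{pq \<in> S. g pq = m} = {(p, q). (p, q) \<in> kernel_indices N \<and> (\<forall>j\<in>{1..N}. y_degree N p q j = m j)}"
    proof (intro set_eqI iffI)
      fix pq assume "pq \<in> {pq \<in> S. g pq = m}"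
      then show "pq \<in> {(p, q). (p, q) \<in> kernel_indices N \<and> (\<forall>j\<in>{1..N}. y_degree N p q j = m j)}"
        by (auto simp: S_def g_def)
    next
      fix pq assume "pq \<in> {(p, q). (p, q) \<in> kernel_indices N \<and> (\<forall>j\<in>{1..N}. y_degree N p q j = m j)}"
      then obtain p q where pq: "pq = (p, q)" "(p, q) \<in> kernel_indices N" "\<forall>j\<in>{1..N}. y_degree N p q j = m j"
        by auto
      have "g pq = m"
        using pq m by (intro PiE_ext[of _ "{1..N}" "\<lambda>_. UNIV"]) (auto simp: g_def cone_at_def)
      moreover have "height N (y_degree N p q) = height N m"
        by (intro height_cong) (use pq in auto)
      then have "kernel_weight N p q = d"
        using m kernel_weight_eq_height[of N p q] by (simp add: cone_at_def)
      ultimately show "pq \<in> {pq \<in> S. g pq = m}"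
        using pq by (auto simp: S_def)
    qed
    show "sum h {pq \<in> S. g pq = m} = kernel_coeff N lam x m * monom_at N z m"
      unfolding eq kernel_coeff_def sum_distrib_right
    proof (intro sum.cong refl)
      fix pq assume "pq \<in> {(p, q). (p, q) \<in> kernel_indices N \<and> (\<forall>j\<in>{1..N}. y_degree N p q j = m j)}"
      then show "h pq = (case pq of (p, q) \<Rightarrow> kernel_term N lam x p q) * monom_at N z m"
        using monom_at_cong[of N "y_degree N (fst pq) (snd pq)" m z]
        by (auto simp: h_def)
    qed
  qed
  finally show "fps_kernel N lam x z $ d = cone_series N z (kernel_coeff N lam x) $ d"
    by (simp add: cone_series_def)
qed


subsection \<open>The kernel identity for the coefficients\<close>

text \<open>Polynomial behaviour along each coordinate axis guarantees that \<open>partial1\<close>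
  and \<open>partial2\<close>, defined through \<open>deriv\<close>, are true derivatives, and it is
  inherited by sums and products without tracking exponents.\<close>

definition coordinatewise_poly :: "((nat \<Rightarrow> real) \<Rightarrow> real) \<Rightarrow> bool" where
  "coordinatewise_poly F \<longleftrightarrow> (\<forall>i x. \<exists>q. \<forall>t. F (x(i := t)) = poly q t)"

definition partial1 :: "nat \<Rightarrow> ((nat \<Rightarrow> real) \<Rightarrow> real) \<Rightarrow> (nat \<Rightarrow> real) \<Rightarrow> real" where
  "partial1 j F x = deriv (\<lambda>z. F (x(j := z))) (x j)"

lemma coordinatewise_poly_const: "coordinatewise_poly (\<lambda>_. c)"
  unfolding coordinatewise_poly_def by (auto intro!: exI[of _ "[:c:]"])

lemma coordinatewise_poly_coord: "coordinatewise_poly (\<lambda>x. x j)"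
  unfolding coordinatewise_poly_def
proof (intro allI)
  fix i and x :: "nat \<Rightarrow> real"
  show "\<exists>q. \<forall>t. (x(i := t)) j = poly q t"
    by (cases "i = j") (auto intro: exI[of _ "[:0, 1:]"] exI[of _ "[:x j:]"])
qed

lemma coordinatewise_poly_add:
  "coordinatewise_poly F \<Longrightarrow> coordinatewise_poly G \<Longrightarrow> coordinatewise_poly (\<lambda>x. F x + G x)"
  unfolding coordinatewise_poly_def by (metis poly_add)

lemma coordinatewise_poly_mult:
  "coordinatewise_poly F \<Longrightarrow> coordinatewise_poly G \<Longrightarrow> coordinatewise_poly (\<lambda>x. F x * G x)"
  unfolding coordinatewise_poly_def by (metis poly_mult)

lemma coordinatewise_poly_sum:
  "(\<And>i. i \<in> I \<Longrightarrow> coordinatewise_poly (F i)) \<Longrightarrow> coordinatewise_poly (\<lambda>x. \<Sum>i\<in>I. F i x)"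
  by (induction I rule: infinite_finite_induct)
     (auto intro!: coordinatewise_poly_const coordinatewise_poly_add)

lemma coordinatewise_poly_prod:
  "(\<And>i. i \<in> I \<Longrightarrow> coordinatewise_poly (F i)) \<Longrightarrow> coordinatewise_poly (\<lambda>x. \<Prod>i\<in>I. F i x)"
  by (induction I rule: infinite_finite_induct)
     (auto intro!: coordinatewise_poly_const coordinatewise_poly_mult)

lemma coordinatewise_poly_power:
  "coordinatewise_poly F \<Longrightarrow> coordinatewise_poly (\<lambda>x. F x ^ n)"
  by (induction n) (auto intro!: coordinatewise_poly_const coordinatewise_poly_mult)

lemma coordinatewise_poly_uminus: "coordinatewise_poly F \<Longrightarrow> coordinatewise_poly (\<lambda>x. - F x)"
  using coordinatewise_poly_mult[OF coordinatewise_poly_const[of "-1"]] by simp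

lemma partial1_deriv:
  assumes "coordinatewise_poly F"
  shows "((\<lambda>t. F (x(i := t))) has_real_derivative partial1 i F (x(i := s))) (at s)"
proof -
  obtain q where q: "\<And>t. F (x(i := t)) = poly q t"
    using assms unfolding coordinatewise_poly_def by blast
  have "(\<lambda>t. poly q t) field_differentiable at s"
    using poly_DERIV field_differentiable_def by blast
  then show ?thesis
    unfolding partial1_def by (simp add: q field_differentiable_derivI)
qed

lemma partial2_deriv:
  assumes "coordinatewise_poly F"
  shows "((\<lambda>t. partial1 i F (x(i := t))) has_real_derivative partial2 i F (x(i := s))) (at s)"
proof -
  obtain q where q: "\<And>t. F (x(i := t)) = poly q t"
    using assms unfolding coordinatewise_poly_def by blast
  have d: "deriv (\<lambda>t. poly p t) = (\<lambda>t. poly (pderiv p) t)" for p :: "real poly"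
    by (auto intro!: DERIV_imp_deriv poly_DERIV)
  have "(\<lambda>t. partial1 i F (x(i := t))) = (\<lambda>t. poly (pderiv q) t)"
    unfolding partial1_def by (simp add: q d)
  moreover have "partial2 i F (x(i := s)) = poly (pderiv (pderiv q)) s"
    unfolding partial2_def by (simp add: q d)
  ultimately show ?thesis by (simp add: poly_DERIV)
qed

lemma partial1_lincomb:
  assumes "\<And>k. k \<in> I \<Longrightarrow> coordinatewise_poly (F k)"
  shows "partial1 i (\<lambda>x. \<Sum>k\<in>I. c k * F k x) x = (\<Sum>k\<in>I. c k * partial1 i (F k) x)"
proof -
  have "((\<lambda>t. \<Sum>k\<in>I. c k * F k (x(i := t))) has_real_derivative
      (\<Sum>k\<in>I. c k * partial1 i (F k) (x(i := x i)))) (at (x i))"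
    by (intro DERIV_sum DERIV_cmult partial1_deriv assms)
  then show ?thesis unfolding partial1_def by (simp add: DERIV_imp_deriv)
qed

lemma partial2_lincomb:
  assumes "\<And>k. k \<in> I \<Longrightarrow> coordinatewise_poly (F k)"
  shows "partial2 i (\<lambda>x. \<Sum>k\<in>I. c k * F k x) x = (\<Sum>k\<in>I. c k * partial2 i (F k) x)"
proof -
  have F: "coordinatewise_poly (\<lambda>x. \<Sum>k\<in>I. c k * F k x)"
    by (intro coordinatewise_poly_sum coordinatewise_poly_mult coordinatewise_poly_const assms)
  have "((\<lambda>t. \<Sum>k\<in>I. c k * partial1 i (F k) (x(i := t))) has_real_derivative
      (\<Sum>k\<in>I. c k * partial2 i (F k) (x(i := x i)))) (at (x i))"
    by (intro DERIV_sum DERIV_cmult partial2_deriv assms)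
  then have "((\<lambda>t. partial1 i (\<lambda>x. \<Sum>k\<in>I. c k * F k x) (x(i := t))) has_real_derivative
      (\<Sum>k\<in>I. c k * partial2 i (F k) x)) (at (x i))"
    by (simp add: partial1_lincomb assms)
  from DERIV_unique[OF this partial2_deriv[OF F]] show ?thesis by simp
qed

lemma coordinatewise_poly_kernel_coeff: "coordinatewise_poly (\<lambda>x. kernel_coeff N lam x m)"
  unfolding kernel_coeff_def kernel_term_def case_prod_beta
  by (intro coordinatewise_poly_sum coordinatewise_poly_mult coordinatewise_poly_prod
      coordinatewise_poly_const coordinatewise_poly_power coordinatewise_poly_uminus
      coordinatewise_poly_coord)

section \<open>Derivatives of the kernel coefficients in x\<close>

lemma cone_series_deriv_x:
  assumes "\<And>m. ((\<lambda>t. H t m) has_real_derivative H' m) (at s)"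
  shows "has_fps_derivative_at (\<lambda>t. cone_series N z (H t)) (cone_series N z H') s"
  unfolding has_fps_derivative_at_def cone_series_def fps_nth_Abs_fps
  using assms by (intro allI DERIV_sum DERIV_cmult_right)

text \<open>The kernel is differentiated in two ways: as a product, which yields the poles, and as a
  cone series, which yields the partial derivatives of the coefficients. Uniqueness of
  coefficientwise derivatives equates the results.\<close>

lemma cone_series_partial1:
  assumes z: "\<And>i. z i > 0" and i: "i \<in> {1..N}"
  shows "cone_series N z (\<lambda>m. partial1 i (\<lambda>x. kernel_coeff N lam x m) x)
    = fps_const lam * (\<Sum>k=1..N. xy_pole x z i k) * fps_kernel N lam x z"
proof -
  have "has_fps_derivative_at (\<lambda>t. fps_kernel N lam (x(i := t)) z)
      (cone_series N z (\<lambda>m. partial1 i (\<lambda>x. kernel_coeff N lam x m) (x(i := x i)))) (x i)"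
    unfolding fps_kernel_eq_cone_series[OF z]
    by (intro cone_series_deriv_x partial1_deriv coordinatewise_poly_kernel_coeff)
  from has_fps_derivative_at_unique[OF this kernel_deriv_x[OF i]] show ?thesis by simp
qed

lemma cone_series_partial2:
  assumes z: "\<And>i. z i > 0" and i: "i \<in> {1..N}"
  shows "cone_series N z (\<lambda>m. partial2 i (\<lambda>x. kernel_coeff N lam x m) x)
    = (fps_const (lam\<^sup>2) * (\<Sum>k=1..N. xy_pole x z i k)\<^sup>2
      + fps_const lam * (\<Sum>k=1..N. (xy_pole x z i k)\<^sup>2)) * fps_kernel N lam x z"
proof -
  have "has_fps_derivative_at
     (\<lambda>t. cone_series N z (\<lambda>m. partial1 i (\<lambda>x. kernel_coeff N lam x m) (x(i := t))))
     (cone_series N z (\<lambda>m. partial2 i (\<lambda>x. kernel_coeff N lam x m) (x(i := x i)))) (x i)"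
    by (intro cone_series_deriv_x partial2_deriv coordinatewise_poly_kernel_coeff)
  then have "has_fps_derivative_at
     (\<lambda>t. fps_const lam * (\<Sum>k=1..N. xy_pole (x(i := t)) z i k) * fps_kernel N lam (x(i := t)) z)
     (cone_series N z (\<lambda>m. partial2 i (\<lambda>x. kernel_coeff N lam x m) x)) (x i)"
    unfolding cone_series_partial1[OF z i] by simp
  from has_fps_derivative_at_unique[OF this kernel_deriv2_x[OF i]] show ?thesis .
qed

text \<open>The resolvent identity for 1/(y - x_i). It absorbs the singular factor 1/(x_i - x_k) of
  the difference quotients into a product of two poles.\<close>

lemma xy_pole_difference:
  assumes z: "\<And>i. z i > 0" and l: "l > 0"
  shows "xy_pole x z i l - xy_pole x z k l = fps_const (x i - x k) * (xy_pole x z i l * xy_pole x z k l)"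
proof -
  define r q e where "r = xy_pole x z i l" and "q = xy_pole x z k l" and "e = eta z l"
  have r: "r * (1 - fps_const (x i) * e) = e" and q: "q * (1 - fps_const (x k) * e) = e"
    unfolding r_def q_def e_def using l by (auto intro: xy_pole_eq)
  have "e * (r - q) = (q * (1 - fps_const (x k) * e)) * r - (r * (1 - fps_const (x i) * e)) * q"
    unfolding r q by (simp add: algebra_simps)
  also have "\<dots> = e * (fps_const (x i - x k) * (r * q))"
    by (simp add: algebra_simps flip: fps_const_sub)
  finally have "r - q = fps_const (x i - x k) * (r * q)"
    using eta_neq_0[of z l, OF z] by (simp add: e_def)
  then show ?thesis by (simp add: r_def q_def)
qed

lemma cone_series_partial1_difference:
  assumes z: "\<And>i. z i > 0" and ik: "i \<in> {1..N}" "k \<in> {1..N}" "x i \<noteq> x k"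
  shows "cone_series N z (\<lambda>m. (partial1 i (\<lambda>x. kernel_coeff N lam x m) x
        - partial1 k (\<lambda>x. kernel_coeff N lam x m) x) / (x i - x k))
    = fps_const lam * (\<Sum>l=1..N. xy_pole x z i l * xy_pole x z k l) * fps_kernel N lam x z"
proof -
  have "cone_series N z (\<lambda>m. (1 / (x i - x k)) * (partial1 i (\<lambda>x. kernel_coeff N lam x m) x
        - partial1 k (\<lambda>x. kernel_coeff N lam x m) x))
    = fps_const (1 / (x i - x k)) * (fps_const lam * fps_kernel N lam x z
        * (\<Sum>l=1..N. xy_pole x z i l - xy_pole x z k l))"
    unfolding cone_series_cmult cone_series_diff cone_series_partial1[OF z ik(1)]
      cone_series_partial1[OF z ik(2)] sum_subtractf by (simp add: algebra_simps)
  also have "(\<Sum>l=1..N. xy_pole x z i l - xy_pole x z k l)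
    = fps_const (x i - x k) * (\<Sum>l=1..N. xy_pole x z i l * xy_pole x z k l)"
    unfolding sum_distrib_left using z by (intro sum.cong refl xy_pole_difference) auto
  also have "fps_const (1 / (x i - x k)) * (fps_const lam * fps_kernel N lam x z
        * (fps_const (x i - x k) * (\<Sum>l=1..N. xy_pole x z i l * xy_pole x z k l)))
    = (fps_const (1 / (x i - x k)) * fps_const (x i - x k)) *
      (fps_const lam * (\<Sum>l=1..N. xy_pole x z i l * xy_pole x z k l) * fps_kernel N lam x z)"
    by (simp only: mult_ac)
  also have "fps_const (1 / (x i - x k)) * fps_const (x i - x k) = 1"
    using ik by (simp only: fps_const_mult) simp
  finally show ?thesis by simp
qed

section \<open>The second derivatives in y on coefficients\<close>

lemma shifted_cong: "n j = n' j \<Longrightarrow> shifted N lam n j = shifted N lam n' j"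
  by (simp add: shifted_def)

lemma exp_cone_shift:
  assumes "exp_cone N (\<lambda>i. m i - v i)" "exp_cone N v"
  shows "exp_cone N m"
  using exp_cone_add[OF assms] by simp

lemma exp_cone_unit_vec: "k \<in> {1..N} \<Longrightarrow> exp_cone N (unit_vec k)"
  by (auto simp: exp_cone_def tail_unit_vec)

text \<open>With the power of y_j included, the coefficient m belongs to y_j^(-sigma), where sigma
  is \<open>shifted N lam m j\<close>. Two derivatives give sigma (sigma + 1) y_j^(-sigma-2), and
  the shift of m by 2 in direction j turns the factor into (sigma - 2)(sigma - 1). The right side is
  the same second derivative expressed through the poles.\<close>

lemma cone_series_y_second_order:
  assumes z: "\<And>i. z i > 0" and j: "j \<in> {1..N}"
  shows "cone_series N z (\<lambda>m. (shifted N lam m j - 1) * (shifted N lam m j - 2)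
        * kernel_coeff N lam x (\<lambda>i. m i - 2 * unit_vec j i))
    = (fps_const (lam\<^sup>2) * (y_drift N x z j)\<^sup>2
        + fps_const lam * ((\<Sum>i=1..N. (xy_pole x z i j)\<^sup>2) - (\<Sum>k=1..N. (yy_pole z j k)\<^sup>2)))
      * fps_kernel N lam x z"
proof -
  define G where "G = kernel_coeff N lam x"
  define c where "c = lam * (real N + 1 - real j)"
  define K where "K = fps_kernel N lam x z"
  define S1 where "S1 = (\<lambda>z. cone_series N z (\<lambda>m. shifted N lam m j * G m))"
  have zj: "z j \<noteq> 0" using z[of j] by simp
  have KG: "fps_kernel N lam x w = cone_series N w G" if "\<And>i. w i > 0" for w
    unfolding G_def by (rule fps_kernel_eq_cone_series) (rule that)
  have S1: "S1 w = fps_const lam * (y_log N x w j + fps_const (real N + 1 - real j)) * fps_kernel N lam x w"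
    if w: "\<And>i. w i > 0" for w
  proof -
    have wj: "w j \<noteq> 0" using w[of j] by simp
    \<comment> \<open>Kernel and cone series are identified only at positive arguments, so the two
      derivatives are compared on the neighbourhood t > 0 of w j.\<close>
    have "eventually (\<lambda>t. cone_series N (w(j := t)) G = fps_kernel N lam x (w(j := t))) (nhds (w j))"
      using eventually_nhds_in_open[OF open_greaterThan, of "w j" 0] w[of j]
      by (auto elim!: eventually_mono intro!: KG[symmetric] simp: w)
    from has_fps_derivative_at_transform[OF cone_series_deriv_z[OF j w] this]
      kernel_deriv_z[OF w j]
    have "fps_const (1 / w j) * cone_series N w (\<lambda>m. of_int (m j) * G m)
      = fps_const (1 / w j) * (fps_const lam * y_log N x w j * fps_kernel N lam x w)"
      by (rule has_fps_derivative_at_unique)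
    then have 1: "cone_series N w (\<lambda>m. of_int (m j) * G m) = fps_const lam * y_log N x w j * fps_kernel N lam x w"
      using wj by simp
    have "S1 w = cone_series N w (\<lambda>m. of_int (m j) * G m) + fps_const c * cone_series N w G"
      unfolding S1_def cone_series_cmult [symmetric] cone_series_add [symmetric]
      by (intro cone_series_cong) (simp add: shifted_def c_def algebra_simps)
    then show ?thesis unfolding 1 KG[OF w, symmetric] c_def
      by (simp add: algebra_simps flip: fps_const_mult)
  qed
  have etaS1: "eta w j * S1 w = fps_const lam * (y_drift N x w j * fps_kernel N lam x w)"
    if w: "\<And>i. w i > 0" for w
  proof -
    have "eta w j * S1 w = fps_const lam *
        ((eta w j * (y_log N x w j + fps_const (real N + 1 - real j))) * fps_kernel N lam x w)"
      unfolding S1[of w, OF w] by (simp only: mult_ac)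
    also have "eta w j * (y_log N x w j + fps_const (real N + 1 - real j)) = y_drift N x w j"
      by (rule eta_y_log[OF w j])
    finally show ?thesis .
  qed
  obtain D where D: "has_fps_derivative_at (\<lambda>t. y_drift N x (z(j := t)) j) D (z j)"
    "fps_const (z j) * (eta z j * D) = (\<Sum>i=1..N. (xy_pole x z i j)\<^sup>2) - (\<Sum>k=1..N. (yy_pole z j k)\<^sup>2)"
    by (rule y_drift_deriv_z[where x = x, OF z j])
  define S2 where "S2 = cone_series N z (\<lambda>m. of_int (m j) * (shifted N lam m j * G m))"
  have "has_fps_derivative_at (\<lambda>t. fps_const lam * (y_drift N x (z(j := t)) j * fps_kernel N lam x (z(j := t))))
     (fps_const lam * (D * fps_kernel N lam x (z(j := z j)) + y_drift N x (z(j := z j)) j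
        * (fps_const (1 / z j) * (fps_const lam * y_log N x z j * K)))) (z j)"
    unfolding K_def
    by (intro has_fps_derivative_at_cmult has_fps_derivative_at_mult D kernel_deriv_z z j)
  then have d1: "has_fps_derivative_at (\<lambda>t. fps_const lam * (y_drift N x (z(j := t)) j * fps_kernel N lam x (z(j := t))))
     (fps_const lam * (D * K + y_drift N x z j
        * (fps_const (1 / z j) * (fps_const lam * y_log N x z j * K)))) (z j)"
    by (simp add: K_def)
  have "has_fps_derivative_at (\<lambda>t. fps_const t * fps_X ^ j * S1 (z(j := t)))
      ((fps_const 1 * fps_X ^ j + fps_const (z j) * 0) * S1 (z(j := z j))
       + (fps_const (z j) * fps_X ^ j) * (fps_const (1 / z j) * S2)) (z j)"
    unfolding S1_def S2_def
    by (intro has_fps_derivative_at_mult has_fps_derivative_at_fps_const has_fps_derivative_at_const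
        DERIV_ident cone_series_deriv_z j z)
  then have d2: "has_fps_derivative_at (\<lambda>t. eta (z(j := t)) j * S1 (z(j := t)))
      (fps_X ^ j * S1 z + fps_X ^ j * S2) (z j)"
  proof -
    assume d: "has_fps_derivative_at (\<lambda>t. fps_const t * fps_X ^ j * S1 (z(j := t)))
      ((fps_const 1 * fps_X ^ j + fps_const (z j) * 0) * S1 (z(j := z j))
       + (fps_const (z j) * fps_X ^ j) * (fps_const (1 / z j) * S2)) (z j)"
    have "fps_const (z j) * fps_const (1 / z j) = 1"
      using zj by (simp only: fps_const_mult) simp
    then have "(fps_const (z j) * fps_X ^ j) * (fps_const (1 / z j) * S2) = fps_X ^ j * S2"
      by (metis mult.assoc mult.left_commute mult_1)
    with d show ?thesis by (simp add: eta_def)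
  qed
  have "eventually (\<lambda>t. eta (z(j := t)) j * S1 (z(j := t))
      = fps_const lam * (y_drift N x (z(j := t)) j * fps_kernel N lam x (z(j := t)))) (nhds (z j))"
    using eventually_nhds_in_open[OF open_greaterThan, of "z j" 0] z[of j]
    by (auto elim!: eventually_mono intro!: etaS1 simp: z)
  from has_fps_derivative_at_unique[OF has_fps_derivative_at_transform[OF d2 this] d1]
  have "fps_const (z j) * (fps_X ^ j * S1 z + fps_X ^ j * S2)
    = fps_const (z j) * (fps_const lam * (D * K + y_drift N x z j
        * (fps_const (1 / z j) * (fps_const lam * y_log N x z j * K))))" by simp
  also have "\<dots> = fps_const lam * (fps_const (z j) * D * K + (fps_const (z j) * fps_const (1 / z j)) * (y_drift N x z j
        * (fps_const lam * y_log N x z j * K)))"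
    by (simp only: distrib_left mult_ac)
  also have "fps_const (z j) * fps_const (1 / z j) = 1"
    using zj by (simp only: fps_const_mult) simp
  finally have e1: "eta z j * (S1 z + S2) = fps_const lam * (fps_const (z j) * D * K + y_drift N x z j
        * (fps_const lam * y_log N x z j * K))"
    by (simp add: eta_def distrib_left mult.assoc)
  \<comment> \<open>Differentiating eta * S1 also hits the factor eta, which contributes S1 besides
    S2; together with c S1 the factor of sigma G becomes (m j + 1) + c = sigma + 1.\<close>
  define A where "A = (\<lambda>m. (shifted N lam m j + 1) * shifted N lam m j * G m)"
  have A: "cone_series N z A = (S1 z + S2) + fps_const c * S1 z"
    unfolding S1_def S2_def cone_series_cmult [symmetric] cone_series_add [symmetric]
    by (intro cone_series_cong) (simp add: A_def shifted_def c_def algebra_simps)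
  have "eta z j * (eta z j * cone_series N z A)
    = eta z j * (fps_const lam * (fps_const (z j) * D * K + y_drift N x z j
        * (fps_const lam * y_log N x z j * K))
      + fps_const c * (fps_const lam * (y_drift N x z j * K)))"
    unfolding A distrib_left[of "eta z j" "S1 z + S2"] e1
    using etaS1[OF z] by (simp add: K_def mult_ac)
  also have "\<dots> = fps_const lam * (fps_const (z j) * (eta z j * D)) * K
      + fps_const lam * fps_const lam * y_drift N x z j
        * (eta z j * (y_log N x z j + fps_const (real N + 1 - real j))) * K"
    unfolding c_def by (simp add: algebra_simps flip: fps_const_mult)
  also have "\<dots> = (fps_const (lam\<^sup>2) * (y_drift N x z j)\<^sup>2
        + fps_const lam * ((\<Sum>i=1..N. (xy_pole x z i j)\<^sup>2) - (\<Sum>k=1..N. (yy_pole z j k)\<^sup>2))) * K"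
    unfolding D(2) eta_y_log[OF z j]
    by (simp add: algebra_simps power2_eq_square flip: fps_const_mult)
  finally have e2: "eta z j * (eta z j * cone_series N z A) = \<dots>" .
  have loc: "local_on N A"
    unfolding local_on_def A_def
  proof (intro allI impI)
    fix m m' :: "nat \<Rightarrow> int" assume a: "\<forall>i\<in>{1..N}. m i = m' i"
    then have "G m = G m'" unfolding G_def by (intro local_onD[OF local_on_kernel_coeff]) auto
    moreover have "shifted N lam m j = shifted N lam m' j" using a j by (intro shifted_cong) auto
    ultimately show "(shifted N lam m j + 1) * shifted N lam m j * G m
      = (shifted N lam m' j + 1) * shifted N lam m' j * G m'" by simp
  qed
  have sup: "A m = 0" if "\<not> exp_cone N m" for m
    using that by (simp add: A_def G_def kernel_coeff_eq_0)
  have loc': "local_on N (\<lambda>m. A (\<lambda>i. m i - unit_vec j i))"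
    unfolding local_on_def by (intro allI impI local_onD[OF loc]) auto
  have sup': "A (\<lambda>i. m i - unit_vec j i) = 0" if "\<not> exp_cone N m" for m
    using that by (intro sup) (blast intro: exp_cone_shift exp_cone_unit_vec j)
  \<comment> \<open>Each factor eta translates the coefficients by one unit in direction j, so sigma
    drops by 2 altogether.\<close>
  have "eta z j * (eta z j * cone_series N z A) = cone_series N z (\<lambda>m. A (\<lambda>i. m i - unit_vec j i - unit_vec j i))"
  proof -
    have "eta z j * cone_series N z A = cone_series N z (\<lambda>m. A (\<lambda>i. m i - unit_vec j i))"
      by (rule cone_series_eta[OF loc sup j z])
    moreover have "eta z j * cone_series N z (\<lambda>m. A (\<lambda>i. m i - unit_vec j i))
      = cone_series N z (\<lambda>m. A (\<lambda>i. m i - unit_vec j i - unit_vec j i))"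
      by (rule cone_series_eta[OF loc' sup' j z])
    ultimately show ?thesis by simp
  qed
  also have "(\<lambda>m. A (\<lambda>i. m i - unit_vec j i - unit_vec j i))
    = (\<lambda>m. (shifted N lam m j - 1) * (shifted N lam m j - 2) * G (\<lambda>i. m i - 2 * unit_vec j i))"
    unfolding A_def by (intro ext) (simp add: shifted_def unit_vec_def algebra_simps)
  finally show ?thesis unfolding e2 G_def K_def by simp
qed

section \<open>The inverse square interaction on coefficients\<close>

lemma kernel_coeff_pair_vanish:
  assumes jk: "(j, k) \<in> index_pairs N" and "tail N m k < int \<nu> + 1"
  shows "kernel_coeff N lam x (\<lambda>i. m i + (int \<nu> - 1) * unit_vec j i - (int \<nu> + 1) * unit_vec k i) = 0"
proof -
  have jk': "j \<in> {1..N}" "k \<in> {1..N}" "j < k" using jk by (auto simp: index_pairs_def)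
  have "tail N (\<lambda>i. (int \<nu> - 1) * unit_vec j i) k = (int \<nu> - 1) * tail N (unit_vec j) k"
    "tail N (\<lambda>i. (int \<nu> + 1) * unit_vec k i) k = (int \<nu> + 1) * tail N (unit_vec k) k"
    by (simp_all add: tail_def sum_distrib_left)
  then have "tail N (\<lambda>i. m i + (int \<nu> - 1) * unit_vec j i - (int \<nu> + 1) * unit_vec k i) k < 0"
    using jk' assms(2) by (simp add: tail_add tail_diff tail_unit_vec)
  then show ?thesis using jk' by (intro kernel_coeff_eq_0) (auto simp: exp_cone_def not_le intro!: bexI[of _ k])
qed

text \<open>The coefficients of the kernel multiplied by
  \<open>(y\<^sub>j - y\<^sub>k)\<^sup>-\<^sup>2 = \<Sum>\<nu>. \<nu> y\<^sub>j\<^bsup>\<nu> - 1\<^esup> y\<^sub>k\<^bsup>-\<nu> - 1\<^esup>\<close>; the sum over \<open>\<nu>\<close> is cut off where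
  the terms leave the cone.\<close>

definition pair_sum ::
  "nat \<Rightarrow> real \<Rightarrow> (nat \<Rightarrow> real) \<Rightarrow> nat \<Rightarrow> nat \<Rightarrow> (nat \<Rightarrow> int) \<Rightarrow> real" where
  "pair_sum N lam x j k m = (\<Sum>\<nu><nat (tail N m k).
     real \<nu> * kernel_coeff N lam x (\<lambda>i. m i + (int \<nu> - 1) * unit_vec j i - (int \<nu> + 1) * unit_vec k i))"

lemma pair_sum_eq:
  assumes "(j, k) \<in> index_pairs N" "nat (tail N m k) \<le> M"
  shows "pair_sum N lam x j k m = (\<Sum>\<nu><M.
     real \<nu> * kernel_coeff N lam x (\<lambda>i. m i + (int \<nu> - 1) * unit_vec j i - (int \<nu> + 1) * unit_vec k i))"
  unfolding pair_sum_def using assms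
  by (intro sum.mono_neutral_left) (auto intro!: kernel_coeff_pair_vanish)

lemma pair_sum_eq_0:
  assumes m: "\<not> exp_cone N m" and jk: "(j, k) \<in> index_pairs N"
  shows "pair_sum N lam x j k m = 0"
proof -
  have jk': "j \<in> {1..N}" "k \<in> {1..N}" "j < k" using jk by (auto simp: index_pairs_def)
  define v where "v = (\<lambda>i. unit_vec k i - unit_vec j i)"
  have cv: "exp_cone N v"
    using jk' by (auto simp: v_def exp_cone_def tail_unit_vec tail_diff)
  show ?thesis
    unfolding pair_sum_def
  proof (intro sum.neutral ballI)
    fix \<nu> :: nat
    show "real \<nu> * kernel_coeff N lam x (\<lambda>i. m i + (int \<nu> - 1) * unit_vec j i - (int \<nu> + 1) * unit_vec k i) = 0"
    proof (cases "\<nu> = 0")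
      case False
      \<comment> \<open>The shift is rewritten as (\<nu> - 1) times e_k - e_j plus 2 e_k, which lies
        in the cone once \<nu> is at least 1; for \<nu> = 0 the summand carries the factor
        0.\<close>
      have "exp_cone N (\<lambda>i. (int \<nu> - 1) * v i + 2 * unit_vec k i)"
      proof -
        have "tail N (\<lambda>i. (int \<nu> - 1) * v i + 2 * unit_vec k i) l = (int \<nu> - 1) * tail N v l + 2 * tail N (unit_vec k) l" for l
          by (simp add: tail_def sum.distrib sum_distrib_left)
        then show ?thesis using cv exp_cone_unit_vec[OF jk'(2)] False
          by (auto simp: exp_cone_def)
      qed
      moreover have "(\<lambda>i. m i + (int \<nu> - 1) * unit_vec j i - (int \<nu> + 1) * unit_vec k i)
        = (\<lambda>i. m i - ((int \<nu> - 1) * v i + 2 * unit_vec k i))"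
        by (simp add: v_def algebra_simps)
      ultimately show ?thesis using m exp_cone_shift kernel_coeff_eq_0 by (metis mult_zero_right)
    qed simp
  qed
qed

text \<open>With \<rho> = y_j/y_k the squared pole is y_k^(-2) (1 - \<rho>)^(-2). The equation is
  verified after multiplication by (1 - \<rho>)^2, which acts on coefficients as a second
  difference, and is then multiplied back by the geometric series.\<close>

lemma cone_series_pair_sum:
  assumes z: "\<And>i. z i > 0" and jk: "(j, k) \<in> index_pairs N"
  shows "cone_series N z (pair_sum N lam x j k) = (yy_pole z j k)\<^sup>2 * fps_kernel N lam x z"
proof -
  have jk': "j \<in> {1..N}" "k \<in> {1..N}" "j < k" using jk by (auto simp: index_pairs_def)
  define G where "G = kernel_coeff N lam x"
  define u where "u = pair_sum N lam x j k"
  define v where "v = (\<lambda>i. unit_vec k i - unit_vec j i)"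
  define \<rho> where "\<rho> = fps_const (z k / z j) * fps_X ^ (k - j)"
  define b where "b = binom_fps (-1) (z k / z j) (k - j)"
  have b: "b * (1 - \<rho>) = 1"
    unfolding b_def \<rho>_def using jk' by (intro binom_fps_minus_one) auto
  have cv: "exp_cone N v"
    using jk' by (auto simp: v_def exp_cone_def tail_unit_vec tail_diff)
  have loc: "local_on N u"
    unfolding local_on_def
  proof (intro allI impI)
    fix m m' :: "nat \<Rightarrow> int" assume a: "\<forall>i\<in>{1..N}. m i = m' i"
    then have "tail N m k = tail N m' k" using jk' by (intro tail_cong) auto
    then show "u m = u m'" unfolding u_def pair_sum_def using a
      by (intro sum.cong arg_cong2[of _ _ _ _ "(*)"] local_onD[OF local_on_kernel_coeff]) auto
  qed
  have sup: "u m = 0" if "\<not> exp_cone N m" for m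
    unfolding u_def using that jk by (rule pair_sum_eq_0)
  have loc': "local_on N (\<lambda>m. u (\<lambda>i. m i - v i))"
    unfolding local_on_def by (intro allI impI local_onD[OF loc]) auto
  have sup': "u (\<lambda>i. m i - v i) = 0" if "\<not> exp_cone N m" for m
    using that by (intro sup) (blast intro: exp_cone_shift cv)
  have 1: "\<rho> * cone_series N z u = cone_series N z (\<lambda>m. u (\<lambda>i. m i - v i))"
    unfolding \<rho>_def v_def by (rule cone_series_ratio[OF loc sup jk z])
  have 2: "\<rho> * (\<rho> * cone_series N z u) = cone_series N z (\<lambda>m. u (\<lambda>i. m i - v i - v i))"
    unfolding 1 unfolding \<rho>_def v_def
    by (rule cone_series_ratio[OF loc'[unfolded v_def] sup'[unfolded v_def] jk z])
  have locG: "local_on N G" unfolding G_def by (rule local_on_kernel_coeff)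
  have supG: "G m = 0" if "\<not> exp_cone N m" for m
    unfolding G_def using that by (rule kernel_coeff_eq_0)
  have locG': "local_on N (\<lambda>m. G (\<lambda>i. m i - unit_vec k i))"
    unfolding local_on_def by (intro allI impI local_onD[OF locG]) auto
  have supG': "G (\<lambda>i. m i - unit_vec k i) = 0" if "\<not> exp_cone N m" for m
    using that by (intro supG) (blast intro: exp_cone_shift exp_cone_unit_vec jk')
  have 3: "eta z k * (eta z k * cone_series N z G) = cone_series N z (\<lambda>m. G (\<lambda>i. m i - unit_vec k i - unit_vec k i))"
  proof -
    have "eta z k * cone_series N z G = cone_series N z (\<lambda>m. G (\<lambda>i. m i - unit_vec k i))"
      by (rule cone_series_eta[OF locG supG jk'(2) z])
    moreover have "eta z k * cone_series N z (\<lambda>m. G (\<lambda>i. m i - unit_vec k i))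
      = cone_series N z (\<lambda>m. G (\<lambda>i. m i - unit_vec k i - unit_vec k i))"
      by (rule cone_series_eta[OF locG' supG' jk'(2) z])
    ultimately show ?thesis by simp
  qed
  have rec: "u m - 2 * u (\<lambda>i. m i - v i) + u (\<lambda>i. m i - v i - v i)
      = G (\<lambda>i. m i - unit_vec k i - unit_vec k i)" for m
  proof -
    define h where "h = (\<lambda>\<nu>::nat. G (\<lambda>i. m i + (int \<nu> - 1) * unit_vec j i - (int \<nu> + 1) * unit_vec k i))"
    define M where "M = nat (tail N m k)"
    have tv: "tail N v k = 1" using jk' by (simp add: v_def tail_diff tail_unit_vec)
    \<comment> \<open>The cut-offs M + 2, M + 1 and M are chosen so that, in terms of h, all three
      sums end at the index M + 1. The second difference of the weights \<nu> is zero, and the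
      boundary terms at 0 and 1 leave only h 1.\<close>
    have u0: "u m = (\<Sum>\<nu><Suc (Suc M). real \<nu> * h \<nu>)"
      unfolding u_def h_def G_def by (rule pair_sum_eq[OF jk]) (simp add: M_def)
    have u1: "u (\<lambda>i. m i - v i) = (\<Sum>\<nu><Suc M. real \<nu> * h (Suc \<nu>))"
    proof -
      have "u (\<lambda>i. m i - v i) = (\<Sum>\<nu><Suc M. real \<nu> * kernel_coeff N lam x
          (\<lambda>i. m i - v i + (int \<nu> - 1) * unit_vec j i - (int \<nu> + 1) * unit_vec k i))"
        unfolding u_def by (rule pair_sum_eq[OF jk]) (simp add: M_def tail_diff tv)
      then show ?thesis
        unfolding h_def G_def v_def by (simp add: algebra_simps)
    qed
    have t2: "tail N (\<lambda>i. m i - v i - v i) k = tail N m k - 2"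
      using tail_diff[of N "\<lambda>i. m i - v i" v k] tail_diff[of N m v k] tv by linarith
    have u2: "u (\<lambda>i. m i - v i - v i) = (\<Sum>\<nu><M. real \<nu> * h (Suc (Suc \<nu>)))"
    proof -
      have "u (\<lambda>i. m i - v i - v i) = (\<Sum>\<nu><M. real \<nu> * kernel_coeff N lam x
          (\<lambda>i. m i - v i - v i + (int \<nu> - 1) * unit_vec j i - (int \<nu> + 1) * unit_vec k i))"
        unfolding u_def by (rule pair_sum_eq[OF jk]) (subst t2, simp add: M_def)
      then show ?thesis
        unfolding h_def G_def v_def by (simp add: algebra_simps)
    qed
    have s1: "(\<Sum>\<nu><Suc (Suc M). (real \<nu> - 1) * h \<nu>) = - h 0 + (\<Sum>\<nu><Suc M. real \<nu> * h (Suc \<nu>))"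
      by (subst sum.lessThan_Suc_shift) simp
    have s2: "(\<Sum>\<nu><Suc (Suc M). (real \<nu> - 2) * h \<nu>) = - 2 * h 0 - h 1 + (\<Sum>\<nu><M. real \<nu> * h (Suc (Suc \<nu>)))"
      by (subst sum.lessThan_Suc_shift, subst sum.lessThan_Suc_shift) simp
    have "(\<Sum>\<nu><Suc (Suc M). real \<nu> * h \<nu>) - 2 * (\<Sum>\<nu><Suc (Suc M). (real \<nu> - 1) * h \<nu>)
        + (\<Sum>\<nu><Suc (Suc M). (real \<nu> - 2) * h \<nu>) = 0"
      unfolding sum_distrib_left sum_subtractf [symmetric] sum.distrib [symmetric]
      by (intro sum.neutral) (simp add: algebra_simps)
    then have "u m - 2 * u (\<lambda>i. m i - v i) + u (\<lambda>i. m i - v i - v i) = h 1"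
      unfolding u0 u1 u2 s1 s2 by simp
    also have "h 1 = G (\<lambda>i. m i - unit_vec k i - unit_vec k i)"
      by (simp add: h_def algebra_simps)
    finally show ?thesis .
  qed
  have "(1 - \<rho>) * ((1 - \<rho>) * cone_series N z u)
    = cone_series N z u - 2 * (\<rho> * cone_series N z u) + \<rho> * (\<rho> * cone_series N z u)"
    by (simp add: algebra_simps)
  also have "\<dots> = cone_series N z (\<lambda>m. u m - 2 * u (\<lambda>i. m i - v i) + u (\<lambda>i. m i - v i - v i))"
    unfolding 2 unfolding 1 cone_series_add cone_series_diff cone_series_cmult
    by (simp add: fps_numeral_fps_const)
  also have "\<dots> = eta z k * (eta z k * fps_kernel N lam x z)"
    unfolding rec 3 [symmetric] fps_kernel_eq_cone_series[OF z] by (simp add: G_def)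
  finally have "b * (1 - \<rho>) * (b * (1 - \<rho>)) * cone_series N z u = b * b * (eta z k * (eta z k * fps_kernel N lam x z))"
    by (simp only: mult_ac)
  then show ?thesis
    unfolding b using jk' by (simp add: u_def yy_pole_def b_def power2_eq_square mult_ac)
qed

text \<open>For fixed x both sides are families in m whose cone series agree at all positive z by
  \<open>kernel_poles\<close>, which settles m in the cone. Outside the cone the kernel coefficient
  is zero identically in x and stays zero under the shifts that occur, so both sides vanish.\<close>

theorem kernel_coeff_identity:
  assumes x: "\<And>i k. (i, k) \<in> index_pairs N \<Longrightarrow> x i \<noteq> x k"
  shows "(\<Sum>i=1..N. partial2 i (\<lambda>x. kernel_coeff N lam x m) x)
      + 2 * lam * (\<Sum>(i, k)\<in>index_pairs N. (partial1 i (\<lambda>x. kernel_coeff N lam x m) x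
          - partial1 k (\<lambda>x. kernel_coeff N lam x m) x) / (x i - x k))
    = (\<Sum>j=1..N. (shifted N lam m j - 1) * (shifted N lam m j - 2)
          * kernel_coeff N lam x (\<lambda>i. m i - 2 * unit_vec j i))
      - 2 * lam * (lam - 1) * (\<Sum>(j, k)\<in>index_pairs N. pair_sum N lam x j k m)"
    (is "?L m = ?R m")
proof -
  have series: "cone_series N z ?L = cone_series N z ?R" if z: "\<And>i. z i > 0" for z
  proof -
    let ?K = "fps_kernel N lam x z"
    have "cone_series N z ?L = (\<Sum>i=1..N. cone_series N z (\<lambda>m. partial2 i (\<lambda>x. kernel_coeff N lam x m) x))
        + fps_const (2 * lam) * (\<Sum>p\<in>index_pairs N. cone_series N z
           (\<lambda>m. (partial1 (fst p) (\<lambda>x. kernel_coeff N lam x m) x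
          - partial1 (snd p) (\<lambda>x. kernel_coeff N lam x m) x) / (x (fst p) - x (snd p))))"
      unfolding cone_series_add cone_series_cmult cone_series_sum case_prod_beta ..
    also have "\<dots> = (\<Sum>i=1..N. (fps_const (lam\<^sup>2) * (\<Sum>k=1..N. xy_pole x z i k)\<^sup>2
            + fps_const lam * (\<Sum>k=1..N. (xy_pole x z i k)\<^sup>2)) * ?K)
        + fps_const (2 * lam) * (\<Sum>p\<in>index_pairs N.
            fps_const lam * (\<Sum>k=1..N. xy_pole x z (fst p) k * xy_pole x z (snd p) k) * ?K)"
      using z x by (intro arg_cong2[of _ _ _ _ "(+)"] arg_cong2[of _ _ _ _ "(*)"] refl sum.cong
          cone_series_partial2 cone_series_partial1_difference) (auto simp: index_pairs_def)
    also have "\<dots> = ((\<Sum>i=1..N. fps_const (lam\<^sup>2) * (\<Sum>k=1..N. xy_pole x z i k)\<^sup>2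
            + fps_const lam * (\<Sum>k=1..N. (xy_pole x z i k)\<^sup>2))
        + fps_const (2 * lam\<^sup>2) * (\<Sum>(i, i')\<in>index_pairs N. \<Sum>k=1..N. xy_pole x z i k * xy_pole x z i' k)) * ?K"
    proof -
      have "fps_const (2 * lam\<^sup>2) = fps_const (2 * lam) * fps_const lam"
        by (simp add: power2_eq_square)
      then show ?thesis
        unfolding sum_distrib_right [symmetric] sum_distrib_left [symmetric] case_prod_beta
        by (simp only: distrib_right distrib_left mult_ac)
    qed
    also have "\<dots> = ((\<Sum>j=1..N. fps_const (lam\<^sup>2) * (y_drift N x z j)\<^sup>2
            + fps_const lam * ((\<Sum>i=1..N. (xy_pole x z i j)\<^sup>2) - (\<Sum>k=1..N. (yy_pole z j k)\<^sup>2)))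
      - fps_const (2 * lam * (lam - 1)) * (\<Sum>(j, k)\<in>index_pairs N. (yy_pole z j k)\<^sup>2)) * ?K"
      unfolding kernel_poles[OF z] ..
    also have "\<dots> = (\<Sum>j=1..N. (fps_const (lam\<^sup>2) * (y_drift N x z j)\<^sup>2
            + fps_const lam * ((\<Sum>i=1..N. (xy_pole x z i j)\<^sup>2) - (\<Sum>k=1..N. (yy_pole z j k)\<^sup>2))) * ?K)
      - fps_const (2 * lam * (lam - 1)) * (\<Sum>p\<in>index_pairs N. (yy_pole z (fst p) (snd p))\<^sup>2 * ?K)"
      unfolding left_diff_distrib sum_distrib_right [symmetric] case_prod_beta mult.assoc ..
    also have "\<dots> = (\<Sum>j=1..N. cone_series N z (\<lambda>m. (shifted N lam m j - 1) * (shifted N lam m j - 2)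
          * kernel_coeff N lam x (\<lambda>i. m i - 2 * unit_vec j i)))
      - fps_const (2 * lam * (lam - 1)) * (\<Sum>p\<in>index_pairs N. cone_series N z (pair_sum N lam x (fst p) (snd p)))"
      using z by (intro arg_cong2[of _ _ _ _ "(-)"] arg_cong2[of _ _ _ _ "(*)"] refl sum.cong
          cone_series_y_second_order[symmetric] cone_series_pair_sum[symmetric]) auto
    also have "\<dots> = cone_series N z ?R"
      unfolding cone_series_diff cone_series_cmult cone_series_sum case_prod_beta ..
    finally show ?thesis .
  qed
  have loc: "?L m = ?L m'" "?R m = ?R m'" if a: "\<And>i. i \<in> {1..N} \<Longrightarrow> m i = m' i" for m m'
  proof -
    have "kernel_coeff N lam x' m = kernel_coeff N lam x' m'" for x'
      by (rule local_onD[OF local_on_kernel_coeff a])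
    then show "?L m = ?L m'" by simp
    have "kernel_coeff N lam x (\<lambda>i. m i - v i) = kernel_coeff N lam x (\<lambda>i. m' i - v i)" for v
      by (rule local_onD[OF local_on_kernel_coeff]) (simp add: a)
    moreover have "shifted N lam m j = shifted N lam m' j" if "j \<in> {1..N}" for j
      using a[OF that] by (rule shifted_cong)
    moreover have "pair_sum N lam x j k m = pair_sum N lam x j k m'" if "(j, k) \<in> index_pairs N" for j k
    proof -
      have "tail N m k = tail N m' k" using that a by (intro tail_cong) (auto simp: index_pairs_def)
      then show ?thesis unfolding pair_sum_def using a
        by (intro sum.cong arg_cong2[of _ _ _ _ "(*)"] local_onD[OF local_on_kernel_coeff]) auto
    qed
    ultimately show "?R m = ?R m'"
      by (intro arg_cong2[of _ _ _ _ "(-)"] arg_cong2[of _ _ _ _ "(*)"] refl sum.cong) auto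
  qed
  show ?thesis
  proof (cases "exp_cone N m")
    case True
    have "exp_cone N (restrict m {1..N})"
      using True by (subst exp_cone_cong[of N _ m]) auto
    then have "?L (restrict m {1..N}) = ?R (restrict m {1..N})"
      using cone_series_unique[of N ?L ?R "restrict m {1..N}"] series by auto
    moreover have "?L m = ?L (restrict m {1..N})" "?R m = ?R (restrict m {1..N})"
      by (rule loc; simp)+
    ultimately show ?thesis by simp
  next
    case False
    have G0: "kernel_coeff N lam x' m = 0" for x' using False by (rule kernel_coeff_eq_0)
    have "?L m = 0" by (simp add: G0 partial1_def partial2_def)
    moreover have "kernel_coeff N lam x (\<lambda>i. m i - 2 * unit_vec j i) = 0" if "j \<in> {1..N}" for j
    proof (rule kernel_coeff_eq_0)
      have "exp_cone N (\<lambda>i. 2 * unit_vec j i)"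
        using exp_cone_add[OF exp_cone_unit_vec[OF that] exp_cone_unit_vec[OF that]] by simp
      then show "\<not> exp_cone N (\<lambda>i. m i - 2 * unit_vec j i)"
        using False exp_cone_shift[of N m "\<lambda>i. 2 * unit_vec j i"] by auto
    qed
    moreover have "pair_sum N lam x j k m = 0" if "(j, k) \<in> index_pairs N" for j k
      using False that by (rule pair_sum_eq_0)
    ultimately show ?thesis by (auto intro!: sum.neutral)
  qed
qed


subsection \<open>The series of Hermite type\<close>

text \<open>The coefficient of y^(a-2s-2) in the differential equation of p_a: lowering the exponent
  by two is traded for the eigenvalue difference 4 (s + 1).\<close>

lemma p_coeff_Suc:
  fixes a :: real
  shows "(a - 2 * real s) * (a - 2 * real s - 1) * p_coeff s a = - 4 * real (Suc s) * p_coeff (Suc s) a"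
proof -
  define b where "b = a - 2 * real s - 1"
  define Q where "Q = (-1) ^ s * pochhammer (b + 2) (2 * s) / (4 ^ s * fact s)"
  have args: "a - 2 * real (Suc s) + 1 = b" "a - 2 * real s + 1 = b + 2" "a - 2 * real s = b + 1"
    "a - 2 * real s - 1 = b"
    by (simp_all add: b_def)
  have "pochhammer b (2 * Suc s) = b * ((b + 1) * pochhammer (b + 2) (2 * s))"
    by (simp add: pochhammer_rec add.commute add.left_commute)
  then have "p_coeff (Suc s) a = - (b * (b + 1) * Q) / (4 * real (Suc s))"
    unfolding p_coeff_def args(1) Q_def by (simp add: mult_ac)
  then have "4 * real (Suc s) * p_coeff (Suc s) a = - (b * (b + 1) * Q)"
    by (simp only: times_divide_eq_right) (rule nonzero_mult_div_cancel_left, simp)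
  moreover have "p_coeff s a = Q"
    unfolding p_coeff_def args(2) Q_def ..
  ultimately show ?thesis unfolding args by (simp add: algebra_simps)
qed

section \<open>Inversion of the triangular system for b\<close>

definition chain_term :: "int \<Rightarrow> real \<Rightarrow> nat \<Rightarrow> nat list \<Rightarrow> real" where
  "chain_term n a s \<sigma> = pochhammer (a - 2 * of_nat (last \<sigma>) + 1) (2 * last \<sigma>)
     * pochhammer (a + of_int n - 2 * of_nat s + 1) (2 * (s - last \<sigma>))
     / (4 ^ s * fact (last \<sigma>) * (\<Prod>i<length \<sigma>. fact ((s # \<sigma>) ! i - (s # \<sigma>) ! Suc i)))"

text \<open>The part of \<open>b_coeff\<close> coming from chains of length j. The leading term
  plays the role of the empty chain and is listed separately because \<open>last []\<close> has no
  specified value.\<close>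

definition chain_sum :: "int \<Rightarrow> real \<Rightarrow> nat \<Rightarrow> nat \<Rightarrow> real" where
  "chain_sum n a s j = (if j = 0 then p_coeff s a
     else (-1) ^ (j + s) * (\<Sum>\<sigma>\<in>chains s j. chain_term n a s \<sigma>))"

lemma chains_Suc: "chains s (Suc j) = (\<lambda>(r, \<tau>). r # \<tau>) ` (SIGMA r:{..<s}. chains r j)"
proof (intro set_eqI iffI)
  fix \<sigma> assume "\<sigma> \<in> chains s (Suc j)"
  then obtain r \<tau> where "\<sigma> = r # \<tau>" "r < s" "\<tau> \<in> chains r j"
    by (cases \<sigma>) (auto simp: chains_def)
  then show "\<sigma> \<in> (\<lambda>(r, \<tau>). r # \<tau>) ` (SIGMA r:{..<s}. chains r j)" by auto
next
  fix \<sigma> assume "\<sigma> \<in> (\<lambda>(r, \<tau>). r # \<tau>) ` (SIGMA r:{..<s}. chains r j)"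
  then show "\<sigma> \<in> chains s (Suc j)" by (auto simp: chains_def dest: less_trans)
qed

lemma finite_chains: "finite (chains s j)"
  by (rule finite_subset[OF _ finite_lists_length_eq[of "{..<s}" j]]) (auto simp: chains_def)

lemma chains_eq_empty: "s < j \<Longrightarrow> chains s j = {}"
proof (induction j arbitrary: s)
  case (Suc j)
  then show ?case unfolding chains_Suc by auto
qed simp

lemma p_coeff_mult:
  fixes a c :: real
  assumes "r \<le> s"
  shows "p_coeff (s - r) (a - 2 * real r) = (-1) ^ (s - r) * pochhammer (a - 2 * real s + 1) (2 * (s - r))
    / (4 ^ (s - r) * fact (s - r))"
  using assms by (simp add: p_coeff_def of_nat_diff algebra_simps)

text \<open>Putting r in front leaves the last entry l unchanged. The second Pochhammer symbol, of
  length 2 (s - l), factors at r: the piece of length 2 (s - r) is a coefficient of p, the piece of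
  length 2 (r - l) belongs to the shorter chain.\<close>

lemma chain_term_Cons:
  assumes r: "r < s" and \<tau>: "\<tau> \<in> chains r (Suc j)"
  shows "chain_term n a s (r # \<tau>) = (-1) ^ (s - r) * (chain_term n a r \<tau> * p_coeff (s - r) (a + of_int n - 2 * real r))"
proof -
  have ne: "\<tau> \<noteq> []" and len: "length \<tau> = Suc j" using \<tau> by (auto simp: chains_def)
  define l where "l = last \<tau>"
  have l: "l < r" using \<tau> last_in_set[OF ne] unfolding l_def chains_def by blast
  define A where "A = a + of_int n"
  have "pochhammer (A - 2 * real s + 1) (2 * (s - r) + 2 * (r - l))
    = pochhammer (A - 2 * real s + 1) (2 * (s - r)) * pochhammer (A - 2 * real s + 1 + real (2 * (s - r))) (2 * (r - l))"
    by (rule pochhammer_product')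
  moreover have "2 * (s - r) + 2 * (r - l) = 2 * (s - l)" using l r by simp
  moreover have "A - 2 * real s + 1 + real (2 * (s - r)) = A - 2 * real r + 1"
    using r by (simp add: of_nat_diff)
  ultimately have poch: "pochhammer (A - 2 * real s + 1) (2 * (s - l))
    = pochhammer (A - 2 * real s + 1) (2 * (s - r)) * pochhammer (A - 2 * real r + 1) (2 * (r - l))"
    by (simp only:)
  have prod: "(\<Prod>i<length (r # \<tau>). fact ((s # r # \<tau>) ! i - (s # r # \<tau>) ! Suc i) :: real)
    = fact (s - r) * (\<Prod>i<length \<tau>. fact ((r # \<tau>) ! i - (r # \<tau>) ! Suc i))"
    unfolding list.size(4) add.commute[of _ "Suc 0"] plus_1_eq_Suc
    by (simp add: prod.lessThan_Suc_shift del: prod.lessThan_Suc)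
  have p4: "(4::real) ^ s = 4 ^ (s - r) * 4 ^ r" using r by (simp flip: power_add)
  show ?thesis
    unfolding chain_term_def last_ConsR[OF ne] l_def [symmetric] A_def [symmetric] poch prod p4
      p_coeff_mult[OF less_imp_le[OF r], of A]
    by (simp add: field_simps flip: power_mult_distrib)
qed

lemma chain_term_single:
  assumes r: "r < s"
  shows "chain_term n a s [r] = (-1) ^ s * (p_coeff r a * p_coeff (s - r) (a + of_int n - 2 * real r))"
proof -
  have p4: "(4::real) ^ s = 4 ^ (s - r) * 4 ^ r" using r by (simp flip: power_add)
  have sg: "(-1::real) ^ s = (-1) ^ r * (-1) ^ (s - r)" using r by (simp flip: power_add)
  show ?thesis
    unfolding chain_term_def p4 sg p_coeff_mult[OF less_imp_le[OF r]]
    by (simp add: p_coeff_def field_simps flip: power_mult_distrib)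
qed

text \<open>One iteration of the unitriangular system b_s = c_s(a) - sum_(r<s) b_r c_(s-r)(a+n-2r),
  with r the largest entry of the chain. The explicit formula for b is the finite Neumann series of
  this system.\<close>

lemma chain_sum_Suc:
  "chain_sum n a s (Suc j) = - (\<Sum>r<s. chain_sum n a r j * p_coeff (s - r) (a + of_int n - 2 * real r))"
proof -
  have "(\<Sum>\<sigma>\<in>chains s (Suc j). chain_term n a s \<sigma>)
      = (\<Sum>(r, \<tau>)\<in>(SIGMA r:{..<s}. chains r j). chain_term n a s (r # \<tau>))"
    unfolding chains_Suc by (subst sum.reindex) (auto simp: inj_on_def case_prod_beta)
  also have "\<dots> = (\<Sum>r<s. \<Sum>\<tau>\<in>chains r j. chain_term n a s (r # \<tau>))"
    by (subst sum.Sigma) (auto simp: finite_chains)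
  also have "\<dots> = (\<Sum>r<s. (-1) ^ (j + s) * (chain_sum n a r j * p_coeff (s - r) (a + of_int n - 2 * real r)))"
  proof (intro sum.cong refl)
    fix r assume "r \<in> {..<s}"
    then have r: "r < s" by simp
    show "(\<Sum>\<tau>\<in>chains r j. chain_term n a s (r # \<tau>))
      = (-1) ^ (j + s) * (chain_sum n a r j * p_coeff (s - r) (a + of_int n - 2 * real r))"
    proof (cases j)
      case 0
      moreover have "chains r 0 = {[]}" by (auto simp: chains_def)
      ultimately show ?thesis using chain_term_single[OF r] by (simp add: chain_sum_def)
    next
      case (Suc j')
      have "(\<Sum>\<tau>\<in>chains r j. chain_term n a s (r # \<tau>))
        = (-1) ^ (s - r) * ((\<Sum>\<tau>\<in>chains r j. chain_term n a r \<tau>) * p_coeff (s - r) (a + of_int n - 2 * real r))"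
        unfolding sum_distrib_left sum_distrib_right
        by (intro sum.cong refl) (use chain_term_Cons[OF r] Suc in simp)
      moreover have "(-1::real) ^ (j + s) * (-1) ^ (j + r) = (-1) ^ (s - r)"
      proof -
        have e: "(j + s) + (j + r) = 2 * (j + r) + (s - r)" using r by simp
        show ?thesis unfolding power_add [symmetric] e by (simp add: power_add power_mult)
      qed
      ultimately show ?thesis using Suc by (simp add: chain_sum_def mult.assoc [symmetric])
    qed
  qed
  also have "\<dots> = (-1) ^ (j + s) * (\<Sum>r<s. chain_sum n a r j * p_coeff (s - r) (a + of_int n - 2 * real r))"
    by (simp only: sum_distrib_left)
  finally have "chain_sum n a s (Suc j) = (-1) ^ (Suc j + s) * ((-1) ^ (j + s)
      * (\<Sum>r<s. chain_sum n a r j * p_coeff (s - r) (a + of_int n - 2 * real r)))"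
    by (simp add: chain_sum_def)
  then show ?thesis
    unfolding mult.assoc [symmetric] power_add [symmetric] by (simp add: power_add mult_ac flip: power_mult_distrib)
qed

lemma b_coeff_eq_chain_sum:
  assumes "s \<le> M"
  shows "b_coeff s n a = (\<Sum>j=0..M. chain_sum n a s j)"
proof -
  have "b_coeff s n a = chain_sum n a s 0 + (\<Sum>j=1..s. chain_sum n a s j)"
    unfolding b_coeff_def
    by (intro arg_cong2[of _ _ _ _ "(+)"] sum.cong)
       (auto simp: chain_sum_def p_coeff_def chain_term_def chains_def intro!: sum.cong)
  also have "\<dots> = (\<Sum>j=0..s. chain_sum n a s j)"
    by (simp add: sum.atLeast_Suc_atMost)
  also have "\<dots> = (\<Sum>j=0..M. chain_sum n a s j)"
    using assms by (intro sum.mono_neutral_left) (auto simp: chain_sum_def chains_eq_empty)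
  finally show ?thesis .
qed

text \<open>The coefficient of x^(a+n-2s) in the expansion of x^n p_a, obtained by summing the chain
  recursion over all chain lengths.\<close>

lemma sum_b_coeff_p_coeff:
  fixes a :: real
  shows "(\<Sum>r\<le>s. b_coeff r n a * p_coeff (s - r) (a + of_int n - 2 * real r)) = p_coeff s a"
proof -
  \<comment> \<open>The upper limit exceeds s by one, so that splitting off j = 0 leaves a range
    0..s that is complete for every r < s.\<close>
  have "b_coeff s n a = (\<Sum>j=0..Suc s. chain_sum n a s j)"
    by (rule b_coeff_eq_chain_sum) simp
  also have "\<dots> = p_coeff s a + (\<Sum>j=0..s. chain_sum n a s (Suc j))"
    by (subst sum.atLeast0_atMost_Suc_shift) (simp add: chain_sum_def)
  also have "(\<Sum>j=0..s. chain_sum n a s (Suc j))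
    = - (\<Sum>r<s. (\<Sum>j=0..s. chain_sum n a r j) * p_coeff (s - r) (a + of_int n - 2 * real r))"
    unfolding chain_sum_Suc sum_negf sum_distrib_right by (subst sum.swap) simp
  also have "\<dots> = - (\<Sum>r<s. b_coeff r n a * p_coeff (s - r) (a + of_int n - 2 * real r))"
    by (intro arg_cong[of _ _ uminus] sum.cong) (auto simp: b_coeff_eq_chain_sum[of _ s])
  finally have "b_coeff s n a + (\<Sum>r<s. b_coeff r n a * p_coeff (s - r) (a + of_int n - 2 * real r)) = p_coeff s a"
    by simp
  moreover have "p_coeff 0 (a + of_int n - 2 * real s) = 1" by (simp add: p_coeff_def)
  ultimately show ?thesis by (simp add: lessThan_Suc_atMost [symmetric])
qed

section \<open>Truncation of the sums and the Euler operator\<close>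

definition tail_bounded :: "nat \<Rightarrow> (nat \<Rightarrow> int) \<Rightarrow> nat \<Rightarrow> bool" where
  "tail_bounded N n M \<longleftrightarrow> (\<forall>k\<in>{1..N}. tail N n k \<le> int M)"

definition f_weight :: "nat \<Rightarrow> real \<Rightarrow> (nat \<Rightarrow> int) \<Rightarrow> (nat \<Rightarrow> nat) \<Rightarrow> real" where
  "f_weight N lam n s = (\<Prod>j=1..N. p_coeff (s j) (shifted N lam n j - 1))"

lemma tail_bounded_le:
  assumes M: "tail_bounded N n M" and c: "exp_cone N (\<lambda>j. n j - 2 * int (s j))" and k: "k \<in> {1..N}"
  shows "s k \<le> M"
proof -
  have "0 \<le> tail N (\<lambda>j. n j - 2 * int (s j)) k" using c k by (auto simp: exp_cone_def)
  also have "\<dots> = tail N n k - 2 * tail N (\<lambda>j. int (s j)) k"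
    unfolding tail_diff by (simp add: tail_def sum_distrib_left)
  finally have "2 * tail N (\<lambda>j. int (s j)) k \<le> int M"
    using M k unfolding tail_bounded_def by force
  moreover have "int (s k) \<le> tail N (\<lambda>j. int (s j)) k"
    unfolding tail_def using k by (intro member_le_sum) auto
  ultimately show ?thesis by linarith
qed

lemma y_exponent_iff:
  assumes "j \<in> {1..N}"
  shows "y_exponent N lam n s p q j = -1 \<longleftrightarrow> y_degree N p q j = n j - 2 * int (s j)"
proof -
  have "y_exponent N lam n s p q j = -1 \<longleftrightarrow> real_of_int (y_degree N p q j) = real_of_int (n j - 2 * int (s j))"
    by (auto simp: y_exponent_def y_degree_def shifted_def algebra_simps)
  then show ?thesis by (simp only: of_int_eq_iff)
qed

text \<open>For given s the admissible (p, q) are those of the kernel coefficient at n - 2 s, and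
  the cone condition bounds s by M. Every valid M gives the same value; hence f at n and at n - E
  can be expanded over the same box.\<close>

lemma f_H_eq_sum:
  assumes M: "tail_bounded N n M"
  shows "f_H N lam n x = (\<Sum>s\<in>{1..N} \<rightarrow>\<^sub>E {..M}. f_weight N lam n s
    * kernel_coeff N lam x (\<lambda>j. n j - 2 * int (s j)))"
proof -
  define K where "K = (\<lambda>s. {(p, q). (p, q) \<in> kernel_indices N \<and> (\<forall>j\<in>{1..N}. y_degree N p q j = n j - 2 * int (s j))})"
  define D where "D = {(s, p, q).
          s \<in> {1..N} \<rightarrow>\<^sub>E UNIV \<and> p \<in> index_pairs N \<rightarrow>\<^sub>E UNIV \<and> q \<in> {1..N} \<times> {1..N} \<rightarrow>\<^sub>E UNIV \<and>
          (\<forall>j\<in>{1..N}. y_exponent N lam n s p q j = -1)}"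
  have D: "D = (SIGMA s:{1..N} \<rightarrow>\<^sub>E {..M}. K s)"
  proof (intro set_eqI iffI)
    fix y assume "y \<in> D"
    then obtain s p q where y: "y = (s, p, q)" "s \<in> {1..N} \<rightarrow>\<^sub>E UNIV" "(p, q) \<in> K s"
      by (auto simp: D_def K_def kernel_indices_def y_exponent_iff)
    have "exp_cone N (y_degree N p q) = exp_cone N (\<lambda>j. n j - 2 * int (s j))"
      by (rule exp_cone_cong) (use y in \<open>auto simp: K_def\<close>)
    then have "exp_cone N (\<lambda>j. n j - 2 * int (s j))" using exp_cone_y_degree by simp
    then have "s k \<le> M" if "k \<in> {1..N}" for k
      using tail_bounded_le[OF M _ that] by simp
    then have "s \<in> {1..N} \<rightarrow>\<^sub>E {..M}" using y(2) by (auto simp: PiE_def extensional_def)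
    with y show "y \<in> (SIGMA s:{1..N} \<rightarrow>\<^sub>E {..M}. K s)" by simp
  next
    fix y assume "y \<in> (SIGMA s:{1..N} \<rightarrow>\<^sub>E {..M}. K s)"
    then show "y \<in> D" by (auto simp: D_def K_def kernel_indices_def y_exponent_iff)
  qed
  have finK: "finite (K s)" for s unfolding K_def by (rule finite_kernel_coeff_indices)
  have finS: "finite ({1..N} \<rightarrow>\<^sub>E {..M})" by (intro finite_PiE) auto
  have finD: "finite D" unfolding D using finK finS by (intro finite_SigmaI)
  have "f_H N lam n x = (\<Sum>(s, p, q)\<in>D. f_weight N lam n s * kernel_term N lam x p q)"
    unfolding f_H_def D_def [symmetric] infsum_finite[OF finD]
    by (intro sum.cong) (auto simp: f_weight_def kernel_term_def)
  also have "\<dots> = (\<Sum>s\<in>{1..N} \<rightarrow>\<^sub>E {..M}. \<Sum>(p, q)\<in>K s. f_weight N lam n s * kernel_term N lam x p q)"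
    unfolding D by (subst sum.Sigma) (use finK finS in auto)
  finally show ?thesis
    unfolding kernel_coeff_def K_def by (simp add: sum_distrib_left case_prod_beta)
qed

text \<open>Formulated for s d/ds instead of a logarithmic derivative, since the point s and the
  factors may be zero.\<close>

lemma DERIV_prod_log:
  fixes F :: "'i \<Rightarrow> real \<Rightarrow> real"
  assumes "finite I" "\<And>p. p \<in> I \<Longrightarrow> (F p has_real_derivative D p) (at s)"
    and "\<And>p. p \<in> I \<Longrightarrow> s * D p = L p * F p s"
  shows "\<exists>D'. ((\<lambda>t. \<Prod>p\<in>I. F p t) has_real_derivative D') (at s) \<and> s * D' = (\<Sum>p\<in>I. L p) * (\<Prod>p\<in>I. F p s)"
  using assms
proof (induction I rule: finite_induct)
  case empty
  show ?case by (intro exI[of _ 0]) auto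
next
  case (insert p I)
  then obtain D' where D': "((\<lambda>t. \<Prod>p\<in>I. F p t) has_real_derivative D') (at s)"
    "s * D' = (\<Sum>p\<in>I. L p) * (\<Prod>p\<in>I. F p s)" by auto
  have "((\<lambda>t. F p t * (\<Prod>p\<in>I. F p t)) has_real_derivative (D p * (\<Prod>p\<in>I. F p s) + D' * F p s)) (at s)"
    using insert.prems(1)[of p] D'(1) by (intro DERIV_mult) auto
  moreover have "s * (D p * (\<Prod>p\<in>I. F p s) + D' * F p s)
      = (s * D p) * (\<Prod>p\<in>I. F p s) + (s * D') * F p s" by (simp add: algebra_simps)
  moreover have "\<dots> = (\<Sum>p\<in>insert p I. L p) * (\<Prod>p\<in>insert p I. F p s)"
    unfolding D'(2) using insert(1,2) insert.prems(2)[of p] by (simp add: algebra_simps)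
  ultimately show ?case using insert(1,2)
    by (intro exI[of _ "D p * (\<Prod>p\<in>I. F p s) + D' * F p s"]) auto
qed

lemma coordinatewise_poly_kernel_term: "coordinatewise_poly (\<lambda>x. kernel_term N lam x p q)"
  unfolding kernel_term_def case_prod_beta
  by (intro coordinatewise_poly_mult coordinatewise_poly_prod
      coordinatewise_poly_const coordinatewise_poly_power coordinatewise_poly_uminus
      coordinatewise_poly_coord)

lemma kernel_term_euler_coord:
  assumes i: "i \<in> {1..N}"
  shows "x i * partial1 i (\<lambda>x. kernel_term N lam x p q) x
    = real (\<Sum>k=1..N. q (i, k)) * kernel_term N lam x p q"
proof -
  define I where "I = {1..N} \<times> {1..N}"
  define Fn where "Fn = (\<lambda>jk t. ((- lam) gchoose q jk) * (- (x(i := t)) (fst jk)) ^ q jk)"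
  define L where "L = (\<lambda>jk. if fst jk = i then real (q jk) else 0)"
  define C where "C = (\<Prod>jk\<in>index_pairs N. (lam gchoose p jk) * (-1) ^ p jk)"
  have "\<exists>D'. ((\<lambda>t. \<Prod>jk\<in>I. Fn jk t) has_real_derivative D') (at (x i))
      \<and> x i * D' = (\<Sum>jk\<in>I. L jk) * (\<Prod>jk\<in>I. Fn jk (x i))"
  proof (rule DERIV_prod_log[where D = "\<lambda>jk. if fst jk = i
      then - (((- lam) gchoose q jk) * (real (q jk) * (- x i) ^ (q jk - 1))) else 0"])
    fix jk assume "jk \<in> I"
    show "(Fn jk has_real_derivative (if fst jk = i
      then - (((- lam) gchoose q jk) * (real (q jk) * (- x i) ^ (q jk - 1))) else 0)) (at (x i))"
      unfolding Fn_def by (auto intro!: derivative_eq_intros)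
    show "x i * (if fst jk = i then - (((- lam) gchoose q jk) * (real (q jk) * (- x i) ^ (q jk - 1))) else 0)
       = L jk * Fn jk (x i)"
      by (cases "q jk") (auto simp: L_def Fn_def)
  qed (simp add: I_def)
  then obtain D' where D': "((\<lambda>t. \<Prod>jk\<in>I. Fn jk t) has_real_derivative D') (at (x i))"
    "x i * D' = (\<Sum>jk\<in>I. L jk) * (\<Prod>jk\<in>I. Fn jk (x i))" by blast
  have trm: "kernel_term N lam (x(i := t)) p q = C * (\<Prod>jk\<in>I. Fn jk t)" for t
    unfolding kernel_term_def C_def I_def Fn_def case_prod_beta by simp
  have "((\<lambda>t. kernel_term N lam (x(i := t)) p q) has_real_derivative C * D') (at (x i))"
    unfolding trm by (rule DERIV_cmult[OF D'(1)])
  then have "partial1 i (\<lambda>x. kernel_term N lam x p q) x = C * D'"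
    unfolding partial1_def by (rule DERIV_imp_deriv)
  then have "x i * partial1 i (\<lambda>x. kernel_term N lam x p q) x = (\<Sum>jk\<in>I. L jk) * (C * (\<Prod>jk\<in>I. Fn jk (x i)))"
    using D'(2) by (simp add: algebra_simps)
  also have "C * (\<Prod>jk\<in>I. Fn jk (x i)) = kernel_term N lam x p q"
    using trm[of "x i"] by simp
  also have "(\<Sum>jk\<in>I. L jk) = (\<Sum>j=1..N. \<Sum>k=1..N. L (j, k))"
    by (simp add: I_def sum.cartesian_product)
  also have "\<dots> = (\<Sum>j=1..N. if j = i then (\<Sum>k=1..N. real (q (i, k))) else 0)"
    by (intro sum.cong) (auto simp: L_def)
  also have "\<dots> = real (\<Sum>k=1..N. q (i, k))" using i by simp
  finally show ?thesis .
qed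

text \<open>The ratios y_j/y_k have total degree zero, so the degree of a term in x equals the sum
  of its degrees in 1/y_j: each kernel coefficient is homogeneous in x.\<close>

lemma kernel_coeff_euler:
  "(\<Sum>i=1..N. x i * partial1 i (\<lambda>x. kernel_coeff N lam x m) x)
    = real_of_int (\<Sum>j=1..N. m j) * kernel_coeff N lam x m"
proof -
  define K where "K = {(p, q). (p, q) \<in> kernel_indices N \<and> (\<forall>j\<in>{1..N}. y_degree N p q j = m j)}"
  have coeff: "kernel_coeff N lam x m = (\<Sum>pq\<in>K. 1 * kernel_term N lam x (fst pq) (snd pq))" for x
    unfolding kernel_coeff_def K_def by (simp add: case_prod_beta)
  have "(\<Sum>i=1..N. x i * partial1 i (\<lambda>x. kernel_coeff N lam x m) x)
    = (\<Sum>i=1..N. \<Sum>pq\<in>K. x i * partial1 i (\<lambda>x. kernel_term N lam x (fst pq) (snd pq)) x)"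
    unfolding coeff
    by (subst partial1_lincomb) (auto simp: coordinatewise_poly_kernel_term sum_distrib_left)
  also have "\<dots> = (\<Sum>pq\<in>K. \<Sum>i=1..N. real (\<Sum>k=1..N. snd pq (i, k)) * kernel_term N lam x (fst pq) (snd pq))"
    by (subst sum.swap) (intro sum.cong refl, simp add: kernel_term_euler_coord)
  also have "\<dots> = (\<Sum>pq\<in>K. real_of_int (\<Sum>j=1..N. m j) * kernel_term N lam x (fst pq) (snd pq))"
  proof (intro sum.cong refl)
    fix pq assume "pq \<in> K"
    then have "(\<Sum>j=1..N. m j) = (\<Sum>j=1..N. of_int (y_degree N (fst pq) (snd pq) j) * 1)"
      by (intro sum.cong) (auto simp: K_def)
    also have "\<dots> = (\<Sum>i=1..N. \<Sum>k=1..N. int (snd pq (i, k)))"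
      unfolding y_degree_linear by (simp add: sum.cartesian_product case_prod_beta)
    finally show "(\<Sum>i=1..N. real (\<Sum>k=1..N. snd pq (i, k)) * kernel_term N lam x (fst pq) (snd pq))
      = real_of_int (\<Sum>j=1..N. m j) * kernel_term N lam x (fst pq) (snd pq)"
      by (simp add: sum_distrib_right)
  qed
  finally show ?thesis unfolding coeff by (simp add: sum_distrib_left)
qed


subsection \<open>Action of the reduced operator\<close>

text \<open>The Hamiltonian conjugated by the ground state, with the ground state energy removed;
  the two drift contributions of a pair are combined into a difference quotient.\<close>

definition reduced_H :: "nat \<Rightarrow> real \<Rightarrow> ((nat \<Rightarrow> real) \<Rightarrow> real) \<Rightarrow> (nat \<Rightarrow> real) \<Rightarrow> real" where
  "reduced_H N lam F x = 2 * (\<Sum>i=1..N. x i * partial1 i F x) - (\<Sum>i=1..N. partial2 i F x)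
     - 2 * lam * (\<Sum>(i, k)\<in>index_pairs N. (partial1 i F x - partial1 k F x) / (x i - x k))"

lemma reduced_H_lincomb:
  assumes "\<And>k. k \<in> I \<Longrightarrow> coordinatewise_poly (F k)"
  shows "reduced_H N lam (\<lambda>x. \<Sum>k\<in>I. c k * F k x) x = (\<Sum>k\<in>I. c k * reduced_H N lam (F k) x)"
proof -
  have 1: "(\<Sum>i=1..N. x i * (\<Sum>k\<in>I. c k * partial1 i (F k) x))
    = (\<Sum>k\<in>I. c k * (\<Sum>i=1..N. x i * partial1 i (F k) x))"
    unfolding sum_distrib_left by (subst sum.swap) (simp add: mult_ac)
  have 2: "(\<Sum>i=1..N. \<Sum>k\<in>I. c k * partial2 i (F k) x) = (\<Sum>k\<in>I. c k * (\<Sum>i=1..N. partial2 i (F k) x))"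
    unfolding sum_distrib_left by (rule sum.swap)
  have 3: "(\<Sum>p\<in>index_pairs N. ((\<Sum>k\<in>I. c k * partial1 (fst p) (F k) x) - (\<Sum>k\<in>I. c k * partial1 (snd p) (F k) x)) / (x (fst p) - x (snd p)))
    = (\<Sum>k\<in>I. c k * (\<Sum>p\<in>index_pairs N. (partial1 (fst p) (F k) x - partial1 (snd p) (F k) x) / (x (fst p) - x (snd p))))"
    unfolding sum_distrib_left sum_subtractf [symmetric] sum_divide_distrib
    by (subst sum.swap) (simp add: right_diff_distrib)
  have p1: "partial1 i (\<lambda>x. \<Sum>k\<in>I. c k * F k x) x = (\<Sum>k\<in>I. c k * partial1 i (F k) x)" for i
    by (rule partial1_lincomb) (rule assms)
  have p2: "partial2 i (\<lambda>x. \<Sum>k\<in>I. c k * F k x) x = (\<Sum>k\<in>I. c k * partial2 i (F k) x)" for i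
    by (rule partial2_lincomb) (rule assms)
  show ?thesis
    unfolding reduced_H_def case_prod_beta p1 p2 1 2 3
    by (simp add: right_diff_distrib sum_subtractf sum_distrib_left mult_ac)
qed

lemma tail_bounded_exists: "\<exists>M. tail_bounded N n M"
proof
  show "tail_bounded N n (nat (\<Sum>k=1..N. \<bar>tail N n k\<bar>))"
    unfolding tail_bounded_def
  proof
    fix k assume k: "k \<in> {1..N}"
    have "tail N n k \<le> \<bar>tail N n k\<bar>" by simp
    also have "\<dots> \<le> (\<Sum>k=1..N. \<bar>tail N n k\<bar>)" using k by (intro member_le_sum) auto
    finally show "tail N n k \<le> int (nat (\<Sum>k=1..N. \<bar>tail N n k\<bar>))" by simp
  qed
qed

lemma tail_bounded_diff: "tail_bounded N n M \<Longrightarrow> exp_cone N v \<Longrightarrow> tail_bounded N (\<lambda>i. n i - v i) M"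
  unfolding tail_bounded_def exp_cone_def tail_diff by force

lemma coordinatewise_poly_f_H: "coordinatewise_poly (f_H N lam n)"
proof -
  obtain M where "tail_bounded N n M" using tail_bounded_exists by blast
  then have "f_H N lam n = (\<lambda>x. \<Sum>s\<in>{1..N} \<rightarrow>\<^sub>E {..M}. f_weight N lam n s
    * kernel_coeff N lam x (\<lambda>j. n j - 2 * int (s j)))"
    by (intro ext f_H_eq_sum)
  then show ?thesis
    by (auto intro!: coordinatewise_poly_sum coordinatewise_poly_mult coordinatewise_poly_const
        coordinatewise_poly_kernel_coeff)
qed

lemma exp_cone_nonneg: "(\<And>i. i \<in> {1..N} \<Longrightarrow> v i \<ge> 0) \<Longrightarrow> exp_cone N v"
  unfolding exp_cone_def tail_def by (auto intro!: sum_nonneg)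

lemma f_H_eq_0:
  assumes "\<not> exp_cone N n"
  shows "f_H N lam n x = 0"
proof -
  obtain M where M: "tail_bounded N n M" using tail_bounded_exists by blast
  have "\<not> exp_cone N (\<lambda>j. n j - 2 * int (s j))" for s :: "nat \<Rightarrow> nat"
    using assms exp_cone_shift[of N n "\<lambda>j. 2 * int (s j)"] exp_cone_nonneg[of N "\<lambda>j. 2 * int (s j)"] by auto
  then show ?thesis unfolding f_H_eq_sum[OF M] by (simp add: kernel_coeff_eq_0)
qed

lemma local_on_f_H: "local_on N (\<lambda>n. f_H N lam n x)"
  unfolding local_on_def
proof (intro allI impI)
  fix n n' :: "nat \<Rightarrow> int" assume a: "\<forall>j\<in>{1..N}. n j = n' j"
  obtain M where M: "tail_bounded N n M" using tail_bounded_exists by blast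
  have "tail N n k = tail N n' k" if "k \<in> {1..N}" for k using a that by (intro tail_cong) auto
  with M have M': "tail_bounded N n' M" by (simp add: tail_bounded_def)
  have "f_weight N lam n s = f_weight N lam n' s" for s
    unfolding f_weight_def using a by (intro prod.cong refl) (simp add: shifted_def)
  moreover have "kernel_coeff N lam x (\<lambda>j. n j - 2 * int (s j)) = kernel_coeff N lam x (\<lambda>j. n' j - 2 * int (s j))" for s
    by (rule local_onD[OF local_on_kernel_coeff]) (use a in auto)
  ultimately show "f_H N lam n x = f_H N lam n' x"
    unfolding f_H_eq_sum[OF M] f_H_eq_sum[OF M'] by simp
qed

lemma E_vec_unit_vec:
  "E_vec (j, k, t, u, v) i = (1 + 2 * int t - int v) * unit_vec j i + (1 + 2 * int u + int v) * unit_vec k i"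
  by (simp add: E_vec_def unit_vec_def)

lemma tail_mult: "tail N (\<lambda>i. c * v i) k = c * tail N v k"
  by (simp add: tail_def sum_distrib_left)

lemma tail_E_vec:
  assumes "(j, k) \<in> index_pairs N"
  shows "tail N (E_vec (j, k, t, u, v)) i
    = (1 + 2 * int t - int v) * of_bool (i \<le> j) + (1 + 2 * int u + int v) * of_bool (i \<le> k)"
  using assms unfolding E_vec_unit_vec[abs_def] tail_add tail_mult
  by (simp add: tail_unit_vec index_pairs_def)

text \<open>The component at j is negative for large v, so a componentwise order would fail. The
  tails are 2 + 2 t + 2 u up to j, then 1 + 2 u + v up to k, and 0 beyond.\<close>

lemma exp_cone_E_vec:
  assumes "e \<in> steps N"
  shows "exp_cone N (E_vec e)"
proof -
  obtain j k t u v where e: "e = (j, k, t, u, v)" "(j, k) \<in> index_pairs N"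
    using assms by (auto simp: steps_def)
  then have "j < k" by (auto simp: index_pairs_def)
  then show ?thesis unfolding exp_cone_def e(1) tail_E_vec[OF e(2)] by auto
qed

lemma exp_cone_pair:
  assumes "(j, k) \<in> index_pairs N" "\<nu> \<ge> 1"
  shows "exp_cone N (\<lambda>i. (int \<nu> + 1) * unit_vec k i - (int \<nu> - 1) * unit_vec j i)"
  using assms unfolding exp_cone_def tail_diff tail_mult
  by (auto simp: tail_unit_vec index_pairs_def)

text \<open>The powers y_j^(\<nu>-1) and y_k^(-1-\<nu>) from the interaction are absorbed into the
  two p series by re-expansion. The exponents change to n_j + \<nu> - 1 - 2 t and n_k - 1 - \<nu> -
  2 u, which is how the vectors E and the two factors b arise.\<close>

lemma f_H_pair_expansion:
  assumes M: "tail_bounded N n M" and jk: "(j, k) \<in> index_pairs N" and \<nu>: "\<nu> \<ge> 1"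
  shows "(\<Sum>s\<in>{1..N} \<rightarrow>\<^sub>E {..M}. f_weight N lam n s *
      kernel_coeff N lam x (\<lambda>i. n i - 2 * int (s i) + (int \<nu> - 1) * unit_vec j i - (int \<nu> + 1) * unit_vec k i))
    = (\<Sum>t\<le>M. \<Sum>u\<le>M. b_coeff t (int \<nu> - 1) (shifted N lam n j - 1)
        * b_coeff u (- 1 - int \<nu>) (shifted N lam n k - 1)
        * f_H N lam (\<lambda>i. n i - E_vec (j, k, t, u, \<nu>) i) x)"
proof -
  have jk': "j \<in> {1..N}" "k \<in> {1..N}" "j \<noteq> k" "k \<noteq> j" using jk by (auto simp: index_pairs_def)
  define a b where "a = shifted N lam n j - 1" and "b = shifted N lam n k - 1"
  define S where "S = ({1..N} \<rightarrow>\<^sub>E {..M} :: (nat \<Rightarrow> nat) set)"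
  define H where "H = (\<lambda>s. kernel_coeff N lam x
      (\<lambda>i. n i - 2 * int (s i) + (int \<nu> - 1) * unit_vec j i - (int \<nu> + 1) * unit_vec k i))"
  define R where "R = (\<lambda>s. \<Prod>i\<in>{1..N} - {j} - {k}. p_coeff (s i) (shifted N lam n i - 1))"
  define tj where "tj = (\<lambda>t. b_coeff t (int \<nu> - 1) a)"
  define uk where "uk = (\<lambda>u. b_coeff u (- 1 - int \<nu>) b)"
  define cj where "cj = (\<lambda>r t. p_coeff r (a + of_int (int \<nu> - 1) - 2 * real t))"
  define ck where "ck = (\<lambda>r u. p_coeff r (b + of_int (- 1 - int \<nu>) - 2 * real u))"
  define g where "g = (\<lambda>(s, t, u). R s * (tj t * cj (s j - t) t) * (uk u * ck (s k - u) u) * H s)"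
  define h where "h = (\<lambda>(s, t, u). tj t * uk u * (R s * cj (s j) t * ck (s k) u
      * kernel_coeff N lam x (\<lambda>i. n i - E_vec (j, k, t, u, \<nu>) i - 2 * int (s i))))"
  have finS: "finite S" unfolding S_def by (intro finite_PiE) auto
  have split: "(\<Prod>i=1..N. f i) = f j * (f k * (\<Prod>i\<in>{1..N} - {j} - {k}. f i))" for f :: "nat \<Rightarrow> real"
    using jk' by (subst prod.remove[of _ j], simp, simp, subst prod.remove[of _ k]) auto
  have w1: "f_weight N lam n s = R s * (\<Sum>t\<le>s j. tj t * cj (s j - t) t) * (\<Sum>u\<le>s k. uk u * ck (s k - u) u)" for s
    unfolding f_weight_def split R_def tj_def uk_def cj_def ck_def sum_b_coeff_p_coeff
    by (simp add: a_def b_def)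
  have w2: "f_weight N lam (\<lambda>i. n i - E_vec (j, k, t, u, \<nu>) i) s = R s * cj (s j) t * ck (s k) u" for s t u
  proof -
    have "shifted N lam (\<lambda>i. n i - E_vec (j, k, t, u, \<nu>) i) i = shifted N lam n i" if "i \<noteq> j" "i \<noteq> k" for i
      using that by (simp add: shifted_def E_vec_unit_vec unit_vec_def)
    then have "(\<Prod>i\<in>{1..N} - {j} - {k}. p_coeff (s i) (shifted N lam (\<lambda>i. n i - E_vec (j, k, t, u, \<nu>) i) i - 1)) = R s"
      unfolding R_def by (intro prod.cong) auto
    moreover have "shifted N lam (\<lambda>i. n i - E_vec (j, k, t, u, \<nu>) i) j - 1 = a + of_int (int \<nu> - 1) - 2 * real t"
      "shifted N lam (\<lambda>i. n i - E_vec (j, k, t, u, \<nu>) i) k - 1 = b + of_int (- 1 - int \<nu>) - 2 * real u"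
      using jk' by (simp_all add: shifted_def E_vec_unit_vec unit_vec_def a_def b_def)
    ultimately show ?thesis
      unfolding f_weight_def split cj_def ck_def by (simp only: mult_ac)
  qed
  have "(\<Sum>s\<in>S. f_weight N lam n s * H s) = (\<Sum>s\<in>S. \<Sum>(t, u)\<in>{..s j} \<times> {..s k}. g (s, t, u))"
  proof (intro sum.cong refl)
    fix s
    have "f_weight N lam n s * H s = (\<Sum>t\<le>s j. \<Sum>u\<le>s k. R s * (tj t * cj (s j - t) t) * (uk u * ck (s k - u) u) * H s)"
      unfolding w1 by (simp add: sum_distrib_left sum_distrib_right mult_ac)
    then show "f_weight N lam n s * H s = (\<Sum>(t, u)\<in>{..s j} \<times> {..s k}. g (s, t, u))"
      by (simp add: sum.cartesian_product g_def)
  qed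
  also have "\<dots> = (\<Sum>y\<in>(SIGMA s:S. {..s j} \<times> {..s k}). g y)"
    using finS by (subst sum.Sigma) (auto simp: case_prod_beta)
  also have "\<dots> = (\<Sum>y\<in>S \<times> {..M} \<times> {..M}. h y)"
  \<comment> \<open>Replacing s by s - t e_j - u e_k makes t and u independent of s. The target box
    also contains points with s j + t or s k + u above M; there the kernel coefficient has to
    vanish.\<close>
  proof (rule sum.reindex_bij_witness_not_neutral[of "{}" "{y \<in> S \<times> {..M} \<times> {..M}.
        fst y j + fst (snd y) > M \<or> fst y k + snd (snd y) > M}" _
        "\<lambda>(s, t, u). (s(j := s j + t, k := s k + u), t, u)"
        "\<lambda>(s, t, u). (s(j := s j - t, k := s k - u), t, u)"])
    show "finite {y \<in> S \<times> {..M} \<times> {..M}. fst y j + fst (snd y) > M \<or> fst y k + snd (snd y) > M}"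
      using finS by auto
    fix y assume y: "y \<in> (SIGMA s:S. {..s j} \<times> {..s k})"
    obtain s t u where stu: "y = (s, t, u)" "s \<in> S" "t \<le> s j" "u \<le> s k" using y by auto
    define s' where "s' = s(j := s j - t, k := s k - u)"
    have "(\<lambda>i. n i - E_vec (j, k, t, u, \<nu>) i - 2 * int (s' i))
      = (\<lambda>i. n i - 2 * int (s i) + (int \<nu> - 1) * unit_vec j i - (int \<nu> + 1) * unit_vec k i)"
      using stu jk' by (intro ext) (simp add: s'_def E_vec_unit_vec unit_vec_def of_nat_diff)
    moreover have "R s' = R s" unfolding R_def by (intro prod.cong) (auto simp: s'_def)
    moreover have "s' j = s j - t" "s' k = s k - u" using jk' by (auto simp: s'_def)
    ultimately show "h (case y of (s, t, u) \<Rightarrow> (s(j := s j - t, k := s k - u), t, u)) = g y"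
      unfolding stu by (simp add: h_def g_def H_def s'_def [symmetric])
  next
    fix y assume y: "y \<in> (SIGMA s:S. {..s j} \<times> {..s k}) - {}"
    obtain s t u where stu: "y = (s, t, u)" "s \<in> S" "t \<le> s j" "u \<le> s k" using y by auto
    have s: "s j \<le> M" "s k \<le> M" "s \<in> {1..N} \<rightarrow>\<^sub>E {..M}" using stu(2) jk' by (auto simp: S_def)
    show "(case case y of (s, t, u) \<Rightarrow> (s(j := s j - t, k := s k - u), t, u) of
        (s, t, u) \<Rightarrow> (s(j := s j + t, k := s k + u), t, u)) = y"
      unfolding stu using stu jk' by (auto simp: fun_eq_iff)
    have "s(j := s j - t, k := s k - u) \<in> S"
      using s jk' by (auto simp: S_def PiE_def extensional_def Pi_def)
    then show "(case y of (s, t, u) \<Rightarrow> (s(j := s j - t, k := s k - u), t, u))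
      \<in> S \<times> {..M} \<times> {..M} - {y \<in> S \<times> {..M} \<times> {..M}. fst y j + fst (snd y) > M \<or> fst y k + snd (snd y) > M}"
      unfolding stu using stu jk' s by auto
  next
    fix y assume y: "y \<in> S \<times> {..M} \<times> {..M} - {y \<in> S \<times> {..M} \<times> {..M}. fst y j + fst (snd y) > M \<or> fst y k + snd (snd y) > M}"
    obtain s t u where stu: "y = (s, t, u)" "s \<in> S" "s j + t \<le> M" "s k + u \<le> M" using y by auto
    show "(case case y of (s, t, u) \<Rightarrow> (s(j := s j + t, k := s k + u), t, u) of
        (s, t, u) \<Rightarrow> (s(j := s j - t, k := s k - u), t, u)) = y"
      unfolding stu using jk' by (auto simp: fun_eq_iff)
    have "s(j := s j + t, k := s k + u) \<in> S"
      using stu jk' by (auto simp: S_def PiE_def extensional_def Pi_def)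
    then show "(case y of (s, t, u) \<Rightarrow> (s(j := s j + t, k := s k + u), t, u)) \<in> (SIGMA s:S. {..s j} \<times> {..s k}) - {}"
      unfolding stu using jk' by auto
  next
    fix y assume y: "y \<in> {y \<in> S \<times> {..M} \<times> {..M}. fst y j + fst (snd y) > M \<or> fst y k + snd (snd y) > M}"
    obtain s t u where stu: "y = (s, t, u)" "s j + t > M \<or> s k + u > M" using y by (cases y) auto
    define s' where "s' = s(j := s j + t, k := s k + u)"
    define w where "w = (\<lambda>i. (int \<nu> + 1) * unit_vec k i - (int \<nu> - 1) * unit_vec j i)"
    \<comment> \<open>Moving t and u back into s gives an s' exceeding the bound M, so n - 2 s' is
      outside the cone; subtracting the cone vector w cannot bring it back inside.\<close>
    have "\<not> exp_cone N (\<lambda>i. n i - 2 * int (s' i))"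
    proof
      assume c: "exp_cone N (\<lambda>i. n i - 2 * int (s' i))"
      have "s' j \<le> M" "s' k \<le> M" using tail_bounded_le[OF M c] jk' by auto
      with stu jk' show False by (auto simp: s'_def)
    qed
    then have "\<not> exp_cone N (\<lambda>i. n i - 2 * int (s' i) - w i)"
      using exp_cone_shift[of N "\<lambda>i. n i - 2 * int (s' i)" w] exp_cone_pair[OF jk \<nu>] by (auto simp: w_def)
    moreover have "(\<lambda>i. n i - 2 * int (s' i) - w i) = (\<lambda>i. n i - E_vec (j, k, t, u, \<nu>) i - 2 * int (s i))"
      using jk' by (intro ext) (simp add: s'_def w_def E_vec_unit_vec unit_vec_def)
    ultimately show "h y = 0" unfolding stu by (simp add: h_def kernel_coeff_eq_0)
  qed auto
  also have "\<dots> = (\<Sum>t\<le>M. \<Sum>u\<le>M. \<Sum>s\<in>S. h (s, t, u))"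
  proof -
    have "(\<Sum>y\<in>S \<times> {..M} \<times> {..M}. h y) = (\<Sum>s\<in>S. \<Sum>tu\<in>{..M} \<times> {..M}. h (s, tu))"
      by (simp add: sum.cartesian_product)
    also have "\<dots> = (\<Sum>tu\<in>{..M} \<times> {..M}. \<Sum>s\<in>S. h (s, tu))"
      by (rule sum.swap)
    also have "\<dots> = (\<Sum>t\<le>M. \<Sum>u\<le>M. \<Sum>s\<in>S. h (s, t, u))"
    proof -
      have "(\<Sum>tu\<in>{..M} \<times> {..M}. F tu) = (\<Sum>t\<le>M. \<Sum>u\<le>M. F (t, u))" for F :: "nat \<times> nat \<Rightarrow> real"
        by (simp add: sum.cartesian_product)
      then show ?thesis .
    qed
    finally show ?thesis .
  qed
  also have "\<dots> = (\<Sum>t\<le>M. \<Sum>u\<le>M. tj t * uk u * f_H N lam (\<lambda>i. n i - E_vec (j, k, t, u, \<nu>) i) x)"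
  proof (intro sum.cong refl)
    fix t u
    have "tail_bounded N (\<lambda>i. n i - E_vec (j, k, t, u, \<nu>) i) M"
      using jk by (intro tail_bounded_diff M exp_cone_E_vec) (simp add: steps_def)
    from f_H_eq_sum[OF this]
    show "(\<Sum>s\<in>S. h (s, t, u)) = tj t * uk u * f_H N lam (\<lambda>i. n i - E_vec (j, k, t, u, \<nu>) i) x"
      by (simp add: S_def h_def w2 sum_distrib_left)
  qed
  finally show ?thesis unfolding S_def H_def tj_def uk_def a_def b_def .
qed

definition steps_le :: "nat \<Rightarrow> nat \<Rightarrow> step set" where
  "steps_le N M = {(j, k, t, u, v). (j, k) \<in> index_pairs N \<and> t \<le> M \<and> u \<le> M \<and> v \<le> M}"

lemma steps_le_eq: "steps_le N M = (\<lambda>((j, k), t, u, v). (j, k, t, u, v)) ` (index_pairs N \<times> {..M} \<times> {..M} \<times> {..M})"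
  by (force simp: steps_le_def)

lemma finite_steps_le: "finite (steps_le N M)"
  unfolding steps_le_eq by (auto simp: finite_index_pairs)

lemma sum_steps_le:
  "(\<Sum>e\<in>steps_le N M. h e) = (\<Sum>(j, k)\<in>index_pairs N. \<Sum>v\<le>M. \<Sum>t\<le>M. \<Sum>u\<le>M. h (j, k, t, u, v))"
proof -
  have "(\<Sum>e\<in>steps_le N M. h e) = (\<Sum>((j, k), v, t, u)\<in>index_pairs N \<times> {..M} \<times> {..M} \<times> {..M}. h (j, k, t, u, v))"
    by (rule sum.reindex_bij_witness[of _ "\<lambda>((j, k), v, t, u). (j, k, t, u, v)" "\<lambda>(j, k, t, u, v). ((j, k), v, t, u)"])
       (auto simp: steps_le_def)
  then show ?thesis by (simp add: sum.cartesian_product case_prod_beta)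
qed

lemma reduced_H_f_H:
  assumes M: "tail_bounded N n M" and x: "\<And>i k. (i, k) \<in> index_pairs N \<Longrightarrow> x i \<noteq> x k"
  shows "reduced_H N lam (f_H N lam n) x = 2 * of_int (\<Sum>j=1..N. n j) * f_H N lam n x
    + (\<Sum>e\<in>steps_le N M. g_coeff N lam e (\<lambda>i. n i - E_vec e i) * f_H N lam (\<lambda>i. n i - E_vec e i) x)"
proof -
  define S where "S = ({1..N} \<rightarrow>\<^sub>E {..M} :: (nat \<Rightarrow> nat) set)"
  define C where "C = f_weight N lam n"
  define K where "K = (\<lambda>s i. n i - 2 * int (s i))"
  define G where "G = kernel_coeff N lam x"
  have finS: "finite S" unfolding S_def by (intro finite_PiE) auto
  have f: "f_H N lam n x = (\<Sum>s\<in>S. C s * kernel_coeff N lam x (K s))" for x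
    unfolding f_H_eq_sum[OF M] S_def C_def K_def ..
  have G: "reduced_H N lam (\<lambda>x. kernel_coeff N lam x m) x
    = 2 * of_int (\<Sum>j=1..N. m j) * G m
      - (\<Sum>j=1..N. (shifted N lam m j - 1) * (shifted N lam m j - 2) * G (\<lambda>i. m i - 2 * unit_vec j i))
      + 2 * lam * (lam - 1) * (\<Sum>(j, k)\<in>index_pairs N. pair_sum N lam x j k m)" for m
    using kernel_coeff_identity[where N = N and x = x and m = m and lam = lam, OF x] kernel_coeff_euler[of x N lam m]
    unfolding reduced_H_def G_def by simp
  have shift: "shifted N lam (K s) j = shifted N lam n j - 2 * real (s j)" for s j
    by (simp add: shifted_def K_def)
  have "reduced_H N lam (f_H N lam n) x = (\<Sum>s\<in>S. C s * reduced_H N lam (\<lambda>x. kernel_coeff N lam x (K s)) x)"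
    unfolding f by (rule reduced_H_lincomb) (rule coordinatewise_poly_kernel_coeff)
  also have "\<dots> = (\<Sum>s\<in>S. C s * (2 * of_int (\<Sum>j=1..N. K s j) * G (K s)))
     - (\<Sum>s\<in>S. \<Sum>j=1..N. C s * ((shifted N lam (K s) j - 1) * (shifted N lam (K s) j - 2) * G (\<lambda>i. K s i - 2 * unit_vec j i)))
     + (\<Sum>s\<in>S. C s * (2 * lam * (lam - 1) * (\<Sum>(j, k)\<in>index_pairs N. pair_sum N lam x j k (K s))))"
    unfolding G distrib_left right_diff_distrib sum.distrib sum_subtractf sum_distrib_left ..
  also have "(\<Sum>s\<in>S. \<Sum>j=1..N. C s * ((shifted N lam (K s) j - 1) * (shifted N lam (K s) j - 2) * G (\<lambda>i. K s i - 2 * unit_vec j i)))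
    = (\<Sum>j=1..N. \<Sum>s\<in>S. C s * ((shifted N lam (K s) j - 1) * (shifted N lam (K s) j - 2) * G (\<lambda>i. K s i - 2 * unit_vec j i)))"
    by (rule sum.swap)
  also have "\<dots> = (\<Sum>j=1..N. \<Sum>s\<in>S. - 4 * real (s j) * (C s * G (K s)))"
  proof (rule sum.cong[OF refl])
    fix j assume j: "j \<in> {1..N}"
    define a where "a = shifted N lam n j - 1"
    have split: "C s = p_coeff (s j) a * (\<Prod>i\<in>{1..N} - {j}. p_coeff (s i) (shifted N lam n i - 1))" for s
      unfolding C_def f_weight_def a_def using j by (subst prod.remove[of _ j]) auto
    show "(\<Sum>s\<in>S. C s * ((shifted N lam (K s) j - 1) * (shifted N lam (K s) j - 2) * G (\<lambda>i. K s i - 2 * unit_vec j i)))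
      = (\<Sum>s\<in>S. - 4 * real (s j) * (C s * G (K s)))"
    \<comment> \<open>Lowering the exponent by 2 in direction j is the same as raising s j by one,
      and the recursion of the p coefficients converts the factor into - 4 (s j + 1). At the ends, s
      j = M would leave the cone and s j = 0 carries the factor 0.\<close>
    proof (rule sum.reindex_bij_witness_not_neutral[of "{s \<in> S. s j = M}" "{s \<in> S. s j = 0}" _
          "\<lambda>s. s(j := s j - 1)" "\<lambda>s. s(j := Suc (s j))"])
      fix s assume s: "s \<in> S"
      have "(\<lambda>i. K s i - 2 * unit_vec j i) = K (s(j := Suc (s j)))"
        by (intro ext) (auto simp: K_def unit_vec_def)
      moreover have "C s * ((a - 2 * real (s j)) * (a - 2 * real (s j) - 1)) = - 4 * real (Suc (s j)) * C (s(j := Suc (s j)))"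
      proof -
        have "(\<Prod>i\<in>{1..N} - {j}. p_coeff ((s(j := Suc (s j))) i) (shifted N lam n i - 1))
          = (\<Prod>i\<in>{1..N} - {j}. p_coeff (s i) (shifted N lam n i - 1))"
          by (intro prod.cong) auto
        moreover define Q where "Q = (\<Prod>i\<in>{1..N} - {j}. p_coeff (s i) (shifted N lam n i - 1))"
        ultimately have "C (s(j := Suc (s j))) = p_coeff (Suc (s j)) a * Q"
          unfolding split[of "s(j := Suc (s j))"] by simp
        moreover have "C s * ((a - 2 * real (s j)) * (a - 2 * real (s j) - 1))
          = ((a - 2 * real (s j)) * (a - 2 * real (s j) - 1) * p_coeff (s j) a) * Q"
          unfolding split[of s] Q_def by (simp only: mult_ac)
        ultimately show ?thesis unfolding p_coeff_Suc by (simp only: mult.assoc)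
      qed
      ultimately show "- 4 * real ((s(j := Suc (s j))) j) * (C (s(j := Suc (s j))) * G (K (s(j := Suc (s j)))))
        = C s * ((shifted N lam (K s) j - 1) * (shifted N lam (K s) j - 2) * G (\<lambda>i. K s i - 2 * unit_vec j i))"
      proof -
        assume K: "(\<lambda>i. K s i - 2 * unit_vec j i) = K (s(j := Suc (s j)))"
          and C: "C s * ((a - 2 * real (s j)) * (a - 2 * real (s j) - 1)) = - 4 * real (Suc (s j)) * C (s(j := Suc (s j)))"
        have a: "shifted N lam (K s) j - 1 = a - 2 * real (s j)" "shifted N lam (K s) j - 2 = a - 2 * real (s j) - 1"
          by (simp_all add: shift a_def)
        show ?thesis
          unfolding K a fun_upd_same mult.assoc [symmetric] C [unfolded mult.assoc [symmetric]] ..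
      qed
    next
      fix s assume s: "s \<in> {s \<in> S. s j = M}"
      have "\<not> exp_cone N (K (s(j := Suc (s j))))"
      proof
        assume "exp_cone N (K (s(j := Suc (s j))))"
        from tail_bounded_le[OF M this[unfolded K_def] j] s show False by auto
      qed
      moreover have "(\<lambda>i. K s i - 2 * unit_vec j i) = K (s(j := Suc (s j)))"
        by (intro ext) (auto simp: K_def unit_vec_def)
      ultimately show "C s * ((shifted N lam (K s) j - 1) * (shifted N lam (K s) j - 2) * G (\<lambda>i. K s i - 2 * unit_vec j i)) = 0"
        by (simp add: G_def kernel_coeff_eq_0)
    next
      fix s assume s: "s \<in> S - {s \<in> S. s j = M}"
      have "s j \<le> M" using s j by (auto simp: S_def)
      then have "s j < M" using s by auto
      then show "s(j := Suc (s j)) \<in> S - {s \<in> S. s j = 0}"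
        using s j by (auto simp: S_def PiE_def extensional_def Pi_def)
    next
      fix s assume s: "s \<in> S - {s \<in> S. s j = 0}"
      have "s j \<le> M" using s j by (auto simp: S_def)
      then show "s(j := s j - 1) \<in> S - {s \<in> S. s j = M}"
        using s j by (auto simp: S_def PiE_def extensional_def Pi_def)
    qed (use finS in auto)
  qed
  \<comment> \<open>The Euler term sees the degree of n - 2 s and is too small by 4 times the sum of
    s; the second derivatives supply exactly this amount, so the eigenvalue does not depend on
    s.\<close>
  also have "(\<Sum>s\<in>S. C s * (2 * of_int (\<Sum>j=1..N. K s j) * G (K s)))
      - (\<Sum>j=1..N. \<Sum>s\<in>S. - 4 * real (s j) * (C s * G (K s)))
    = 2 * of_int (\<Sum>j=1..N. n j) * f_H N lam n x"
  proof -
    have "(\<Sum>j=1..N. \<Sum>s\<in>S. - 4 * real (s j) * (C s * G (K s)))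
      = (\<Sum>s\<in>S. \<Sum>j=1..N. - 4 * real (s j) * (C s * G (K s)))"
      by (rule sum.swap)
    then have "(\<Sum>s\<in>S. C s * (2 * of_int (\<Sum>j=1..N. K s j) * G (K s)))
      - (\<Sum>j=1..N. \<Sum>s\<in>S. - 4 * real (s j) * (C s * G (K s)))
      = (\<Sum>s\<in>S. (2 * of_int (\<Sum>j=1..N. K s j) + 4 * (\<Sum>j=1..N. real (s j))) * (C s * G (K s)))"
      by (simp add: sum_subtractf [symmetric] sum_negf sum_distrib_left sum_distrib_right algebra_simps sum.distrib)
    also have "\<dots> = (\<Sum>s\<in>S. 2 * of_int (\<Sum>j=1..N. n j) * (C s * G (K s)))"
      by (intro sum.cong refl arg_cong2[of _ _ _ _ "(*)"])
         (simp add: K_def sum_subtractf sum_distrib_left)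
    finally show ?thesis unfolding f G_def by (simp add: sum_distrib_left)
  qed
  also have "(\<Sum>s\<in>S. C s * (2 * lam * (lam - 1) * (\<Sum>(j, k)\<in>index_pairs N. pair_sum N lam x j k (K s))))
    = (\<Sum>e\<in>steps_le N M. g_coeff N lam e (\<lambda>i. n i - E_vec e i) * f_H N lam (\<lambda>i. n i - E_vec e i) x)"
  proof -
    define h where "h = (\<lambda>j k (\<nu>::nat) s. kernel_coeff N lam x
        (\<lambda>i. n i - 2 * int (s i) + (int \<nu> - 1) * unit_vec j i - (int \<nu> + 1) * unit_vec k i))"
    have ps: "pair_sum N lam x j k (K s) = (\<Sum>\<nu>\<le>M. real \<nu> * h j k \<nu> s)" if jk: "(j, k) \<in> index_pairs N" for j k s
    proof -
      have "tail N (K s) k = tail N n k - 2 * tail N (\<lambda>i. int (s i)) k"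
        unfolding K_def tail_diff tail_mult ..
      moreover have "tail N (\<lambda>i. int (s i)) k \<ge> 0" unfolding tail_def by (intro sum_nonneg) auto
      moreover have "tail N n k \<le> int M"
        using M jk unfolding tail_bounded_def by (auto simp: index_pairs_def)
      ultimately have "nat (tail N (K s) k) \<le> Suc M" by simp
      from pair_sum_eq[OF jk this]
      show ?thesis by (simp add: K_def h_def lessThan_Suc_atMost)
    qed
    have "(\<Sum>s\<in>S. C s * (2 * lam * (lam - 1) * (\<Sum>(j, k)\<in>index_pairs N. pair_sum N lam x j k (K s))))
      = (\<Sum>s\<in>S. \<Sum>p\<in>index_pairs N. \<Sum>\<nu>\<le>M. 2 * lam * (lam - 1) * real \<nu> * (C s * h (fst p) (snd p) \<nu> s))"
      unfolding sum_distrib_left case_prod_beta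
    proof (intro sum.cong refl)
      fix s p assume "p \<in> index_pairs N"
      then have "(fst p, snd p) \<in> index_pairs N" by simp
      from ps[OF this] show "C s * (2 * lam * (lam - 1) * pair_sum N lam x (fst p) (snd p) (K s))
        = (\<Sum>\<nu>\<le>M. 2 * lam * (lam - 1) * real \<nu> * (C s * h (fst p) (snd p) \<nu> s))"
        by (simp add: sum_distrib_left mult_ac)
    qed
    also have "\<dots> = (\<Sum>p\<in>index_pairs N. \<Sum>s\<in>S. \<Sum>\<nu>\<le>M. 2 * lam * (lam - 1) * real \<nu> * (C s * h (fst p) (snd p) \<nu> s))"
      by (rule sum.swap)
    also have "\<dots> = (\<Sum>p\<in>index_pairs N. \<Sum>\<nu>\<le>M. \<Sum>s\<in>S. 2 * lam * (lam - 1) * real \<nu> * (C s * h (fst p) (snd p) \<nu> s))"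
      by (intro sum.cong refl sum.swap)
    also have "\<dots> = (\<Sum>(j, k)\<in>index_pairs N. \<Sum>\<nu>\<le>M. \<Sum>t\<le>M. \<Sum>u\<le>M.
        g_coeff N lam (j, k, t, u, \<nu>) (\<lambda>i. n i - E_vec (j, k, t, u, \<nu>) i)
          * f_H N lam (\<lambda>i. n i - E_vec (j, k, t, u, \<nu>) i) x)"
      unfolding case_prod_beta
    proof (intro sum.cong refl)
      fix p \<nu> assume p: "p \<in> index_pairs N"
      define j k where "j = fst p" and "k = snd p"
      have jk: "(j, k) \<in> index_pairs N" using p by (simp add: j_def k_def)
      have ne: "j \<noteq> k" "k \<noteq> j" using jk by (auto simp: index_pairs_def)
      have g: "g_coeff N lam (j, k, t, u, \<nu>) (\<lambda>i. n i - E_vec (j, k, t, u, \<nu>) i)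
         = 2 * lam * (lam - 1) * real \<nu> * (b_coeff t (int \<nu> - 1) (shifted N lam n j - 1)
              * b_coeff u (- 1 - int \<nu>) (shifted N lam n k - 1))" for t u
      proof -
        have "shifted N lam (\<lambda>i. n i - E_vec (j, k, t, u, \<nu>) i) j + 2 * real t - real \<nu> = shifted N lam n j - 1"
          "shifted N lam (\<lambda>i. n i - E_vec (j, k, t, u, \<nu>) i) k + 2 * real u + real \<nu> = shifted N lam n k - 1"
          using ne by (simp_all add: shifted_def E_vec_unit_vec unit_vec_def)
        then show ?thesis by (simp add: g_coeff_def)
      qed
      have "(\<Sum>s\<in>S. 2 * lam * (lam - 1) * real \<nu> * (C s * h j k \<nu> s))
        = 2 * lam * (lam - 1) * real \<nu> * (\<Sum>s\<in>S. C s * h j k \<nu> s)"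
        by (simp only: sum_distrib_left)
      also have "\<dots> = 2 * lam * (lam - 1) * real \<nu> * (\<Sum>t\<le>M. \<Sum>u\<le>M. b_coeff t (int \<nu> - 1) (shifted N lam n j - 1)
        * b_coeff u (- 1 - int \<nu>) (shifted N lam n k - 1)
        * f_H N lam (\<lambda>i. n i - E_vec (j, k, t, u, \<nu>) i) x)"
      proof (cases "\<nu> = 0")
        case False
        then have "\<nu> \<ge> 1" by simp
        from f_H_pair_expansion[OF M jk this, of lam x] show ?thesis
          unfolding S_def C_def h_def by simp
      qed simp
      also have "\<dots> = (\<Sum>t\<le>M. \<Sum>u\<le>M. g_coeff N lam (j, k, t, u, \<nu>) (\<lambda>i. n i - E_vec (j, k, t, u, \<nu>) i)
          * f_H N lam (\<lambda>i. n i - E_vec (j, k, t, u, \<nu>) i) x)"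
        unfolding g sum_distrib_left by (simp only: mult.assoc)
      finally show "(\<Sum>s\<in>S. 2 * lam * (lam - 1) * real \<nu> * (C s * h (fst p) (snd p) \<nu> s))
        = (\<Sum>t\<le>M. \<Sum>u\<le>M. g_coeff N lam (fst p, snd p, t, u, \<nu>) (\<lambda>i. n i - E_vec (fst p, snd p, t, u, \<nu>) i)
          * f_H N lam (\<lambda>i. n i - E_vec (fst p, snd p, t, u, \<nu>) i) x)"
        unfolding j_def k_def .
    qed
    finally show ?thesis unfolding sum_steps_le .
  qed
  finally show ?thesis .
qed


subsection \<open>Solution of the triangular system\<close>

definition path_vec :: "step list \<Rightarrow> nat \<Rightarrow> int" where
  "path_vec w i = (\<Sum>r<length w. E_vec (w ! r) i)"

definition path_weight :: "step list \<Rightarrow> real" where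
  "path_weight w = (\<Sum>r<length w. real (step_weight (w ! r)))"

definition path_coeff :: "nat \<Rightarrow> real \<Rightarrow> (nat \<Rightarrow> int) \<Rightarrow> step list \<Rightarrow> real" where
  "path_coeff N lam n w = (\<Prod>r<length w. g_coeff N lam (w ! r) (\<lambda>i. n i - (\<Sum>l\<le>r. E_vec (w ! l) i))
     / (4 * (\<Sum>l\<le>r. real (step_weight (w ! l)))))"

lemma path_Nil [simp]: "path_vec [] i = 0" "path_weight [] = 0" "path_coeff N lam n [] = 1"
  by (simp_all add: path_vec_def path_weight_def path_coeff_def)

lemma path_vec_snoc: "path_vec (w @ [e]) i = path_vec w i + E_vec e i"
  by (simp add: path_vec_def nth_append)

lemma path_weight_snoc: "path_weight (w @ [e]) = path_weight w + real (step_weight e)"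
  by (simp add: path_weight_def nth_append)

text \<open>A factor of the product depends only on the steps up to its own position, so appending a
  step leaves the earlier factors alone. The new factor is the interaction weight divided by the
  energy difference to the starting vector: the recursion solving the triangular system.\<close>

lemma path_coeff_snoc:
  "path_coeff N lam n (w @ [e]) = path_coeff N lam n w
     * (g_coeff N lam e (\<lambda>i. n i - path_vec (w @ [e]) i) / (4 * path_weight (w @ [e])))"
proof -
  have "(\<Prod>r<length w. g_coeff N lam ((w @ [e]) ! r) (\<lambda>i. n i - (\<Sum>l\<le>r. E_vec ((w @ [e]) ! l) i))
     / (4 * (\<Sum>l\<le>r. real (step_weight ((w @ [e]) ! l))))) = path_coeff N lam n w"
    unfolding path_coeff_def
  proof (intro prod.cong refl)
    fix r assume "r \<in> {..<length w}"
    then have r: "r < length w" by simp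
    have "(\<Sum>l\<le>r. E_vec ((w @ [e]) ! l) i) = (\<Sum>l\<le>r. E_vec (w ! l) i)" for i
      using r by (intro sum.cong) (auto simp: nth_append)
    moreover have "(\<Sum>l\<le>r. real (step_weight ((w @ [e]) ! l))) = (\<Sum>l\<le>r. real (step_weight (w ! l)))"
      using r by (intro sum.cong) (auto simp: nth_append)
    ultimately show "g_coeff N lam ((w @ [e]) ! r) (\<lambda>i. n i - (\<Sum>l\<le>r. E_vec ((w @ [e]) ! l) i))
        / (4 * (\<Sum>l\<le>r. real (step_weight ((w @ [e]) ! l))))
      = g_coeff N lam (w ! r) (\<lambda>i. n i - (\<Sum>l\<le>r. E_vec (w ! l) i)) / (4 * (\<Sum>l\<le>r. real (step_weight (w ! l))))"
      using r by (simp add: nth_append)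
  qed
  then show ?thesis
    unfolding path_coeff_def[of N lam n "w @ [e]"] path_vec_def path_weight_def
    by (simp add: lessThan_Suc_atMost [symmetric] del: sum.lessThan_Suc)
qed

lemma step_weight_pos: "step_weight e > 0"
  by (simp add: step_weight_def split: prod.split)

lemma path_weight_snoc_pos: "path_weight (w @ [e]) > 0"
  unfolding path_weight_snoc using step_weight_pos[of e]
  by (simp add: path_weight_def add_nonneg_pos sum_nonneg)

text \<open>The index v cancels between the two components. Hence the diagonal entry, twice the
  component sum, drops by four times the weight of the step, which is the 4 in the
  denominators.\<close>

lemma sum_E_vec: "e \<in> steps N \<Longrightarrow> (\<Sum>i=1..N. E_vec e i) = 2 * int (step_weight e)"
proof -
  assume "e \<in> steps N"
  then obtain j k t u v where e: "e = (j, k, t, u, v)" "(j, k) \<in> index_pairs N"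
    by (auto simp: steps_def)
  then show ?thesis using tail_E_vec[OF e(2), of t u v 1]
    by (auto simp: tail_def step_weight_def index_pairs_def)
qed

lemma sum_path_vec:
  assumes "set w \<subseteq> steps N"
  shows "of_int (\<Sum>i=1..N. path_vec w i) = 2 * path_weight w"
proof -
  have "(\<Sum>i=1..N. path_vec w i) = (\<Sum>r<length w. \<Sum>i=1..N. E_vec (w ! r) i)"
    unfolding path_vec_def by (rule sum.swap)
  also have "\<dots> = (\<Sum>r<length w. 2 * int (step_weight (w ! r)))"
    using assms by (intro sum.cong refl sum_E_vec) auto
  finally show ?thesis by (simp add: path_weight_def sum_distrib_left)
qed

lemma tail_path_vec: "tail N (path_vec w) k = (\<Sum>r<length w. tail N (E_vec (w ! r)) k)"
  unfolding tail_def path_vec_def by (rule sum.swap)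

lemma exp_cone_path_vec: "set w \<subseteq> steps N \<Longrightarrow> exp_cone N (path_vec w)"
  unfolding exp_cone_def tail_path_vec
proof (intro ballI sum_nonneg)
  fix k r assume w: "set w \<subseteq> steps N" and "k \<in> {1..N}" "r \<in> {..<length w}"
  then have "w ! r \<in> steps N" using nth_mem[of r w] by auto
  from exp_cone_E_vec[OF this] show "0 \<le> tail N (E_vec (w ! r)) k"
    using \<open>k \<in> {1..N}\<close> by (simp add: exp_cone_def)
qed

text \<open>All steps have non-negative tails, so no single step can exceed the tail bound of the
  whole path; and every step uses up at least one unit of the tail at 1, which limits the
  length.\<close>

lemma path_bounded:
  assumes M: "tail_bounded N n M" and w: "set w \<subseteq> steps N" and c: "exp_cone N (\<lambda>i. n i - path_vec w i)"
  shows "set w \<subseteq> steps_le N M" "length w \<le> M"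
proof -
  have T: "tail N (path_vec w) k \<le> int M" if "k \<in> {1..N}" for k
    using M c that unfolding tail_bounded_def exp_cone_def tail_diff by force
  have nonneg: "0 \<le> tail N (E_vec (w ! r)) k" if "r < length w" "k \<in> {1..N}" for r k
  proof -
    have "w ! r \<in> steps N" using w nth_mem[OF that(1)] by blast
    from exp_cone_E_vec[OF this] show ?thesis using that(2) by (simp add: exp_cone_def)
  qed
  have step: "tail N (E_vec (w ! r)) k \<le> int M" if "r < length w" "k \<in> {1..N}" for r k
  proof -
    have "tail N (E_vec (w ! r)) k \<le> tail N (path_vec w) k"
      unfolding tail_path_vec using that nonneg by (intro member_le_sum) auto
    with T[OF that(2)] show ?thesis by simp
  qed
  show "set w \<subseteq> steps_le N M"
  proof
    fix e assume "e \<in> set w"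
    then obtain r where r: "r < length w" "e = w ! r" by (auto simp: in_set_conv_nth)
    obtain j k t u v where e: "e = (j, k, t, u, v)" "(j, k) \<in> index_pairs N"
      using w \<open>e \<in> set w\<close> by (auto simp: steps_def)
    then have jk: "j \<in> {1..N}" "k \<in> {1..N}" "j < k" by (auto simp: index_pairs_def)
    \<comment> \<open>The tail at j is 2 + 2 t + 2 u and controls t and u; the tail at k is 1 + 2 u
      + v and controls v.\<close>
    show "e \<in> steps_le N M"
      using step[OF r(1) jk(1)] step[OF r(1) jk(2)] jk e(2)
      unfolding r(2) [symmetric] e(1) tail_E_vec[OF e(2)] by (auto simp: steps_le_def)
  qed
  show "length w \<le> M"
  proof (cases "w = []")
    case False
    then have "hd w \<in> steps N" using w by (meson hd_in_set subsetD)
    then have N: "1 \<in> {1..N}" by (auto simp: steps_def index_pairs_def)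
    have "int (length w) = (\<Sum>r<length w. 1)" by simp
    also have "\<dots> \<le> (\<Sum>r<length w. tail N (E_vec (w ! r)) 1)"
    proof (intro sum_mono)
      fix r assume "r \<in> {..<length w}"
      then have "w ! r \<in> steps N" using w by auto
      from sum_E_vec[OF this] step_weight_pos[of "w ! r"] show "1 \<le> tail N (E_vec (w ! r)) 1"
        by (simp add: tail_def)
    qed
    also have "\<dots> \<le> int M" using T[OF N] by (simp add: tail_path_vec)
    finally show ?thesis by simp
  qed simp
qed

definition paths :: "nat \<Rightarrow> nat \<Rightarrow> step list set" where
  "paths N M = {w. set w \<subseteq> steps_le N M \<and> length w \<le> M}"

lemma finite_paths: "finite (paths N M)"
  unfolding paths_def by (rule finite_lists_length_le[OF finite_steps_le])

lemma steps_le_subset: "steps_le N M \<subseteq> steps N"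
  by (auto simp: steps_le_def steps_def)

lemma path_vec_eq_imp_paths:
  assumes M: "tail_bounded N n M" and m: "exp_cone N m" and w: "set w \<subseteq> steps N"
    and eq: "\<forall>i\<in>{1..N}. m i = n i - path_vec w i"
  shows "w \<in> paths N M"
proof -
  have "exp_cone N (\<lambda>i. n i - path_vec w i)"
    using m eq exp_cone_cong[of N m "\<lambda>i. n i - path_vec w i"] by auto
  from path_bounded[OF M w this] show ?thesis by (simp add: paths_def)
qed

text \<open>A path ending in the cone is one of finitely many, whatever its length, and the
  Kronecker delta is the contribution of the empty path.\<close>

lemma beta_eq_sum:
  assumes M: "tail_bounded N n M" and m: "exp_cone N m"
  shows "beta N lam n m = (\<Sum>w\<in>paths N M. if \<forall>i\<in>{1..N}. m i = n i - path_vec w i then path_coeff N lam n w else 0)"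
proof -
  define T where "T = (\<lambda>w. if \<forall>i\<in>{1..N}. m i = n i - path_vec w i then path_coeff N lam n w else 0)"
  define L where "L = (\<lambda>s. {w \<in> paths N M. length w = s})"
  have T: "kronecker N n (\<lambda>i. m i + (\<Sum>r<s. E_vec (w ! r) i))
          * (\<Prod>r<s. g_coeff N lam (w ! r) (\<lambda>i. n i - (\<Sum>l\<le>r. E_vec (w ! l) i))
                    / (4 * (\<Sum>l\<le>r. real (step_weight (w ! l))))) = T w" if "length w = s" for w s
    using that by (auto simp: T_def kronecker_def path_vec_def path_coeff_def)
  have T0: "T w = 0" if "set w \<subseteq> steps N" "w \<notin> paths N M" for w
    using path_vec_eq_imp_paths[OF M m that(1)] that(2) by (auto simp: T_def)
  have inner: "(\<Sum>\<^sub>\<infinity>w\<in>{w. length w = s \<and> set w \<subseteq> steps N}. T w) = (\<Sum>w\<in>L s. T w)" for s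
  proof -
    have "(\<Sum>\<^sub>\<infinity>w\<in>{w. length w = s \<and> set w \<subseteq> steps N}. T w) = (\<Sum>\<^sub>\<infinity>w\<in>L s. T w)"
      by (rule infsum_cong_neutral) (use steps_le_subset in \<open>auto simp: L_def paths_def intro!: T0\<close>)
    then show ?thesis using finite_paths by (simp add: L_def)
  qed
  have "(\<Sum>\<^sub>\<infinity>s\<in>{1..}. \<Sum>\<^sub>\<infinity>w\<in>{w. length w = s \<and> set w \<subseteq> steps N}.
          kronecker N n (\<lambda>i. m i + (\<Sum>r<s. E_vec (w ! r) i))
          * (\<Prod>r<s. g_coeff N lam (w ! r) (\<lambda>i. n i - (\<Sum>l\<le>r. E_vec (w ! l) i))
                    / (4 * (\<Sum>l\<le>r. real (step_weight (w ! l))))))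
    = (\<Sum>\<^sub>\<infinity>s\<in>{1..}. \<Sum>w\<in>L s. T w)"
    unfolding inner [symmetric] by (intro infsum_cong T) auto
  also have "\<dots> = (\<Sum>\<^sub>\<infinity>s\<in>{1..M}. \<Sum>w\<in>L s. T w)"
    by (rule infsum_cong_neutral) (auto simp: L_def paths_def intro!: sum.neutral)
  also have "\<dots> = (\<Sum>s=1..M. \<Sum>w\<in>L s. T w)" by simp
  finally have "beta N lam n m = kronecker N n m + (\<Sum>s=1..M. \<Sum>w\<in>L s. T w)"
    unfolding beta_def by simp
  also have "kronecker N n m = (\<Sum>w\<in>L 0. T w)"
  proof -
    have "L 0 = {[]}" by (auto simp: L_def paths_def)
    then show ?thesis by (auto simp: T_def kronecker_def)
  qed
  also have "(\<Sum>w\<in>L 0. T w) + (\<Sum>s=1..M. \<Sum>w\<in>L s. T w) = (\<Sum>s=0..M. \<Sum>w\<in>L s. T w)"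
    by (simp add: sum.atLeast_Suc_atMost)
  also have "\<dots> = (\<Sum>w\<in>paths N M. T w)"
    unfolding L_def by (rule sum.group[OF finite_paths]) (auto simp: paths_def)
  finally show ?thesis unfolding T_def .
qed

text \<open>Summing over end points and then over the paths leading there is summing over paths. End
  points outside the cone drop out through f rather than through beta.\<close>

lemma calogero_P_eq_sum:
  assumes M: "tail_bounded N n M"
  shows "calogero_P N lam n x
    = (\<Sum>w\<in>paths N M. path_coeff N lam n w * f_H N lam (\<lambda>i. n i - path_vec w i) x)"
proof -
  define R where "R = (\<lambda>w. restrict (\<lambda>i. n i - path_vec w i) {1..N})"
  define A where "A = R ` paths N M"
  have finA: "finite A" unfolding A_def using finite_paths by simp
  have A: "A \<subseteq> {1..N} \<rightarrow>\<^sub>E UNIV" by (auto simp: A_def R_def)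
  have eqR: "(\<forall>i\<in>{1..N}. m i = n i - path_vec w i) \<longleftrightarrow> m = R w" if "m \<in> {1..N} \<rightarrow>\<^sub>E UNIV" for m w
  proof
    assume a: "\<forall>i\<in>{1..N}. m i = n i - path_vec w i"
    show "m = R w" by (rule PiE_ext[OF that]) (use a in \<open>auto simp: R_def\<close>)
  qed (auto simp: R_def)
  have trm: "beta N lam n m * f_H N lam m x
    = (\<Sum>w\<in>paths N M. if m = R w then path_coeff N lam n w * f_H N lam m x else 0)"
    if m: "m \<in> {1..N} \<rightarrow>\<^sub>E UNIV" for m
  proof (cases "exp_cone N m")
    case True
    show ?thesis unfolding beta_eq_sum[OF M True] eqR[OF m] sum_distrib_right
      by (intro sum.cong) auto
  next
    case False
    then have f0: "f_H N lam m x = 0" by (rule f_H_eq_0)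
    show ?thesis unfolding f0 mult_zero_right if_cancel by simp
  qed
  have "calogero_P N lam n x = (\<Sum>\<^sub>\<infinity>m\<in>{1..N} \<rightarrow>\<^sub>E UNIV.
      \<Sum>w\<in>paths N M. if m = R w then path_coeff N lam n w * f_H N lam m x else 0)"
    unfolding calogero_P_def by (intro infsum_cong trm)
  also have "\<dots> = (\<Sum>\<^sub>\<infinity>m\<in>A. \<Sum>w\<in>paths N M. if m = R w then path_coeff N lam n w * f_H N lam m x else 0)"
    by (rule infsum_cong_neutral) (use A in \<open>auto simp: A_def intro!: sum.neutral\<close>)
  also have "\<dots> = (\<Sum>m\<in>A. \<Sum>w\<in>paths N M. if m = R w then path_coeff N lam n w * f_H N lam m x else 0)"
    using finA by simp
  also have "\<dots> = (\<Sum>w\<in>paths N M. \<Sum>m\<in>A. if m = R w then path_coeff N lam n w * f_H N lam m x else 0)"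
    by (rule sum.swap)
  also have "\<dots> = (\<Sum>w\<in>paths N M. path_coeff N lam n w * f_H N lam (\<lambda>i. n i - path_vec w i) x)"
  proof (intro sum.cong refl)
    fix w assume w: "w \<in> paths N M"
    have "f_H N lam (R w) x = f_H N lam (\<lambda>i. n i - path_vec w i) x"
      by (rule local_onD[OF local_on_f_H]) (simp add: R_def)
    moreover have "R w \<in> A" using w by (simp add: A_def)
    ultimately show "(\<Sum>m\<in>A. if m = R w then path_coeff N lam n w * f_H N lam m x else 0)
      = path_coeff N lam n w * f_H N lam (\<lambda>i. n i - path_vec w i) x"
      using finA by simp
  qed
  finally show ?thesis .
qed

text \<open>Extending every path by one step reproduces all non-empty paths, so the off-diagonal part
  of the operator telescopes against the energy differences.\<close>

lemma reduced_H_calogero_P: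
  assumes x: "\<And>i k. (i, k) \<in> index_pairs N \<Longrightarrow> x i \<noteq> x k"
  shows "reduced_H N lam (calogero_P N lam n) x = 2 * of_int (\<Sum>j=1..N. n j) * calogero_P N lam n x"
proof -
  obtain M where M: "tail_bounded N n M" using tail_bounded_exists by blast
  define A where "A = paths N M"
  define c where "c = path_coeff N lam n"
  define F where "F = (\<lambda>w x. f_H N lam (\<lambda>i. n i - path_vec w i) x)"
  define y where "y = (\<lambda>w. 4 * path_weight w * c w * F w x)"
  have P: "calogero_P N lam n = (\<lambda>x. \<Sum>w\<in>A. c w * F w x)"
    unfolding A_def c_def F_def by (intro ext calogero_P_eq_sum[OF M])
  have step: "c w * reduced_H N lam (F w) x
    = 2 * of_int (\<Sum>j=1..N. n j) * (c w * F w x) - y w + (\<Sum>e\<in>steps_le N M. y (w @ [e]))"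
    if w: "w \<in> A" for w
  proof -
    have sw: "set w \<subseteq> steps N" using w steps_le_subset by (auto simp: A_def paths_def)
    have "reduced_H N lam (F w) x = 2 * of_int (\<Sum>j=1..N. n j - path_vec w j) * F w x
       + (\<Sum>e\<in>steps_le N M. g_coeff N lam e (\<lambda>i. n i - path_vec w i - E_vec e i)
            * f_H N lam (\<lambda>i. n i - path_vec w i - E_vec e i) x)"
      unfolding F_def by (rule reduced_H_f_H[OF tail_bounded_diff[OF M exp_cone_path_vec[OF sw]] x])
    also have "of_int (\<Sum>j=1..N. n j - path_vec w j) = of_int (\<Sum>j=1..N. n j) - 2 * path_weight w"
      using sum_path_vec[OF sw] by (simp add: sum_subtractf)
    also have "(\<lambda>e. \<lambda>i. n i - path_vec w i - E_vec e i) = (\<lambda>e. \<lambda>i. n i - path_vec (w @ [e]) i)"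
      by (simp add: path_vec_snoc algebra_simps)
    finally have H: "reduced_H N lam (F w) x = 2 * (of_int (\<Sum>j=1..N. n j) - 2 * path_weight w) * F w x
       + (\<Sum>e\<in>steps_le N M. g_coeff N lam e (\<lambda>i. n i - path_vec (w @ [e]) i) * F (w @ [e]) x)"
      unfolding F_def by (simp add: path_vec_snoc algebra_simps)
    \<comment> \<open>The interaction term of an extension is its coefficient times the denominator
      just introduced; cancelling it uses that a non-empty path has positive weight.\<close>
    have "c w * (g_coeff N lam e (\<lambda>i. n i - path_vec (w @ [e]) i) * F (w @ [e]) x) = y (w @ [e])" for e
      using path_weight_snoc_pos[of w e] unfolding y_def c_def path_coeff_snoc by simp
    note cg = this
    have yw: "y w = 4 * path_weight w * c w * F w x" by (simp add: y_def)
    show ?thesis unfolding H distrib_left sum_distrib_left cg by (simp add: yw algebra_simps)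
  qed
  have telescope: "(\<Sum>w\<in>A. \<Sum>e\<in>steps_le N M. y (w @ [e])) = (\<Sum>w\<in>A. y w)"
  proof -
    have "(\<Sum>w\<in>A. \<Sum>e\<in>steps_le N M. y (w @ [e])) = (\<Sum>p\<in>A \<times> steps_le N M. y (fst p @ [snd p]))"
      by (simp add: sum.cartesian_product case_prod_beta)
    also have "\<dots> = (\<Sum>w\<in>A. y w)"
    \<comment> \<open>Extensions of paths of the maximal length M end outside the cone, where f is
      zero, and the only path that is not an extension is the empty one, whose weight is
      zero.\<close>
    proof (rule sum.reindex_bij_witness_not_neutral[of "{p \<in> A \<times> steps_le N M. length (fst p) = M}" "{[]}" _
          "\<lambda>w. (butlast w, last w)" "\<lambda>p. fst p @ [snd p]"])
      show "finite {p \<in> A \<times> steps_le N M. length (fst p) = M}"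
        using finite_paths finite_steps_le by (auto simp: A_def)
      fix p assume p: "p \<in> {p \<in> A \<times> steps_le N M. length (fst p) = M}"
      have "\<not> exp_cone N (\<lambda>i. n i - path_vec (fst p @ [snd p]) i)"
      proof
        assume "exp_cone N (\<lambda>i. n i - path_vec (fst p @ [snd p]) i)"
        moreover have "snd p \<in> steps_le N M" "set (fst p) \<subseteq> steps_le N M"
          using p by (auto simp: A_def paths_def)
        then have "set (fst p @ [snd p]) \<subseteq> steps N"
          using steps_le_subset[of N M] unfolding set_append list.set by blast
        ultimately have "length (fst p @ [snd p]) \<le> M" using path_bounded(2)[OF M] by blast
        with p show False by simp
      qed
      then show "y (fst p @ [snd p]) = 0" by (simp add: y_def F_def f_H_eq_0)
    next
      fix w assume w: "w \<in> A - {[]}"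
      then have "length (butlast w) < M" by (cases w rule: rev_cases) (auto simp: A_def paths_def)
      with w show "(butlast w, last w) \<in> A \<times> steps_le N M - {p \<in> A \<times> steps_le N M. length (fst p) = M}"
        by (cases w rule: rev_cases) (auto simp: A_def paths_def)
    qed (auto simp: A_def paths_def y_def)
    finally show ?thesis .
  qed
  have "reduced_H N lam (calogero_P N lam n) x = (\<Sum>w\<in>A. c w * reduced_H N lam (F w) x)"
    unfolding P by (rule reduced_H_lincomb) (simp add: F_def coordinatewise_poly_f_H)
  also have "\<dots> = (\<Sum>w\<in>A. 2 * of_int (\<Sum>j=1..N. n j) * (c w * F w x) - y w + (\<Sum>e\<in>steps_le N M. y (w @ [e])))"
    by (intro sum.cong refl step)
  also have "\<dots> = 2 * of_int (\<Sum>j=1..N. n j) * (\<Sum>w\<in>A. c w * F w x)"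
    unfolding sum.distrib sum_subtractf telescope by (simp add: sum_distrib_left)
  finally show ?thesis unfolding P .
qed

section \<open>Polynomiality and symmetry\<close>

lemma coordinatewise_poly_calogero_P: "coordinatewise_poly (calogero_P N lam n)"
proof -
  obtain M where M: "tail_bounded N n M" using tail_bounded_exists by blast
  have "calogero_P N lam n = (\<lambda>x. \<Sum>w\<in>paths N M. path_coeff N lam n w * f_H N lam (\<lambda>i. n i - path_vec w i) x)"
    by (intro ext calogero_P_eq_sum[OF M])
  then show ?thesis
    by (simp add: coordinatewise_poly_sum coordinatewise_poly_mult coordinatewise_poly_const coordinatewise_poly_f_H)
qed

lemma polynomial_in_monomial: "polynomial_in N (\<lambda>x. c * (\<Prod>j=1..N. x j ^ \<alpha> j))"
  unfolding polynomial_in_def by (intro exI[of _ "{\<alpha>}"] exI[of _ "\<lambda>_. c"]) simp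

lemma polynomial_in_add:
  assumes "polynomial_in N P" "polynomial_in N Q"
  shows "polynomial_in N (\<lambda>x. P x + Q x)"
proof -
  obtain A c where A: "finite A" "\<And>x. P x = (\<Sum>\<alpha>\<in>A. c \<alpha> * (\<Prod>j=1..N. x j ^ \<alpha> j))"
    using assms(1) unfolding polynomial_in_def by (elim exE conjE) blast
  obtain B d where B: "finite B" "\<And>x. Q x = (\<Sum>\<alpha>\<in>B. d \<alpha> * (\<Prod>j=1..N. x j ^ \<alpha> j))"
    using assms(2) unfolding polynomial_in_def by (elim exE conjE) blast
  define c' where "c' = (\<lambda>\<alpha>. if \<alpha> \<in> A then c \<alpha> else 0)"
  define d' where "d' = (\<lambda>\<alpha>. if \<alpha> \<in> B then d \<alpha> else 0)"
  have "P x = (\<Sum>\<alpha>\<in>A \<union> B. c' \<alpha> * (\<Prod>j=1..N. x j ^ \<alpha> j))" for x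
    unfolding A(2) using A(1) B(1) by (intro sum.mono_neutral_cong_left) (auto simp: c'_def)
  moreover have "Q x = (\<Sum>\<alpha>\<in>A \<union> B. d' \<alpha> * (\<Prod>j=1..N. x j ^ \<alpha> j))" for x
    unfolding B(2) using A(1) B(1) by (intro sum.mono_neutral_cong_left) (auto simp: d'_def)
  ultimately show ?thesis
    unfolding polynomial_in_def using A(1) B(1)
    by (intro exI[of _ "A \<union> B"] exI[of _ "\<lambda>\<alpha>. c' \<alpha> + d' \<alpha>"]) (simp add: distrib_right sum.distrib)
qed

lemma polynomial_in_zero: "polynomial_in N (\<lambda>x. 0)"
  unfolding polynomial_in_def by (intro exI[of _ "{}"]) auto

lemma polynomial_in_sum:
  "(\<And>i. i \<in> I \<Longrightarrow> polynomial_in N (P i)) \<Longrightarrow> polynomial_in N (\<lambda>x. \<Sum>i\<in>I. P i x)"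
  by (induction I rule: infinite_finite_induct) (auto intro: polynomial_in_zero polynomial_in_add)

lemma polynomial_in_cmult:
  assumes "polynomial_in N P"
  shows "polynomial_in N (\<lambda>x. c * P x)"
proof -
  obtain A d where A: "finite A" "\<And>x. P x = (\<Sum>\<alpha>\<in>A. d \<alpha> * (\<Prod>j=1..N. x j ^ \<alpha> j))"
    using assms unfolding polynomial_in_def by (elim exE conjE) blast
  show ?thesis unfolding A(2) sum_distrib_left mult.assoc [symmetric]
    by (intro polynomial_in_sum polynomial_in_monomial)
qed

lemma kernel_term_monomial:
  "kernel_term N lam x p q = ((\<Prod>jk\<in>index_pairs N. (lam gchoose p jk) * (-1) ^ p jk)
      * (\<Prod>jk\<in>{1..N} \<times> {1..N}. ((- lam) gchoose q jk) * (-1) ^ q jk))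
     * (\<Prod>j=1..N. x j ^ (\<Sum>k=1..N. q (j, k)))"
proof -
  have "(\<Prod>(j, k)\<in>{1..N} \<times> {1..N}. ((- lam) gchoose q (j, k)) * (- x j) ^ q (j, k))
    = (\<Prod>jk\<in>{1..N} \<times> {1..N}. ((- lam) gchoose q jk) * (-1) ^ q jk) * (\<Prod>(j, k)\<in>{1..N} \<times> {1..N}. x j ^ q (j, k))"
    unfolding prod.distrib [symmetric]
  proof (intro prod.cong refl)
    fix jk :: "nat \<times> nat"
    obtain j k where jk: "jk = (j, k)" by force
    have "(- x j) ^ q jk = (-1) ^ q jk * x j ^ q jk" by (rule power_minus)
    then show "(case jk of (j, k) \<Rightarrow> ((- lam) gchoose q (j, k)) * (- x j) ^ q (j, k))
      = ((- lam) gchoose q jk) * (-1) ^ q jk * (case jk of (j, k) \<Rightarrow> x j ^ q (j, k))"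
      by (simp add: jk)
  qed
  also have "(\<Prod>(j, k)\<in>{1..N} \<times> {1..N}. x j ^ q (j, k)) = (\<Prod>j=1..N. x j ^ (\<Sum>k=1..N. q (j, k)))"
    by (simp add: prod.cartesian_product [symmetric] power_sum)
  finally show ?thesis by (simp add: kernel_term_def mult.assoc)
qed

lemma polynomial_in_f_H: "polynomial_in N (f_H N lam n)"
proof -
  obtain M where M: "tail_bounded N n M" using tail_bounded_exists by blast
  have "f_H N lam n = (\<lambda>x. \<Sum>s\<in>{1..N} \<rightarrow>\<^sub>E {..M}. f_weight N lam n s
    * kernel_coeff N lam x (\<lambda>j. n j - 2 * int (s j)))"
    by (intro ext f_H_eq_sum[OF M])
  then show ?thesis
    unfolding kernel_coeff_def case_prod_beta kernel_term_monomial
    by (simp only:) (intro polynomial_in_sum polynomial_in_cmult polynomial_in_monomial)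
qed

lemma polynomial_in_calogero_P: "polynomial_in N (calogero_P N lam n)"
proof -
  obtain M where M: "tail_bounded N n M" using tail_bounded_exists by blast
  have "calogero_P N lam n = (\<lambda>x. \<Sum>w\<in>paths N M. path_coeff N lam n w * f_H N lam (\<lambda>i. n i - path_vec w i) x)"
    by (intro ext calogero_P_eq_sum[OF M])
  then show ?thesis
    by (simp only:) (intro polynomial_in_sum polynomial_in_cmult polynomial_in_f_H)
qed

text \<open>Permuting x amounts to permuting the first index of q. The degree in y sums over that
  index, so the index set of the coefficient is preserved.\<close>

lemma kernel_coeff_permute:
  assumes \<pi>: "\<pi> permutes {1..N}"
  shows "kernel_coeff N lam (\<lambda>j. x (\<pi> j)) m = kernel_coeff N lam x m"
proof -
  define \<rho> where "\<rho> = inv \<pi>"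
  have \<rho>: "\<rho> permutes {1..N}" unfolding \<rho>_def by (rule permutes_inv[OF \<pi>])
  have inv: "\<pi> (\<rho> i) = i" "\<rho> (\<pi> i) = i" for i
    unfolding \<rho>_def using permutes_inverses[OF \<pi>] by auto
  define act where "act = (\<lambda>(\<sigma> :: nat \<Rightarrow> nat) (q :: nat \<times> nat \<Rightarrow> nat) ik. q (\<sigma> (fst ik), snd ik))"
  define D where "D = {(p, q). (p, q) \<in> kernel_indices N \<and> (\<forall>j\<in>{1..N}. y_degree N p q j = m j)}"
  have act_ext: "act \<sigma> q \<in> {1..N} \<times> {1..N} \<rightarrow>\<^sub>E UNIV"
    if "\<sigma> permutes {1..N}" "q \<in> {1..N} \<times> {1..N} \<rightarrow>\<^sub>E UNIV" for \<sigma> q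
  proof -
    have "act \<sigma> q ik = undefined" if "ik \<notin> {1..N} \<times> {1..N}" for ik
    proof -
      have "(\<sigma> (fst ik), snd ik) \<notin> {1..N} \<times> {1..N}"
        using that permutes_in_image[OF \<open>\<sigma> permutes {1..N}\<close>, of "fst ik"] by (cases ik) auto
      then show ?thesis using \<open>q \<in> _\<close> unfolding act_def by (rule PiE_arb[rotated])
    qed
    then show ?thesis by (auto simp: PiE_def extensional_def)
  qed
  have deg: "y_degree N p (act \<sigma> q) j = y_degree N p q j" if "\<sigma> permutes {1..N}" for \<sigma> p q j
  proof -
    have "(\<Sum>i\<in>{1..N}. int (act \<sigma> q (i, j))) = (\<Sum>i\<in>{1..N}. int (q (i, j)))"
      using sum.permute[OF that, of "\<lambda>i. int (q (i, j))"] by (simp add: act_def comp_def)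
    then show ?thesis by (simp add: y_degree_def)
  qed
  have mem: "(p, act \<sigma> q) \<in> D" if "\<sigma> permutes {1..N}" "(p, q) \<in> D" for \<sigma> p q
    using that act_ext[OF that(1)] deg[OF that(1)] by (auto simp: D_def kernel_indices_def)
  have trm: "kernel_term N lam (\<lambda>j. x (\<pi> j)) p (act \<pi> q) = kernel_term N lam x p q" for p q
  proof -
    have "(\<Prod>j=1..N. \<Prod>k=1..N. ((- lam) gchoose q (\<pi> j, k)) * (- x (\<pi> j)) ^ q (\<pi> j, k))
       = (\<Prod>j=1..N. \<Prod>k=1..N. ((- lam) gchoose q (j, k)) * (- x j) ^ q (j, k))"
      using prod.permute[OF \<pi>, of "\<lambda>j. \<Prod>k=1..N. ((- lam) gchoose q (j, k)) * (- x j) ^ q (j, k)"]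
      by (simp add: comp_def)
    then show ?thesis
      unfolding kernel_term_def act_def by (simp add: prod.cartesian_product)
  qed
  show ?thesis
    unfolding kernel_coeff_def D_def [symmetric]
  proof (rule sum.reindex_bij_witness[of _ "\<lambda>(p, q). (p, act \<pi> q)" "\<lambda>(p, q). (p, act \<rho> q)"])
    fix pq assume pq: "pq \<in> D"
    obtain p q where e: "pq = (p, q)" by force
    show "(case case pq of (p, q) \<Rightarrow> (p, act \<rho> q) of (p, q) \<Rightarrow> (p, act \<pi> q)) = pq"
      "(case case pq of (p, q) \<Rightarrow> (p, act \<pi> q) of (p, q) \<Rightarrow> (p, act \<rho> q)) = pq"
      unfolding e by (auto simp: act_def inv)
    show "(case pq of (p, q) \<Rightarrow> (p, act \<rho> q)) \<in> D" "(case pq of (p, q) \<Rightarrow> (p, act \<pi> q)) \<in> D"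
      using pq mem \<pi> \<rho> unfolding e by auto
    have "act \<pi> (act \<rho> q) = q" by (auto simp: act_def inv)
    then show "(case case pq of (p, q) \<Rightarrow> (p, act \<rho> q) of (p, q) \<Rightarrow> kernel_term N lam x p q)
      = (case pq of (p, q) \<Rightarrow> kernel_term N lam (\<lambda>j. x (\<pi> j)) p q)"
      unfolding e using trm[of p "act \<rho> q"] by simp
  qed
qed

lemma symmetric_in_calogero_P: "symmetric_in N (calogero_P N lam n)"
  unfolding symmetric_in_def
proof (intro allI impI)
  fix \<pi> and x :: "nat \<Rightarrow> real" assume \<pi>: "\<pi> permutes {1..N}"
  have f: "f_H N lam m (\<lambda>j. x (\<pi> j)) = f_H N lam m x" for m
  proof -
    obtain M where M: "tail_bounded N m M" using tail_bounded_exists by blast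
    show ?thesis unfolding f_H_eq_sum[OF M] kernel_coeff_permute[OF \<pi>] ..
  qed
  show "calogero_P N lam n (\<lambda>j. x (\<pi> j)) = calogero_P N lam n x"
    unfolding calogero_P_def f ..
qed


subsection \<open>Conjugation by the ground state\<close>

definition ordered_on :: "nat \<Rightarrow> (nat \<Rightarrow> real) \<Rightarrow> bool" where
  "ordered_on N x \<longleftrightarrow> (\<forall>p\<in>index_pairs N. x (fst p) < x (snd p))"

definition psi0_log :: "nat \<Rightarrow> real \<Rightarrow> (nat \<Rightarrow> real) \<Rightarrow> real" where
  "psi0_log N lam x = (\<Sum>j=1..N. - ((x j)\<^sup>2) / 2) + (\<Sum>p\<in>index_pairs N. lam * ln (x (snd p) - x (fst p)))"

text \<open>The term \<open>k = j\<close> vanishes because \<open>lam / 0 = 0\<close>.\<close>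

definition psi0_drift :: "nat \<Rightarrow> real \<Rightarrow> (nat \<Rightarrow> real) \<Rightarrow> nat \<Rightarrow> real" where
  "psi0_drift N lam x j = - x j + (\<Sum>k=1..N. lam / (x j - x k))"

lemma psi0_eq_exp:
  assumes "ordered_on N x"
  shows "psi0 N lam x = exp (psi0_log N lam x)"
proof -
  have "(\<Prod>(j, k)\<in>index_pairs N. (x k - x j) powr lam)
    = (\<Prod>p\<in>index_pairs N. exp (lam * ln (x (snd p) - x (fst p))))"
    using assms by (intro prod.cong) (auto simp: ordered_on_def powr_def)
  then show ?thesis
    by (simp add: psi0_def psi0_log_def exp_add exp_sum finite_index_pairs)
qed

text \<open>The chamber is open in each coordinate. A second derivative needs the first one
  throughout a neighbourhood, and there the exponential form of the ground state must remain
  valid.\<close>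

lemma eventually_ordered_on:
  assumes "ordered_on N x"
  shows "eventually (\<lambda>t. ordered_on N (x(j := t))) (nhds (x j))"
  unfolding ordered_on_def
proof (rule eventually_ball_finite[OF finite_index_pairs], intro ballI)
  fix p assume p: "p \<in> index_pairs N"
  then have lt: "x (fst p) < x (snd p)" and ne: "fst p \<noteq> snd p"
    using assms by (auto simp: ordered_on_def index_pairs_def)
  consider "fst p = j" "snd p \<noteq> j" | "snd p = j" "fst p \<noteq> j" | "fst p \<noteq> j" "snd p \<noteq> j" using ne by auto
  then show "eventually (\<lambda>t. (x(j := t)) (fst p) < (x(j := t)) (snd p)) (nhds (x j))"
  proof cases
    case 1
    then show ?thesis using lt eventually_nhds_in_open[OF open_lessThan, of "x j" "x (snd p)"] by simp
  next
    case 2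
    then show ?thesis using lt eventually_nhds_in_open[OF open_greaterThan, of "x j" "x (fst p)"] by simp
  qed (use lt in simp)
qed

lemma psi0_log_deriv:
  assumes x: "ordered_on N x" and j: "j \<in> {1..N}"
  shows "((\<lambda>t. psi0_log N lam (x(j := t))) has_real_derivative psi0_drift N lam x j) (at (x j))"
proof -
  have 1: "((\<lambda>t. \<Sum>i=1..N. - (((x(j := t)) i)\<^sup>2) / 2) has_real_derivative (\<Sum>i=1..N. if i = j then - x j else 0)) (at (x j))"
  proof (rule DERIV_sum)
    fix i
    show "((\<lambda>t. - (((x(j := t)) i)\<^sup>2) / 2) has_real_derivative (if i = j then - x j else 0)) (at (x j))"
      by (cases "i = j") (auto intro!: derivative_eq_intros)
  qed
  define f where "f = (\<lambda>k. lam / (x j - x k))"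
  have 2: "((\<lambda>t. \<Sum>p\<in>index_pairs N. lam * ln ((x(j := t)) (snd p) - (x(j := t)) (fst p))) has_real_derivative
      (\<Sum>p\<in>index_pairs N. if fst p = j then f (snd p) else if snd p = j then f (fst p) else 0)) (at (x j))"
  proof (rule DERIV_sum)
    fix p assume p: "p \<in> index_pairs N"
    then have lt: "x (fst p) < x (snd p)" and ne: "fst p \<noteq> snd p"
      using x by (auto simp: ordered_on_def index_pairs_def)
    consider "fst p = j" "snd p \<noteq> j" | "snd p = j" "fst p \<noteq> j" | "fst p \<noteq> j" "snd p \<noteq> j" using ne by auto
    then show "((\<lambda>t. lam * ln ((x(j := t)) (snd p) - (x(j := t)) (fst p))) has_real_derivative
      (if fst p = j then f (snd p) else if snd p = j then f (fst p) else 0)) (at (x j))"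
    proof cases
      case 1
      have "((\<lambda>t. lam * ln (x (snd p) - t)) has_real_derivative lam * (- 1 / (x (snd p) - x j))) (at (x j))"
        using lt 1 by (auto intro!: derivative_eq_intros)
      moreover have "lam * (- 1 / (x (snd p) - x j)) = f (snd p)"
        using lt 1 by (simp add: f_def field_simps)
      ultimately show ?thesis using 1 by simp
    next
      case 2
      have "((\<lambda>t. lam * ln (t - x (fst p))) has_real_derivative lam * (1 / (x j - x (fst p)))) (at (x j))"
        using lt 2 by (auto intro!: derivative_eq_intros)
      then show ?thesis using 2 by (simp add: f_def)
    qed simp
  qed
  have "(\<Sum>p\<in>index_pairs N. if fst p = j then f (snd p) else if snd p = j then f (fst p) else 0)
    = (\<Sum>k=1..N. if j < k then f k else if k < j then f k else 0)"
    using sum_index_pairs_incident[OF j, of f f] by (simp add: case_prod_beta)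
  also have "\<dots> = (\<Sum>k=1..N. f k)"
    by (intro sum.cong) (auto simp: f_def not_less dest: antisym)
  finally show ?thesis
    using DERIV_add[OF 1 2] j by (simp add: psi0_log_def psi0_drift_def f_def)
qed

lemma psi0_deriv:
  assumes x: "ordered_on N x" and j: "j \<in> {1..N}"
  shows "((\<lambda>t. psi0 N lam (x(j := t))) has_real_derivative psi0 N lam x * psi0_drift N lam x j) (at (x j))"
proof -
  have "((\<lambda>t. exp (psi0_log N lam (x(j := t)))) has_real_derivative
      exp (psi0_log N lam (x(j := x j))) * psi0_drift N lam x j) (at (x j))"
    by (rule DERIV_fun_exp[OF psi0_log_deriv[OF x j]])
  moreover have "eventually (\<lambda>t. psi0 N lam (x(j := t)) = exp (psi0_log N lam (x(j := t)))) (nhds (x j))"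
    using eventually_ordered_on[OF x, of j] by eventually_elim (rule psi0_eq_exp)
  ultimately show ?thesis
    unfolding psi0_eq_exp[OF x] by (simp add: DERIV_cong_ev)
qed

lemma psi0_drift_deriv:
  assumes x: "ordered_on N x" and j: "j \<in> {1..N}"
  shows "((\<lambda>t. psi0_drift N lam (x(j := t)) j) has_real_derivative
    - 1 - (\<Sum>k=1..N. lam / (x j - x k)\<^sup>2)) (at (x j))"
proof -
  have "((\<lambda>t. \<Sum>k=1..N. lam / ((x(j := t)) j - (x(j := t)) k)) has_real_derivative
      (\<Sum>k=1..N. - (lam / (x j - x k)\<^sup>2))) (at (x j))"
  proof (rule DERIV_sum)
    fix k assume k: "k \<in> {1..N}"
    show "((\<lambda>t. lam / ((x(j := t)) j - (x(j := t)) k)) has_real_derivative - (lam / (x j - x k)\<^sup>2)) (at (x j))"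
    proof (cases "k = j")
      case False
      then have "j < k \<or> k < j" by auto
      then have "x j - x k \<noteq> 0"
        using x j k unfolding ordered_on_def index_pairs_def by force
      with False show ?thesis by (auto intro!: derivative_eq_intros simp: power2_eq_square)
    qed simp
  qed
  from DERIV_add[OF DERIV_minus[OF DERIV_ident] this] show ?thesis
    by (simp add: psi0_drift_def sum_negf)
qed

text \<open>With w the logarithmic derivative of the ground state, differentiating twice gives the
  factor w^2 + w' on P, 2 w on its first derivative and 1 on its second.\<close>

lemma partial2_psi0_mult:
  assumes P: "coordinatewise_poly P" and x: "ordered_on N x" and j: "j \<in> {1..N}"
  shows "partial2 j (\<lambda>y. psi0 N lam y * P y) x = psi0 N lam x
    * (((psi0_drift N lam x j)\<^sup>2 - 1 - (\<Sum>k=1..N. lam / (x j - x k)\<^sup>2)) * P x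
       + 2 * psi0_drift N lam x j * partial1 j P x + partial2 j P x)"
proof -
  define w where "w = (\<lambda>t. psi0_drift N lam (x(j := t)) j)"
  define w' where "w' = - 1 - (\<Sum>k=1..N. lam / (x j - x k)\<^sup>2)"
  have d1: "((\<lambda>z. psi0 N lam (x(j := z)) * P (x(j := z))) has_real_derivative
      psi0 N lam (x(j := t)) * (w t * P (x(j := t)) + partial1 j P (x(j := t)))) (at t)"
    if t: "ordered_on N (x(j := t))" for t
  proof -
    have "((\<lambda>z. psi0 N lam (x(j := z))) has_real_derivative psi0 N lam (x(j := t)) * w t) (at t)"
      using psi0_deriv[OF t j, of lam] by (simp add: w_def)
    from DERIV_mult[OF this partial1_deriv[OF P, of x j t]]
    show ?thesis by (simp add: algebra_simps)
  qed
  have ev: "eventually (\<lambda>t. deriv (\<lambda>z. psi0 N lam (x(j := z)) * P (x(j := z))) t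
      = psi0 N lam (x(j := t)) * (w t * P (x(j := t)) + partial1 j P (x(j := t)))) (nhds (x j))"
    using eventually_ordered_on[OF x, of j] by eventually_elim (rule DERIV_imp_deriv[OF d1])
  have P1: "((\<lambda>t. P (x(j := t))) has_real_derivative partial1 j P x) (at (x j))"
    using partial1_deriv[OF P, of x j "x j"] by simp
  have P2: "((\<lambda>t. partial1 j P (x(j := t))) has_real_derivative partial2 j P x) (at (x j))"
    using partial2_deriv[OF P, of j x "x j"] by simp
  have W: "(w has_real_derivative w') (at (x j))"
    unfolding w_def w'_def by (rule psi0_drift_deriv[OF x j])
  have "((\<lambda>t. psi0 N lam (x(j := t)) * (w t * P (x(j := t)) + partial1 j P (x(j := t)))) has_real_derivative
      psi0 N lam x * w (x j) * (w (x j) * P x + partial1 j P x)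
       + (w' * P x + partial1 j P x * w (x j) + partial2 j P x) * psi0 N lam x) (at (x j))"
    using DERIV_mult[OF psi0_deriv[OF x j, of lam] DERIV_add[OF DERIV_mult[OF W P1] P2]]
    by (simp add: w_def)
  then have "((deriv (\<lambda>z. psi0 N lam (x(j := z)) * P (x(j := z)))) has_real_derivative
      psi0 N lam x * w (x j) * (w (x j) * P x + partial1 j P x)
       + (w' * P x + partial1 j P x * w (x j) + partial2 j P x) * psi0 N lam x) (at (x j))"
    using ev by (simp add: DERIV_cong_ev)
  then have "partial2 j (\<lambda>y. psi0 N lam y * P y) x
    = psi0 N lam x * w (x j) * (w (x j) * P x + partial1 j P x)
       + (w' * P x + partial1 j P x * w (x j) + partial2 j P x) * psi0 N lam x"
    unfolding partial2_def by (rule DERIV_imp_deriv)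
  then show ?thesis by (simp add: w_def w'_def algebra_simps power2_eq_square)
qed

text \<open>The ground state is an exact eigenfunction because the squares of the drift contain no
  three-body terms. What survives on P is a constant, and the first-order terms assemble into
  \<open>reduced_H\<close>.\<close>

lemma calogero_H_psi0_mult:
  assumes P: "coordinatewise_poly P" and x: "ordered_on N x"
  shows "calogero_H N lam (\<lambda>y. psi0 N lam y * P y) x
    = psi0 N lam x * (reduced_H N lam P x + real N * (1 + lam * (real N - 1)) * P x)"
proof -
  define S where "S = (\<lambda>j k. 1 / (x j - x k))"
  define s where "s = (\<lambda>j. \<Sum>k=1..N. S j k)"
  define q where "q = (\<lambda>j. \<Sum>k=1..N. (S j k)\<^sup>2)"
  define SP where "SP = (\<Sum>(j, k)\<in>index_pairs N. 1 / (x j - x k)^2)"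
  have ne: "x j \<noteq> x k" if "j \<in> {1..N}" "k \<in> {1..N}" "j \<noteq> k" for j k
  proof -
    have "(j, k) \<in> index_pairs N \<or> (k, j) \<in> index_pairs N" using that by (auto simp: index_pairs_def)
    then show ?thesis using x unfolding ordered_on_def by force
  qed
  have nep: "x (fst p) - x (snd p) \<noteq> 0" "x (snd p) - x (fst p) \<noteq> 0" if "p \<in> index_pairs N" for p
    using x that unfolding ordered_on_def by force+
  have S0: "S j j = 0" for j by (simp add: S_def)
  \<comment> \<open>Each pair contributes x_j/(x_j - x_k) + x_k/(x_k - x_j) = 1; the number of pairs
    is obtained from the symmetric double sum of the constant 1. This gives the part lam N (N - 1)
    of the ground state energy.\<close>
  have xs: "2 * (\<Sum>j=1..N. x j * s j) = real N * (real N - 1)"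
  proof -
    have c: "(\<Sum>j=1..N. \<Sum>k=1..N. 1::real) = 2 * (\<Sum>(j, k)\<in>index_pairs N. 1) + (\<Sum>j=1..N. 1)"
      by (rule sum_index_pairs_symmetric) simp
    have "(\<Sum>j=1..N. x j * s j) = (\<Sum>j=1..N. \<Sum>k=1..N. x j * S j k)"
      by (simp add: s_def sum_distrib_left)
    also have "\<dots> = (\<Sum>(j, k)\<in>index_pairs N. x j * S j k + x k * S k j)"
      unfolding sum_square_index_pairs by (simp add: S0)
    also have "\<dots> = (\<Sum>(j, k)\<in>index_pairs N. 1)"
    proof (intro sum.cong refl)
      fix p assume p: "p \<in> index_pairs N"
      have "x (fst p) * S (fst p) (snd p) + x (snd p) * S (snd p) (fst p) = 1"
        using nep[OF p] by (simp add: S_def divide_simps) (simp add: algebra_simps)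
      then show "(case p of (j, k) \<Rightarrow> x j * S j k + x k * S k j) = (case p of (j, k) \<Rightarrow> 1)"
        by (simp add: case_prod_beta)
    qed
    finally show ?thesis using c by (simp add: algebra_simps)
  qed
  have ss: "(\<Sum>j=1..N. (s j)\<^sup>2) = (\<Sum>j=1..N. q j)"
    unfolding s_def q_def
  proof (rule sum_square_triple)
    fix j k l assume jkl: "j \<in> {1..N}" "k \<in> {1..N}" "l \<in> {1..N}" "j \<noteq> k" "j \<noteq> l" "k \<noteq> l"
    define a b where "a = x j - x k" and "b = x k - x l"
    have "a \<noteq> 0" "b \<noteq> 0" "a + b \<noteq> 0"
      using ne[of j k] ne[of k l] ne[of j l] jkl by (auto simp: a_def b_def)
    then have "1 / a * (1 / (a + b)) + 1 / (- a) * (1 / b) + 1 / (- (a + b)) * (1 / (- b)) = 0"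
      by (simp add: divide_simps)
    moreover have "x j - x k = a" "x j - x l = a + b" "x k - x j = - a" "x k - x l = b"
      "x l - x k = - b" "x l - x j = - (a + b)"
      by (auto simp: a_def b_def)
    ultimately show "S j k * S j l + S k j * S k l + S l j * S l k = 0"
      unfolding S_def by (simp only:)
  next
    show "S k j = - S j k" for j k
      unfolding S_def by (metis minus_diff_eq minus_divide_right)
  qed (auto simp: S0)
  have qSP: "(\<Sum>j=1..N. q j) = 2 * SP"
    unfolding q_def SP_def
    by (subst sum_index_pairs_symmetric) (simp_all add: S_def power_divide power2_commute)
  have sP: "(\<Sum>j=1..N. s j * p j) = (\<Sum>(j, k)\<in>index_pairs N. (p j - p k) / (x j - x k))" for p
  proof -
    have "(\<Sum>j=1..N. s j * p j) = (\<Sum>j=1..N. \<Sum>k=1..N. S j k * p j)"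
      by (simp add: s_def sum_distrib_right)
    also have "\<dots> = (\<Sum>(j, k)\<in>index_pairs N. S j k * p j + S k j * p k)"
      unfolding sum_square_index_pairs by (simp add: S0)
    also have "\<dots> = (\<Sum>(j, k)\<in>index_pairs N. (p j - p k) / (x j - x k))"
    proof (intro sum.cong refl)
      fix y assume y: "y \<in> index_pairs N"
      have "S (fst y) (snd y) * p (fst y) + S (snd y) (fst y) * p (snd y) = (p (fst y) - p (snd y)) / (x (fst y) - x (snd y))"
        using nep[OF y] by (simp add: S_def divide_simps) (simp add: algebra_simps)
      then show "(case y of (j, k) \<Rightarrow> S j k * p j + S k j * p k) = (case y of (j, k) \<Rightarrow> (p j - p k) / (x j - x k))"
        by (simp add: case_prod_beta)
    qed
    finally show ?thesis .
  qed
  have w: "psi0_drift N lam x j = - x j + lam * s j" for j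
    by (simp add: psi0_drift_def s_def S_def sum_distrib_left)
  have w': "(\<Sum>k=1..N. lam / (x j - x k)\<^sup>2) = lam * q j" for j
    by (simp add: q_def S_def sum_distrib_left power_divide)
  have trm: "- partial2 j (\<lambda>y. psi0 N lam y * P y) x + (x j)^2 * (psi0 N lam x * P x)
    = psi0 N lam x * ((1 + lam * q j + 2 * lam * (x j * s j) - lam * lam * (s j)\<^sup>2) * P x
        + 2 * (x j * partial1 j P x) - 2 * lam * (s j * partial1 j P x) - partial2 j P x)"
    if j: "j \<in> {1..N}" for j
    unfolding partial2_psi0_mult[OF P x j] w w' by (simp add: algebra_simps power2_eq_square)
  have "calogero_H N lam (\<lambda>y. psi0 N lam y * P y) x
    = (\<Sum>j=1..N. psi0 N lam x * ((1 + lam * q j + 2 * lam * (x j * s j) - lam * lam * (s j)\<^sup>2) * P x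
        + 2 * (x j * partial1 j P x) - 2 * lam * (s j * partial1 j P x) - partial2 j P x))
      + 2 * lam * (lam - 1) * SP * (psi0 N lam x * P x)"
    unfolding calogero_H_def SP_def by (intro arg_cong2[of _ _ _ _ "(+)"] sum.cong refl trm)
  also have "(\<Sum>j=1..N. psi0 N lam x * ((1 + lam * q j + 2 * lam * (x j * s j) - lam * lam * (s j)\<^sup>2) * P x
        + 2 * (x j * partial1 j P x) - 2 * lam * (s j * partial1 j P x) - partial2 j P x))
    = psi0 N lam x * ((real N + lam * (\<Sum>j=1..N. q j) + 2 * lam * (\<Sum>j=1..N. x j * s j)
          - lam * lam * (\<Sum>j=1..N. (s j)\<^sup>2)) * P x
        + 2 * (\<Sum>j=1..N. x j * partial1 j P x) - 2 * lam * (\<Sum>j=1..N. s j * partial1 j P x)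
        - (\<Sum>j=1..N. partial2 j P x))"
    by (simp add: sum.distrib sum_subtractf sum_distrib_left sum_distrib_right distrib_right left_diff_distrib
        distrib_left right_diff_distrib mult_ac)
  \<comment> \<open>The remaining lam - lam^2 times the sum of q equals -2 lam (lam - 1) SP and
    cancels the interaction of the Hamiltonian.\<close>
  also have "real N + lam * (\<Sum>j=1..N. q j) + 2 * lam * (\<Sum>j=1..N. x j * s j)
          - lam * lam * (\<Sum>j=1..N. (s j)\<^sup>2)
     = real N * (1 + lam * (real N - 1)) - 2 * lam * (lam - 1) * SP"
  proof -
    have "2 * lam * (\<Sum>j=1..N. x j * s j) = lam * (real N * (real N - 1))"
      unfolding xs [symmetric] by simp
    then show ?thesis unfolding ss qSP by (simp add: algebra_simps)
  qed
  finally show ?thesis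
    unfolding sP reduced_H_def by (simp add: algebra_simps)
qed

theorem theorem3p1:
  fixes N :: nat and lam :: real and n :: "nat \<Rightarrow> int"
  assumes "1 \<le> N" and "0 < lam"
  shows "reduced_polynomial_eigenfunction N lam (calogero_P N lam n) (calogero_E N lam n)"
  unfolding reduced_polynomial_eigenfunction_def
proof (intro conjI allI impI)
  fix x :: "nat \<Rightarrow> real" assume x: "strict_mono_on {1..N} x"
  have lt: "x i < x k" if "(i, k) \<in> index_pairs N" for i k
    using x that by (auto simp: index_pairs_def strict_mono_on_def)
  then have "ordered_on N x" by (auto simp: ordered_on_def)
  then have "calogero_H N lam (\<lambda>y. psi0 N lam y * calogero_P N lam n y) x
    = psi0 N lam x * (reduced_H N lam (calogero_P N lam n) x
        + real N * (1 + lam * (real N - 1)) * calogero_P N lam n x)"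
    by (intro calogero_H_psi0_mult coordinatewise_poly_calogero_P)
  also have "reduced_H N lam (calogero_P N lam n) x = 2 * of_int (\<Sum>j=1..N. n j) * calogero_P N lam n x"
    by (rule reduced_H_calogero_P) (use lt in force)
  finally show "calogero_H N lam (\<lambda>y. psi0 N lam y * calogero_P N lam n y) x
    = calogero_E N lam n * (psi0 N lam x * calogero_P N lam n x)"
    by (simp add: calogero_E_def algebra_simps)
qed (rule polynomial_in_calogero_P symmetric_in_calogero_P)+

end
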